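(* Let $\delta\ge 1$ and $c>\delta$ be constant integers. Let $k$ be a power of $2$ with $k>\lceil k/\log k\rceil + c$. Let $\mathbf u\in\{0,1\}^k$ have i.i.d. Bernoulli$(1/2)$ components, and let $\mathbf x\in\{0,1\}^n$ be its encoding by the Guess & Check (GC) code with parameters $(k,\delta,c)$ (defined in the context). Then, using the GC decoder (defined in the context), the GC code can correct in polynomial time up to $\delta$ deletions occurring at uniformly random positions within $\mathbf x$ (that is, the decoder outputs $\mathbf u$ unless it declares a decoding failure), and the following hold, where the asymptotics are as $k\to\infty$ with $\delta$ and $c$ fixed: 1. Redundancy: $n-k=c(\delta+1)\log k$ bits. 2. The encoding complexity is $\mathcal O(k\log k)$, and the decoding complexity is $\mathcal O\!\left(\dfrac{k^{\delta+2}}{\log^{\delta}k}\right)$. 3. The probability $Pr(F)$ that the decoder declares a decoding failure, taken over the random message $\mathbf u$ and the random deletion positions, satisfies $$Pr(F)=\mathcal O\!\left(\frac{k^{2\delta-c}}{\log^{\delta}k}\right).$$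
   Context: All logarithms are base $2$. $k$ and $n$ are the lengths in bits of the message and of the codeword. A deletion removes a bit from the transmitted string completely; the receiver sees the shortened string and does not know the locations of the deleted bits. The deletion positions are uniformly random and independent of $\mathbf u$. Complexity means the number of elementary operations. Write $m=\lceil k/\log k\rceil$ (informally $k/\log k$) and $q=k$, so that $GF(q)$ is a field of characteristic $2$ whose elements are identified with binary strings of length $\log k$ via a fixed basis over $GF(2)$. **GC encoder** with parameters $(k,\delta,c)$: - (I) The message $\mathbf u\in\{0,1\}^k$ is chunked into $m$ adjacent blocks of $\log k$ bits each (if $\log k$ does not divide $k$, the last block is completed with zeros, which are known to the decoder and not transmitted). Each block is mapped to its symbol in $GF(q)$, giving $\mathbf U\in GF(q)^m$. - (II) $\mathbf U$ is encoded with a systematic $(m+c,m)$ MDS code over $GF(q)$, giving $\mathbf X=(\mathbf U,p_1,\dots,p_c)$, where $p_1,\dots,p_c\in GF(q)$ are the parity symbols, $p_r=\mathbf G_r^T\mathbf U$ for fixed encoding vectors $\mathbf G_r\in GF(q)^m$. - (III) The symbols are mapped back to their binary representations, giving the $k$ systematic bits $\mathbf u$ followed by $c\log k$ parity bits. - (IV) Each parity bit (and no systematic bit) is repeated $\delta+1$ times consecutively. The result is the codeword $\mathbf x$ of length $n$. **GC decoder**, applied to the string $\mathbf y$ received after at most $\delta$ deletions: - (1) The parity symbols $p_1,\dots,p_c$ are recovered from the end of $\mathbf y$ using the $(\delta+1)$-repetition code: the last $c(\delta+1)\log k-\delta$ bits of $\mathbf y$ are the repeated parity bits with exactly $\delta$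 bits deleted, which determines the parity bits. In the remaining steps the decoder works as if exactly $\delta$ deletions occurred and all of them were in the systematic bits: it uses the first $k-\delta$ bits of $\mathbf y$, which are obtained from $\mathbf u$ by deleting exactly $\delta$ bits (followed by the known padding zeros, if any). - (2) Guessing: a case is a way to distribute $\delta$ deletions among the $m$ blocks, i.e. a tuple $(d_1,\dots,d_m)$ of nonnegative integers with $\sum_j d_j=\delta$. There are $t=\binom{m+\delta-1}{\delta}$ cases. The decoder goes through all of them. - (3) Checking: in each case $i=1,\dots,t$ the decoder chunks the string of step (1) into consecutive sub-blocks of lengths $\log k-d_j$, $j=1,\dots,m$. It treats the symbols of blocks with $d_j>0$ as erased and maps the other blocks to their symbols in $GF(q)$. It decodes the erasures (at most $\delta$ of them) over $GF(q)$ using the first $\delta$ parities $p_1,\dots,p_\delta$, obtaining a decoded string in $GF(q)^m$. Case $i$ is called *possible* if both of the following hold. Criterion 1: the decoded $q$-ary string satisfies the last $c-\delta$ parities $p_{\delta+1},\dots,p_c$ simultaneously. Criterion 2: the binary representation of each decoded erasure is a supersequence of its corresponding received sub-block. (A binary string $\mathbf a$ is a supersequence of $\mathbf b$ if $\mathbf b$ can be obtained from $\mathbf a$ by deleting bits.) - (4) If there is exactly one possible case, or there are several possible cases all leading to the same decoded string, the decoder declares success and outputs that string (in binary). Otherwise it declares a decoding failure; this event is denoted $F$. *)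

theory Defs
  imports
    "HOL-Probability.Probability"
    "HOL-Algebra.Ring"
    "HOL-Library.Sublist"
    "HOL-Library.Landau_Symbols"
    "HOL-Library.Monad_Syntax"
begin

section \<open>Parameters, symbols and MDS codes\<close>

(* Exact base-2 logarithm for the powers of two to which it is applied. *)
definition lg :: "nat \<Rightarrow> nat" where
  "lg k = nat \<lfloor>log 2 (real k)\<rfloor>"

definition nblocks :: "nat \<Rightarrow> nat" where
  "nblocks k = nat \<lceil>real k / log 2 (real k)\<rceil>"

definition symbol :: "'a ring \<Rightarrow> 'a list \<Rightarrow> bool list \<Rightarrow> 'a" where
  "symbol R B bs =
     (\<Oplus>\<^bsub>R\<^esub>i\<in>{..<length B}. if bs ! i then B ! i else \<zero>\<^bsub>R\<^esub>)"

(* Every element of R is a unique combination of B with coefficients in {0,1}; for R of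
   characteristic 2 this says that B is a basis of R over its subfield GF(2). *)
definition binary_basis :: "'a ring \<Rightarrow> 'a list \<Rightarrow> bool" where
  "binary_basis R B \<longleftrightarrow> set B \<subseteq> carrier R \<and>
     bij_betw (symbol R B) {bs. length bs = length B} (carrier R)"

definition bits :: "'a ring \<Rightarrow> 'a list \<Rightarrow> 'a \<Rightarrow> bool list" where
  "bits R B = the_inv_into {bs. length bs = length B} (symbol R B)"

definition hamming :: "'a list \<Rightarrow> 'a list \<Rightarrow> nat" where
  "hamming xs ys = card {i. i < length xs \<and> xs ! i \<noteq> ys ! i}"

definition min_dist :: "'a list set \<Rightarrow> nat" where
  "min_dist C = Min {hamming x y | x y. x \<in> C \<and> y \<in> C \<and> x \<noteq> y}"

(* Equality in the Singleton bound for a code of length N with q^K codewords. *)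
definition mds_code :: "nat \<Rightarrow> nat \<Rightarrow> nat \<Rightarrow> 'a list set \<Rightarrow> bool" where
  "mds_code q N K C \<longleftrightarrow> (\<forall>x\<in>C. length x = N) \<and> card C = q ^ K \<and> min_dist C = N - K + 1"

definition parity :: "'a ring \<Rightarrow> (nat \<Rightarrow> 'a) \<Rightarrow> 'a list \<Rightarrow> 'a" where
  "parity R g U = (\<Oplus>\<^bsub>R\<^esub>j\<in>{..<length U}. g j \<otimes>\<^bsub>R\<^esub> U ! j)"

definition systematic_code :: "'a ring \<Rightarrow> (nat \<Rightarrow> nat \<Rightarrow> 'a) \<Rightarrow> nat \<Rightarrow> nat \<Rightarrow> 'a list set" where
  "systematic_code R G m c =
     {U @ map (\<lambda>r. parity R (G r) U) [0..<c] | U. length U = m \<and> set U \<subseteq> carrier R}"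

(* The data fixed by the code designer: R is GF(k), B its basis over GF(2), and
   G r (for r < c) the encoding vector of the (r+1)-st parity symbol. *)
definition gc_code ::
  "'a ring \<Rightarrow> 'a list \<Rightarrow> (nat \<Rightarrow> nat \<Rightarrow> 'a) \<Rightarrow> nat \<Rightarrow> nat \<Rightarrow> bool" where
  "gc_code R B G k c \<longleftrightarrow> field R \<and> card (carrier R) = k \<and>
     binary_basis R B \<and> length B = lg k \<and>
     (\<forall>r<c. \<forall>j<nblocks k. G r j \<in> carrier R) \<and>
     mds_code k (nblocks k + c) (nblocks k) (systematic_code R G (nblocks k) c)"


section \<open>Guess and Check codes\<close>

definition padding :: "nat \<Rightarrow> bool list" where
  "padding k = replicate (nblocks k * lg k - k) False"

(* Block number j of a string of consecutive blocks of length l. *)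
definition block :: "nat \<Rightarrow> 'b list \<Rightarrow> nat \<Rightarrow> 'b list" where
  "block l xs j = take l (drop (j * l) xs)"

definition repeat_bits :: "nat \<Rightarrow> bool list \<Rightarrow> bool list" where
  "repeat_bits r bs = concat (map (replicate r) bs)"

definition message_symbols :: "'a ring \<Rightarrow> 'a list \<Rightarrow> nat \<Rightarrow> bool list \<Rightarrow> 'a list" where
  "message_symbols R B k u =
     map (\<lambda>j. symbol R B (block (lg k) (u @ padding k) j)) [0..<nblocks k]"

definition gc_encode ::
  "'a ring \<Rightarrow> 'a list \<Rightarrow> (nat \<Rightarrow> nat \<Rightarrow> 'a) \<Rightarrow> nat \<Rightarrow> nat \<Rightarrow> nat \<Rightarrow> bool list \<Rightarrow> bool list" where
  "gc_encode R B G k \<delta> c u =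
     (let U = message_symbols R B k u;
          p = map (\<lambda>r. parity R (G r) U) [0..<c]
      in u @ repeat_bits (\<delta> + 1) (concat (map (bits R B) p)))"

definition delete_at :: "nat set \<Rightarrow> 'b list \<Rightarrow> 'b list" where
  "delete_at D xs = nths xs (- D)"

definition recovered_parities ::
  "'a ring \<Rightarrow> 'a list \<Rightarrow> nat \<Rightarrow> nat \<Rightarrow> nat \<Rightarrow> bool list \<Rightarrow> 'a list" where
  "recovered_parities R B k \<delta> c y =
     (let z = drop (length y - (c * (\<delta> + 1) * lg k - \<delta>)) y;
          b = (THE b. length b = c * lg k \<and> subseq z (repeat_bits (\<delta> + 1) b))
      in map (\<lambda>r. symbol R B (block (lg k) b r)) [0..<c])"

definition received_systematic :: "nat \<Rightarrow> nat \<Rightarrow> bool list \<Rightarrow> bool list" where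
  "received_systematic k \<delta> y = take (k - \<delta>) y @ padding k"

definition deletion_cases :: "nat \<Rightarrow> nat \<Rightarrow> nat list set" where
  "deletion_cases m \<delta> = {d. length d = m \<and> sum_list d = \<delta>}"

definition subblock :: "nat \<Rightarrow> nat list \<Rightarrow> 'b list \<Rightarrow> nat \<Rightarrow> 'b list" where
  "subblock l d s j = take (l - d ! j) (drop (\<Sum>i<j. l - d ! i) s)"

(* Y is the result of decoding the erasures of case d from the first \<delta> parities p of the
   received string s. If these parities are inconsistent with s, there is no such Y. *)
definition erasure_decoded ::
  "'a ring \<Rightarrow> 'a list \<Rightarrow> (nat \<Rightarrow> nat \<Rightarrow> 'a) \<Rightarrow> nat \<Rightarrow> nat \<Rightarrow>
   'a list \<Rightarrow> bool list \<Rightarrow> nat list \<Rightarrow> 'a list \<Rightarrow> bool" where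
  "erasure_decoded R B G k \<delta> p s d Y \<longleftrightarrow>
     length Y = nblocks k \<and> set Y \<subseteq> carrier R \<and>
     (\<forall>j<nblocks k. d ! j = 0 \<longrightarrow> Y ! j = symbol R B (subblock (lg k) d s j)) \<and>
     (\<forall>r<\<delta>. parity R (G r) Y = p ! r)"

(* The first conjunct discards the cases which would need a sub-block of negative length. *)
definition possible_case ::
  "'a ring \<Rightarrow> 'a list \<Rightarrow> (nat \<Rightarrow> nat \<Rightarrow> 'a) \<Rightarrow> nat \<Rightarrow> nat \<Rightarrow> nat \<Rightarrow>
   'a list \<Rightarrow> bool list \<Rightarrow> nat list \<Rightarrow> 'a list \<Rightarrow> bool" where
  "possible_case R B G k \<delta> c p s d Y \<longleftrightarrow>
     (\<forall>j<nblocks k. d ! j \<le> lg k) \<and>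
     erasure_decoded R B G k \<delta> p s d Y \<and>
     (\<forall>r. \<delta> \<le> r \<and> r < c \<longrightarrow> parity R (G r) Y = p ! r) \<and>
     (\<forall>j<nblocks k. d ! j > 0 \<longrightarrow> subseq (subblock (lg k) d s j) (bits R B (Y ! j)))"

(* None is a declared decoding failure. *)
definition gc_decode ::
  "'a ring \<Rightarrow> 'a list \<Rightarrow> (nat \<Rightarrow> nat \<Rightarrow> 'a) \<Rightarrow> nat \<Rightarrow> nat \<Rightarrow> nat \<Rightarrow> bool list \<Rightarrow> bool list option"
where
  "gc_decode R B G k \<delta> c y =
     (let p = recovered_parities R B k \<delta> c y;
          s = received_systematic k \<delta> y;
          Ys = {Y. \<exists>d\<in>deletion_cases (nblocks k) \<delta>. possible_case R B G k \<delta> c p s d Y}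
      in if \<exists>Y. Ys = {Y} then Some (take k (concat (map (bits R B) (the_elem Ys)))) else None)"


section \<open>Programs with operation counts\<close>

text \<open>
  Encoder and decoder as functional programs over bits. A computation carries its result together
  with its number of elementary operations. As in \<open>HOL-Library.Time_Commands\<close>, every call of a
  function below, recursive calls included, is charged one operation; the work done in a single
  call besides further calls is a bounded number of pattern matches, list constructors, Boolean
  connectives and arithmetic operations on indices. The parameters \<open>k\<close>, \<open>\<delta>\<close>, \<open>c\<close>, and with
  them \<open>lg k\<close> and \<open>nblocks k\<close>, are constants of the programs.
\<close>

datatype 'b counted = Counted (result: 'b) (ops: nat)

definition bind_counted :: "'b counted \<Rightarrow> ('b \<Rightarrow> 'd counted) \<Rightarrow> 'd counted" where
  "bind_counted a f = (let b = f (result a) in Counted (result b) (ops a + ops b))"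

adhoc_overloading Monad_Syntax.bind \<rightleftharpoons> bind_counted

definition step :: "'b \<Rightarrow> 'b counted" where
  "step x = Counted x 1"

subsection \<open>Lists\<close>

fun take_op :: "nat \<Rightarrow> 'b list \<Rightarrow> 'b list counted" where
  "take_op (Suc n) (x # xs) = do { ys \<leftarrow> take_op n xs; step (x # ys) }"
| "take_op _ _ = step []"

fun drop_op :: "nat \<Rightarrow> 'b list \<Rightarrow> 'b list counted" where
  "drop_op (Suc n) (x # xs) = do { ys \<leftarrow> drop_op n xs; step ys }"
| "drop_op _ xs = step xs"

fun append_op :: "'b list \<Rightarrow> 'b list \<Rightarrow> 'b list counted" where
  "append_op [] ys = step ys"
| "append_op (x # xs) ys = do { zs \<leftarrow> append_op xs ys; step (x # zs) }"

fun concat_op :: "'b list list \<Rightarrow> 'b list counted" where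
  "concat_op [] = step []"
| "concat_op (xs # xss) = do { ys \<leftarrow> concat_op xss; zs \<leftarrow> append_op xs ys; step zs }"

fun length_op :: "'b list \<Rightarrow> nat counted" where
  "length_op [] = step 0"
| "length_op (x # xs) = do { n \<leftarrow> length_op xs; step (Suc n) }"

fun replicate_op :: "nat \<Rightarrow> 'b \<Rightarrow> 'b list counted" where
  "replicate_op 0 x = step []"
| "replicate_op (Suc n) x = do { xs \<leftarrow> replicate_op n x; step (x # xs) }"

fun chunks_op :: "nat \<Rightarrow> nat \<Rightarrow> 'b list \<Rightarrow> 'b list list counted" where
  "chunks_op 0 l xs = step []"
| "chunks_op (Suc n) l xs = do {
     b \<leftarrow> take_op l xs; xs' \<leftarrow> drop_op l xs; bs \<leftarrow> chunks_op n l xs'; step (b # bs) }"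

fun repeat_op :: "nat \<Rightarrow> bool list \<Rightarrow> bool list counted" where
  "repeat_op r [] = step []"
| "repeat_op r (b # bs) = do {
     xs \<leftarrow> replicate_op r b; ys \<leftarrow> repeat_op r bs; zs \<leftarrow> append_op xs ys; step zs }"

fun equal_bits_op :: "bool list \<Rightarrow> bool list \<Rightarrow> bool counted" where
  "equal_bits_op [] [] = step True"
| "equal_bits_op (x # xs) (y # ys) = do { b \<leftarrow> equal_bits_op xs ys; step (x = y \<and> b) }"
| "equal_bits_op _ _ = step False"

fun equal_blocks_op :: "bool list list \<Rightarrow> bool list list \<Rightarrow> bool counted" where
  "equal_blocks_op [] [] = step True"
| "equal_blocks_op (x # xs) (y # ys) = do {
     a \<leftarrow> equal_bits_op x y; b \<leftarrow> equal_blocks_op xs ys; step (a \<and> b) }"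
| "equal_blocks_op _ _ = step False"

fun subseq_op :: "bool list \<Rightarrow> bool list \<Rightarrow> bool counted" where
  "subseq_op [] ys = step True"
| "subseq_op (x # xs) [] = step False"
| "subseq_op (x # xs) (y # ys) =
     do { b \<leftarrow> subseq_op (if x = y then xs else x # xs) ys; step b }"

subsection \<open>Binary linear algebra\<close>

type_synonym bit_matrix = "bool list list"  \<comment> \<open>list of rows\<close>

fun xor_op :: "bool list \<Rightarrow> bool list \<Rightarrow> bool list counted" where
  "xor_op (x # xs) (y # ys) = do { zs \<leftarrow> xor_op xs ys; step ((x \<noteq> y) # zs) }"
| "xor_op _ _ = step []"

fun dot_op :: "bool list \<Rightarrow> bool list \<Rightarrow> bool counted" where
  "dot_op (x # xs) (y # ys) = do { b \<leftarrow> dot_op xs ys; step ((x \<and> y) \<noteq> b) }"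
| "dot_op _ _ = step False"

fun mat_vec_op :: "bit_matrix \<Rightarrow> bool list \<Rightarrow> bool list counted" where
  "mat_vec_op [] v = step []"
| "mat_vec_op (r # rs) v = do { b \<leftarrow> dot_op r v; bs \<leftarrow> mat_vec_op rs v; step (b # bs) }"

fun parity_op :: "nat \<Rightarrow> bit_matrix list \<Rightarrow> bool list list \<Rightarrow> bool list counted" where
  "parity_op l (M # Ms) (b # bs) = do {
     x \<leftarrow> mat_vec_op M b; y \<leftarrow> parity_op l Ms bs; z \<leftarrow> xor_op x y; step z }"
| "parity_op l _ _ = do { z \<leftarrow> replicate_op l False; step z }"

fun parities_op :: "nat \<Rightarrow> bit_matrix list list \<Rightarrow> bool list list \<Rightarrow> bool list list counted" where
  "parities_op l [] bs = step []"
| "parities_op l (Ms # T) bs = do {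
     p \<leftarrow> parity_op l Ms bs; ps \<leftarrow> parities_op l T bs; step (p # ps) }"

type_synonym bit_equation = "bool list \<times> bool"  \<comment> \<open>coefficients and right-hand side\<close>

fun consistent_op :: "bit_equation list \<Rightarrow> bool counted" where
  "consistent_op [] = step True"
| "consistent_op ((a, b) # es) = do { ok \<leftarrow> consistent_op es; step (\<not> b \<and> ok) }"

(* Splits off the first equation in which the leading unknown occurs, without that unknown. *)
fun pivot_op :: "bit_equation list \<Rightarrow> (bit_equation option \<times> bit_equation list) counted" where
  "pivot_op [] = step (None, [])"
| "pivot_op ((a, b) # es) =
     (if a \<noteq> [] \<and> hd a then step (Some (tl a, b), es)
      else do { (q, es') \<leftarrow> pivot_op es; step (q, (a, b) # es') })"

fun eliminate_op :: "bit_equation \<Rightarrow> bit_equation list \<Rightarrow> bit_equation list counted" where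
  "eliminate_op q [] = step []"
| "eliminate_op q ((a, b) # es) = do {
     es' \<leftarrow> eliminate_op q es;
     if a \<noteq> [] \<and> hd a then do { a' \<leftarrow> xor_op (tl a) (fst q); step ((a', b \<noteq> snd q) # es') }
     else step ((tl a, b) # es') }"

(* Gaussian elimination over GF(2) for n unknowns; unknowns without a pivot are set to 0. *)
fun solve_op :: "nat \<Rightarrow> bit_equation list \<Rightarrow> bool list option counted" where
  "solve_op 0 es = do { ok \<leftarrow> consistent_op es; step (if ok then Some [] else None) }"
| "solve_op (Suc n) es = do {
     (q, es') \<leftarrow> pivot_op es;
     es'' \<leftarrow> eliminate_op (case q of None \<Rightarrow> ([], False) | Some e \<Rightarrow> e) es';
     sol \<leftarrow> solve_op n es'';
     (case sol of
        None \<Rightarrow> step None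
      | Some x \<Rightarrow> (case q of
            None \<Rightarrow> step (Some (False # x))
          | Some (a, b) \<Rightarrow> do { t \<leftarrow> dot_op a x; step (Some ((b \<noteq> t) # x)) })) }"

subsection \<open>Encoder\<close>

text \<open>
  Multiplication by a fixed element is linear over GF(2) in the basis \<open>B\<close>. The matrices of the
  multiplications by the entries of the fixed encoding vectors are part of the description of the
  code and are given to the programs as a table.
\<close>

definition mult_matrix :: "'a ring \<Rightarrow> 'a list \<Rightarrow> 'a \<Rightarrow> bit_matrix" where
  "mult_matrix R B g =
     map (\<lambda>i. map (\<lambda>b. bits R B (g \<otimes>\<^bsub>R\<^esub> b) ! i) B) [0..<length B]"

definition code_table ::
  "'a ring \<Rightarrow> 'a list \<Rightarrow> (nat \<Rightarrow> nat \<Rightarrow> 'a) \<Rightarrow> nat \<Rightarrow> nat \<Rightarrow> bit_matrix list list" where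
  "code_table R B G k c =
     map (\<lambda>r. map (\<lambda>j. mult_matrix R B (G r j)) [0..<nblocks k]) [0..<c]"

definition gc_encode_op ::
  "bit_matrix list list \<Rightarrow> nat \<Rightarrow> nat \<Rightarrow> bool list \<Rightarrow> bool list counted" where
  "gc_encode_op T k \<delta> u = do {
     z \<leftarrow> replicate_op (nblocks k * lg k - k) False;
     w \<leftarrow> append_op u z;
     bs \<leftarrow> chunks_op (nblocks k) (lg k) w;
     ps \<leftarrow> parities_op (lg k) T bs;
     p \<leftarrow> concat_op ps;
     r \<leftarrow> repeat_op (\<delta> + 1) p;
     x \<leftarrow> append_op u r;
     step x }"

subsection \<open>Decoder\<close>

(* Keeps every (\<delta>+1)-st bit, starting with the first. After \<delta> deletions, position i(\<delta>+1) still
   holds a copy of the i-th repeated bit. *)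
fun sample_op :: "nat \<Rightarrow> nat \<Rightarrow> bool list \<Rightarrow> bool list counted" where
  "sample_op \<delta> (Suc n) (b # z) = do {
     z' \<leftarrow> drop_op \<delta> z; bs \<leftarrow> sample_op \<delta> n z'; step (b # bs) }"
| "sample_op \<delta> _ _ = step []"

fun cons_all_op :: "'b \<Rightarrow> 'b list list \<Rightarrow> 'b list list counted" where
  "cons_all_op x [] = step []"
| "cons_all_op x (xs # xss) = do { yss \<leftarrow> cons_all_op x xss; step ((x # xs) # yss) }"

fun collect_op :: "(nat \<Rightarrow> 'b list counted) \<Rightarrow> nat \<Rightarrow> 'b list counted" where
  "collect_op f 0 = do { xs \<leftarrow> f 0; step xs }"
| "collect_op f (Suc n) = do {
     xs \<leftarrow> f (Suc n); ys \<leftarrow> collect_op f n; zs \<leftarrow> append_op xs ys; step zs }"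

(* All ways to distribute s deletions among m blocks. *)
primrec cases_op :: "nat \<Rightarrow> nat \<Rightarrow> nat list list counted" where
  "cases_op 0 s = step (if s = 0 then [[]] else [])"
| "cases_op (Suc m) s = do {
     ds \<leftarrow> collect_op (\<lambda>a. do { ds \<leftarrow> cases_op m (s - a); cons_all_op a ds }) s;
     step ds }"

fun all_le_op :: "nat \<Rightarrow> nat list \<Rightarrow> bool counted" where
  "all_le_op l [] = step True"
| "all_le_op l (a # d) = do { ok \<leftarrow> all_le_op l d; step (a \<le> l \<and> ok) }"

fun subblocks_op :: "nat \<Rightarrow> nat list \<Rightarrow> bool list \<Rightarrow> bool list list counted" where
  "subblocks_op l [] s = step []"
| "subblocks_op l (a # d) s = do {
     b \<leftarrow> take_op (l - a) s; s' \<leftarrow> drop_op (l - a) s; bs \<leftarrow> subblocks_op l d s'; step (b # bs) }"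

fun zero_erased_op :: "nat \<Rightarrow> nat list \<Rightarrow> bool list list \<Rightarrow> bool list list counted" where
  "zero_erased_op l (a # d) (b # bs) = do {
     bs' \<leftarrow> zero_erased_op l d bs;
     if a = 0 then step (b # bs')
     else do { z \<leftarrow> replicate_op l False; step (z # bs') } }"
| "zero_erased_op l _ _ = step []"

fun xor_blocks_op :: "bool list list \<Rightarrow> bool list list \<Rightarrow> bool list list counted" where
  "xor_blocks_op (x # xs) (y # ys) = do {
     z \<leftarrow> xor_op x y; zs \<leftarrow> xor_blocks_op xs ys; step (z # zs) }"
| "xor_blocks_op _ _ = step []"

fun join_rows_op :: "bit_matrix \<Rightarrow> bit_matrix \<Rightarrow> bit_matrix counted" where
  "join_rows_op (r # rs) (s # ss) = do {
     t \<leftarrow> append_op r s; ts \<leftarrow> join_rows_op rs ss; step (t # ts) }"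
| "join_rows_op _ _ = step []"

(* The matrices of the erased blocks side by side. *)
fun erased_columns_op :: "nat \<Rightarrow> nat list \<Rightarrow> bit_matrix list \<Rightarrow> bit_matrix counted" where
  "erased_columns_op l (a # d) (M # Ms) = do {
     N \<leftarrow> erased_columns_op l d Ms;
     if a = 0 then step N else do { N' \<leftarrow> join_rows_op M N; step N' } }"
| "erased_columns_op l _ _ = do { N \<leftarrow> replicate_op l []; step N }"

fun attach_op :: "bit_matrix \<Rightarrow> bool list \<Rightarrow> bit_equation list counted" where
  "attach_op (r # rs) (b # bs) = do { es \<leftarrow> attach_op rs bs; step ((r, b) # es) }"
| "attach_op _ _ = step []"

fun equations_op ::
  "nat \<Rightarrow> nat list \<Rightarrow> bit_matrix list list \<Rightarrow> bool list list \<Rightarrow> bit_equation list counted" where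
  "equations_op l d (Ms # T) (q # qs) = do {
     N \<leftarrow> erased_columns_op l d Ms; es \<leftarrow> attach_op N q;
     fs \<leftarrow> equations_op l d T qs; gs \<leftarrow> append_op es fs; step gs }"
| "equations_op l d _ _ = step []"

fun count_erased_op :: "nat list \<Rightarrow> nat counted" where
  "count_erased_op [] = step 0"
| "count_erased_op (a # d) = do { n \<leftarrow> count_erased_op d; step (if a = 0 then n else Suc n) }"

fun fill_op :: "nat list \<Rightarrow> bool list list \<Rightarrow> bool list list \<Rightarrow> bool list list counted" where
  "fill_op (a # d) (b # bs) xs = do {
     ys \<leftarrow> fill_op d bs (if a = 0 then xs else tl xs);
     step ((if a = 0 then b else hd xs) # ys) }"
| "fill_op _ _ _ = step []"

fun superseqs_op :: "nat list \<Rightarrow> bool list list \<Rightarrow> bool list list \<Rightarrow> bool counted" where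
  "superseqs_op (a # d) (b # bs) (y # ys) = do {
     ok \<leftarrow> superseqs_op d bs ys;
     if a = 0 then step ok else do { ok' \<leftarrow> subseq_op b y; step (ok' \<and> ok) } }"
| "superseqs_op _ _ _ = step True"

(* The decoded string of case d, split into blocks, if the case is possible. *)
definition check_op ::
  "bit_matrix list list \<Rightarrow> nat \<Rightarrow> nat \<Rightarrow> bool list list \<Rightarrow> bool list \<Rightarrow> nat list \<Rightarrow>
   bool list list option counted" where
  "check_op T l \<delta> ps s d = do {
     ok \<leftarrow> all_le_op l d;
     if \<not> ok then step None else do {
       bs \<leftarrow> subblocks_op l d s;
       zs \<leftarrow> zero_erased_op l d bs;
       qs \<leftarrow> parities_op l T zs;
       syn \<leftarrow> xor_blocks_op ps qs;
       T\<delta> \<leftarrow> take_op \<delta> T;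
       es \<leftarrow> equations_op l d T\<delta> syn;
       n \<leftarrow> count_erased_op d;
       sol \<leftarrow> solve_op (n * l) es;
       (case sol of
          None \<Rightarrow> step None
        | Some x \<Rightarrow> do {
            xs \<leftarrow> chunks_op n l x;
            Y \<leftarrow> fill_op d bs xs;
            T' \<leftarrow> drop_op \<delta> T;
            rs \<leftarrow> parities_op l T' Y;
            ps' \<leftarrow> drop_op \<delta> ps;
            criterion1 \<leftarrow> equal_blocks_op rs ps';
            criterion2 \<leftarrow> superseqs_op d bs Y;
            step (if criterion1 \<and> criterion2 then Some Y else None) }) } }"

fun check_all_op ::
  "bit_matrix list list \<Rightarrow> nat \<Rightarrow> nat \<Rightarrow> bool list list \<Rightarrow> bool list \<Rightarrow> nat list list \<Rightarrow>
   bool list list list counted" where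
  "check_all_op T l \<delta> ps s [] = step []"
| "check_all_op T l \<delta> ps s (d # ds) = do {
     r \<leftarrow> check_op T l \<delta> ps s d;
     Ys \<leftarrow> check_all_op T l \<delta> ps s ds;
     step (case r of None \<Rightarrow> Ys | Some Y \<Rightarrow> Y # Ys) }"

fun all_equal_op :: "bool list list \<Rightarrow> bool list list list \<Rightarrow> bool counted" where
  "all_equal_op Y [] = step True"
| "all_equal_op Y (Z # Zs) = do {
     a \<leftarrow> equal_blocks_op Y Z; b \<leftarrow> all_equal_op Y Zs; step (a \<and> b) }"

fun output_op :: "nat \<Rightarrow> bool list list list \<Rightarrow> bool list option counted" where
  "output_op k [] = step None"
| "output_op k (Y # Ys) = do {
     eq \<leftarrow> all_equal_op Y Ys;
     if eq then do { w \<leftarrow> concat_op Y; u \<leftarrow> take_op k w; step (Some u) } else step None }"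

definition gc_decode_op ::
  "bit_matrix list list \<Rightarrow> nat \<Rightarrow> nat \<Rightarrow> nat \<Rightarrow> bool list \<Rightarrow> bool list option counted" where
  "gc_decode_op T k \<delta> c y = do {
     n \<leftarrow> length_op y;
     z \<leftarrow> drop_op (n - (c * (\<delta> + 1) * lg k - \<delta>)) y;
     p \<leftarrow> sample_op \<delta> (c * lg k) z;
     ps \<leftarrow> chunks_op c (lg k) p;
     y' \<leftarrow> take_op (k - \<delta>) y;
     zeros \<leftarrow> replicate_op (nblocks k * lg k - k) False;
     s \<leftarrow> append_op y' zeros;
     ds \<leftarrow> cases_op (nblocks k) \<delta>;
     Ys \<leftarrow> check_all_op T (lg k) \<delta> ps s ds;
     r \<leftarrow> output_op k Ys;
     step r }"

end

theory Submission
  imports Defs "HOL-Algebra.Multiplicative_Group" "HOL-Real_Asymp.Real_Asymp"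
begin

text \<open>
  Fix the deleted positions. The decoder only uses the first \<open>k - \<delta>\<close> received bits, and these
  arise from the message \<open>u\<close> by deleting a set \<open>E\<close> of exactly \<open>\<delta>\<close> bits. So it suffices to count,
  for each guess \<open>d\<close>, the messages for which \<open>d\<close> is a possible case with a wrong decoded string \<open>Y\<close>.
  All parities of the difference of \<open>Y\<close> and the message symbols vanish, so the difference is
  determined by its symbols outside any given \<open>c\<close> blocks. In an unerased block, the bit of \<open>Y\<close> at
  position \<open>i\<close> is the bit of \<open>u\<close> at some position \<open>source i\<close>, and \<open>source\<close> is strictly increasing;
  therefore the sums \<open>u ! i + u ! source i\<close> over the misaligned positions
  (\<open>source i \<noteq> i\<close>), together with the bits of \<open>u\<close> at the other positions, determine \<open>u\<close>.

  Call a block free if it is erased or all its positions are misaligned. If there are at least \<open>c\<close>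
  free blocks, then choosing \<open>c\<close> of them, including the erased ones, saves a factor \<open>k\<close> for each of the at
  least \<open>c - \<delta>\<close> unerased ones: at most \<open>2 ^ k / k ^ (c - \<delta>)\<close> messages are bad for this guess.
  If there are fewer, then at least \<open>c + 1 - \<delta>\<close> blocks are still free, since at most \<open>\<delta>\<close> blocks are
  partly aligned and a nonzero difference touches more than \<open>c\<close> blocks; this gives a bound which is
  worse by a factor of at most \<open>k ^ (\<delta> - 1)\<close>. But in this case every erased block has distance at most
  \<open>c\<close> from a block in which a bit was deleted, so the number of such guesses is bounded independently of \<open>k\<close>.
\<close>

text \<open>The candidate \<open>Y\<close> of a wrong guess, the received string and the parities
  are all functions of \<open>u\<close>, so none of them can be fixed while the rest is treated as
  independent. Hence messages are counted, for one deletion set at a time, by an injective encoding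
  into fewer bits, and the law of the deletions never enters. Strict monotonicity of
  \<open>source\<close> is essential: sums \<open>u ! i + u ! source i\<close> along a cycle would
  lose information, but a strictly increasing self-map of a finite set has a fixed point, and
  misaligned positions have none. The padding is constant, so misaligned positions must be shown to
  lie in the message. The exponents come from a union bound: about
  \<open>(k / log k) ^ \<delta>\<close> guesses at \<open>k ^ (\<delta> - c)\<close> each give
  exactly the claimed order. The weaker bound \<open>k ^ (2 * \<delta> - c - 1)\<close> for few free
  blocks could not be multiplied by that many guesses when \<open>\<delta> > 1\<close>; multiplied
  by a constant it is absorbed, because \<open>log k ^ \<delta>\<close> is
  \<open>O(k)\<close>.\<close>

lemma result_bind [simp]: "result (bind_counted a f) = result (f (result a))"
  and ops_bind [simp]: "ops (bind_counted a f) = ops a + ops (f (result a))"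
  and result_step [simp]: "result (step x) = x"
  and ops_step [simp]: "ops (step x) = 1"
  by (simp_all add: bind_counted_def step_def Let_def)

section \<open>Results and operation counts of the list programs\<close>

lemma result_take_op [simp]: "result (take_op n xs) = take n xs"
  by (induction n xs rule: take_op.induct) auto

lemma ops_take_op: "ops (take_op n xs) \<le> n + 1"
  by (induction n xs rule: take_op.induct) auto

lemma result_drop_op [simp]: "result (drop_op n xs) = drop n xs"
  by (induction n xs rule: drop_op.induct) auto

lemma ops_drop_op: "ops (drop_op n xs) \<le> n + 1"
  by (induction n xs rule: drop_op.induct) auto

text \<open>A second bound, by the list instead of the index: the decoder drops by an index that
  depends on the length of the received string.\<close>

lemma ops_drop_op_length: "ops (drop_op n xs) \<le> length xs + 1"
  by (induction n xs rule: drop_op.induct) auto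

lemma result_append_op [simp]: "result (append_op xs ys) = xs @ ys"
  by (induction xs) auto

lemma ops_append_op [simp]: "ops (append_op xs ys) = length xs + 1"
  by (induction xs) auto

lemma result_concat_op [simp]: "result (concat_op xss) = concat xss"
  by (induction xss) auto

lemma ops_concat_op: "ops (concat_op xss) = length (concat xss) + 2 * length xss + 1"
  by (induction xss) auto

lemma result_length_op [simp]: "result (length_op xs) = length xs"
  by (induction xs) auto

lemma ops_length_op [simp]: "ops (length_op xs) = length xs + 1"
  by (induction xs) auto

lemma result_replicate_op [simp]: "result (replicate_op n x) = replicate n x"
  by (induction n) auto

lemma ops_replicate_op [simp]: "ops (replicate_op n x) = n + 1"
  by (induction n) auto

lemma block_0: "block l xs 0 = take l xs"
  and block_Suc: "block l xs (Suc j) = block l (drop l xs) j"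
  by (simp_all add: block_def add.commute)

lemma result_chunks_op [simp]: "result (chunks_op n l xs) = map (block l xs) [0..<n]"
proof (induction n arbitrary: xs)
  case (Suc n)
  have "map (block l xs) [0..<Suc n] = block l xs 0 # map (\<lambda>j. block l xs (Suc j)) [0..<n]"
    by (simp add: upt_conv_Cons map_Suc_upt [symmetric] comp_def del: upt_Suc)
  then show ?case
    using Suc by (simp add: block_0 block_Suc del: upt_Suc)
qed simp

lemma ops_chunks_op: "ops (chunks_op n l xs) \<le> n * (2 * l + 3) + 1"
proof (induction n arbitrary: xs)
  case (Suc n)
  show ?case
    using ops_take_op [of l xs] ops_drop_op [of l xs] Suc [of "drop l xs"]
    by simp
qed simp

lemma result_repeat_op [simp]: "result (repeat_op r bs) = repeat_bits r bs"
  by (induction bs) (auto simp: repeat_bits_def)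

lemma ops_repeat_op: "ops (repeat_op r bs) = length bs * (2 * r + 3) + 1"
  by (induction bs) auto

lemma result_equal_bits_op [simp]: "result (equal_bits_op xs ys) = (xs = ys)"
  by (induction xs ys rule: equal_bits_op.induct) auto

lemma ops_equal_bits_op: "ops (equal_bits_op xs ys) \<le> length xs + 1"
  by (induction xs ys rule: equal_bits_op.induct) auto

lemma result_equal_blocks_op [simp]: "result (equal_blocks_op xs ys) = (xs = ys)"
  by (induction xs ys rule: equal_blocks_op.induct) auto

lemma ops_equal_blocks_op:
  "\<forall>x\<in>set xs. length x \<le> l \<Longrightarrow> ops (equal_blocks_op xs ys) \<le> length xs * (l + 2) + 1"
proof (induction xs ys rule: equal_blocks_op.induct)
  case (2 x xs y ys)
  then show ?case
    using ops_equal_bits_op [of x y] by simp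
qed auto

lemma result_subseq_op [simp]: "result (subseq_op xs ys) = subseq xs ys"
  by (induction xs ys rule: subseq_op.induct) (simp_all add: subseq_Cons2_iff)

lemma ops_subseq_op: "ops (subseq_op xs ys) \<le> length ys + 1"
  by (induction xs ys rule: subseq_op.induct) auto

section \<open>Vectors over GF(2)\<close>

definition xor_list :: "bool list \<Rightarrow> bool list \<Rightarrow> bool list" where
  "xor_list xs ys = map2 (\<noteq>) xs ys"

lemma xor_list_simps [simp]:
  "xor_list (x # xs) (y # ys) = (x \<noteq> y) # xor_list xs ys"
  "xor_list [] ys = []" "xor_list xs [] = []"
  by (simp_all add: xor_list_def)

lemma length_xor_list [simp]: "length (xor_list xs ys) = min (length xs) (length ys)"
  by (simp add: xor_list_def)

lemma result_xor_op [simp]: "result (xor_op xs ys) = xor_list xs ys"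
  by (induction xs ys rule: xor_op.induct) auto

lemma ops_xor_op: "ops (xor_op xs ys) \<le> length xs + 1"
  by (induction xs ys rule: xor_op.induct) auto

fun dot :: "bool list \<Rightarrow> bool list \<Rightarrow> bool" where
  "dot (x # xs) (y # ys) = ((x \<and> y) \<noteq> dot xs ys)"
| "dot _ _ = False"

lemma result_dot_op [simp]: "result (dot_op xs ys) = dot xs ys"
  by (induction xs ys rule: dot.induct) auto

lemma ops_dot_op: "ops (dot_op xs ys) \<le> length ys + 1"
  by (induction xs ys rule: dot.induct) auto

definition mat_vec :: "bit_matrix \<Rightarrow> bool list \<Rightarrow> bool list" where
  "mat_vec M v = map (\<lambda>r. dot r v) M"

lemma result_mat_vec_op [simp]: "result (mat_vec_op M v) = mat_vec M v"
  by (induction M) (auto simp: mat_vec_def)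

lemma ops_mat_vec_op: "ops (mat_vec_op M v) \<le> length M * (length v + 2) + 1"
proof (induction M)
  case (Cons r M)
  then show ?case
    using ops_dot_op [of r v] by simp
qed simp

fun parity_bits :: "nat \<Rightarrow> bit_matrix list \<Rightarrow> bool list list \<Rightarrow> bool list" where
  "parity_bits l (M # Ms) (b # bs) = xor_list (mat_vec M b) (parity_bits l Ms bs)"
| "parity_bits l _ _ = replicate l False"

lemma result_parity_op [simp]: "result (parity_op l Ms bs) = parity_bits l Ms bs"
  by (induction l Ms bs rule: parity_bits.induct) auto

lemma ops_parity_op:
  assumes "\<forall>M\<in>set Ms. length M = l" "\<forall>b\<in>set bs. length b = l"
  shows "ops (parity_op l Ms bs) \<le> length bs * (l * (l + 2) + l + 3) + l + 2"
  using assms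
proof (induction l Ms bs rule: parity_bits.induct)
  case (1 l M Ms b bs)
  have "ops (parity_op l Ms bs) \<le> length bs * (l * (l + 2) + l + 3) + l + 2"
    using 1 by auto
  moreover have "ops (mat_vec_op M b) \<le> l * (l + 2) + 1"
    using ops_mat_vec_op [of M b] 1 by auto
  moreover have "ops (xor_op (mat_vec M b) (parity_bits l Ms bs)) \<le> l + 1"
    using ops_xor_op [of "mat_vec M b" "parity_bits l Ms bs"] 1 by (simp add: mat_vec_def)
  ultimately show ?case
    by simp
qed auto

lemma result_parities_op [simp]: "result (parities_op l T bs) = map (\<lambda>Ms. parity_bits l Ms bs) T"
  by (induction l T bs rule: parities_op.induct) auto

lemma ops_parities_op:
  assumes "\<forall>Ms\<in>set T. \<forall>M\<in>set Ms. length M = l" "\<forall>b\<in>set bs. length b = l"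
  shows "ops (parities_op l T bs) \<le>
    length T * (length bs * (l * (l + 2) + l + 3) + l + 3) + 1"
  using assms
proof (induction l T bs rule: parities_op.induct)
  case (2 l Ms T bs)
  then show ?case
    using ops_parity_op [of Ms l bs] by auto
qed auto

section \<open>Symbols and parities\<close>

locale gc =
  fixes R :: "'a ring" (structure)
    and B :: "'a list" and G :: "nat \<Rightarrow> nat \<Rightarrow> 'a" and k \<delta> c e :: nat
  assumes code: "gc_code R B G k c"
    and k_eq: "k = 2 ^ e"
    and k_gt: "k > nblocks k + c"
    and \<delta>_ge: "\<delta> \<ge> 1" and c_gt: "c > \<delta>"
begin

abbreviation l :: nat where "l \<equiv> lg k"
abbreviation m :: nat where "m \<equiv> nblocks k"
abbreviation sym :: "bool list \<Rightarrow> 'a" where "sym \<equiv> symbol R B"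
abbreviation bts :: "'a \<Rightarrow> bool list" where "bts \<equiv> bits R B"

lemma field_R: "field R" and card_R: "card (carrier R) = k" and basis: "binary_basis R B"
  and length_B: "length B = l"
  and G_carrier: "r < c \<Longrightarrow> j < m \<Longrightarrow> G r j \<in> carrier R"
  and mds: "mds_code k (m + c) m (systematic_code R G m c)"
  using code by (auto simp: gc_code_def)

sublocale field R by (rule field_R)

lemma l_eq: "l = e"
  by (simp add: lg_def k_eq log_nat_power)

text \<open>A field with \<open>2 ^ e\<close> elements has characteristic 2: if
  \<open>\<one> \<oplus> \<one>\<close> were nonzero, so would be its powers, which are the
  multiples of \<open>\<one>\<close> by \<open>2 ^ n\<close>; but the multiple by the order of the
  additive group vanishes.\<close>

lemma add_self:
  assumes x: "x \<in> carrier R"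
  shows "x \<oplus> x = \<zero>"
proof -
  have one_one: "\<one> \<oplus> \<one> = \<zero>"
  proof (rule ccontr)
    assume t: "\<one> \<oplus> \<one> \<noteq> \<zero>"
    have "add_pow R ((2::nat) ^ n) \<one> \<noteq> \<zero>" for n
    proof (induction n)
      case (Suc n)
      have c: "add_pow R ((2::nat) ^ n) \<one> \<in> carrier R" by simp
      have "add_pow R ((2::nat) ^ Suc n) \<one> = add_pow R ((2::nat) ^ n) \<one> \<oplus> add_pow R ((2::nat) ^ n) \<one>"
        by (simp add: add.nat_pow_mult mult_2)
      also have "\<dots> = (\<one> \<oplus> \<one>) \<otimes> add_pow R ((2::nat) ^ n) \<one>"
        using c by (simp add: l_distr)
      finally show ?case
        using t c Suc integral by (metis a_closed one_closed)
    qed simp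
    moreover have "add_pow R k \<one> = \<zero>"
      using add.pow_order_eq_1 [of \<one>] card_R by (simp add: order_def)
    ultimately show False using k_eq by metis
  qed
  have "x \<oplus> x = (\<one> \<oplus> \<one>) \<otimes> x" using x by (simp add: l_distr)
  then show ?thesis using one_one x by simp
qed

lemma finsum_lessThan_Suc:
  assumes "f \<in> {..<Suc n} \<rightarrow> carrier R"
  shows "finsum R f {..<Suc n} = f 0 \<oplus> finsum R (\<lambda>i. f (Suc i)) {..<n}"
proof -
  have "finsum R f {..<Suc n} = finsum R f (insert 0 (Suc ` {..<n}))"
    by (simp add: lessThan_Suc_eq_insert_0)
  also have "\<dots> = f 0 \<oplus> finsum R f (Suc ` {..<n})"
    using assms by (intro finsum_insert) auto
  also have "finsum R f (Suc ` {..<n}) = finsum R (\<lambda>i. f (Suc i)) {..<n}"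
    using assms by (intro finsum_reindex) auto
  finally show ?thesis .
qed

lemma nth_closed: "set xs \<subseteq> carrier R \<Longrightarrow> i < length xs \<Longrightarrow> xs ! i \<in> carrier R"
  using nth_mem by blast

lemma symbol_Cons:
  assumes "set (b # Bs) \<subseteq> carrier R"
  shows "symbol R (b # Bs) (x # v) = (if x then b else \<zero>) \<oplus> symbol R Bs v"
proof -
  have "(\<lambda>i. if (x # v) ! i then (b # Bs) ! i else \<zero>) \<in> {..<Suc (length Bs)} \<rightarrow> carrier R"
    using assms nth_closed [of "b # Bs"] by auto
  from finsum_lessThan_Suc [OF this] show ?thesis
    unfolding symbol_def length_Cons nth_Cons_Suc by simp
qed

lemma symbol_closed [simp]:
  assumes "set Bs \<subseteq> carrier R"
  shows "symbol R Bs v \<in> carrier R"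
  using assms unfolding symbol_def by (intro finsum_closed) (auto intro: nth_closed)

lemma set_B: "set B \<subseteq> carrier R"
  using basis by (simp add: binary_basis_def)

lemma sym_closed [simp]: "sym v \<in> carrier R"
  using set_B by simp

text \<open>Stated for an arbitrary list \<open>Bs\<close> instead of the basis \<open>B\<close>, so
  that the induction can remove one basis vector at a time; a coefficient present in both summands
  cancels by \<open>add_self\<close>.\<close>

lemma symbol_xor_list:
  assumes "length v = length Bs" "length w = length Bs" "set Bs \<subseteq> carrier R"
  shows "symbol R Bs (xor_list v w) = symbol R Bs v \<oplus> symbol R Bs w"
  using assms
proof (induction Bs arbitrary: v w)
  case Nil
  then show ?case by (simp add: symbol_def)
next
  case (Cons b Bs)
  then obtain x v' y w' where vw: "v = x # v'" "w = y # w'"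
    by (metis length_Suc_conv)
  have "symbol R Bs v' \<in> carrier R" "symbol R Bs w' \<in> carrier R" "b \<in> carrier R"
    using Cons.prems by auto
  moreover have "symbol R Bs (xor_list v' w') = symbol R Bs v' \<oplus> symbol R Bs w'"
    using Cons vw by simp
  moreover have "b \<oplus> (b \<oplus> z) = z" if "b \<in> carrier R" "z \<in> carrier R" for z
    using that add_self a_assoc by (metis l_zero)
  ultimately show ?case
    using vw Cons.prems by (simp add: symbol_Cons a_ac)
qed

lemma bij_symbol: "bij_betw sym {bs. length bs = l} (carrier R)"
  using basis length_B by (simp add: binary_basis_def)

lemma bits_symbol: "length v = l \<Longrightarrow> bts (sym v) = v"
  using bij_symbol unfolding bits_def length_B
  by (intro the_inv_into_f_f) (auto simp: bij_betw_def)

lemma symbol_bits: "x \<in> carrier R \<Longrightarrow> sym (bts x) = x"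
  using bij_symbol unfolding bits_def length_B
  by (intro f_the_inv_into_f) (auto simp: bij_betw_def)

lemma length_bits [simp]: "x \<in> carrier R \<Longrightarrow> length (bts x) = l"
  using the_inv_into_into [of sym "{bs. length bs = l}" x "{bs. length bs = l}"] bij_symbol
  unfolding bits_def length_B by (auto simp: bij_betw_def)

lemma bits_eq_iff: "x \<in> carrier R \<Longrightarrow> y \<in> carrier R \<Longrightarrow> bts x = bts y \<longleftrightarrow> x = y"
  by (metis symbol_bits)

lemma sym_xor_list: "length v = l \<Longrightarrow> length w = l \<Longrightarrow> sym (xor_list v w) = sym v \<oplus> sym w"
  by (intro symbol_xor_list) (simp_all add: length_B set_B)

lemma bits_add:
  assumes "x \<in> carrier R" "y \<in> carrier R"
  shows "bts (x \<oplus> y) = xor_list (bts x) (bts y)"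
proof -
  have "sym (xor_list (bts x) (bts y)) = x \<oplus> y"
    using assms by (simp add: sym_xor_list symbol_bits)
  moreover have "length (xor_list (bts x) (bts y)) = l"
    using assms by simp
  ultimately show ?thesis by (metis bits_symbol)
qed

lemma sym_zeros: "sym (replicate l False) = \<zero>"
  unfolding symbol_def length_B by (intro add.finprod_one_eqI) simp

lemma bits_zero: "bts \<zero> = replicate l False"
  by (metis bits_symbol length_replicate sym_zeros)

text \<open>Multiplication by \<open>g\<close> is linear over GF(2), so an output bit is the scalar
  product of \<open>v\<close> with the corresponding bits of the images of the basis vectors. The
  list \<open>Bs\<close> shrinks in the induction while \<open>bts\<close> keeps referring to the
  full basis \<open>B\<close>.\<close>

lemma bits_mult_nth:
  assumes "length v = length Bs" "set Bs \<subseteq> carrier R" "g \<in> carrier R" "i < l"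
  shows "bts (g \<otimes> symbol R Bs v) ! i = dot (map (\<lambda>b. bts (g \<otimes> b) ! i) Bs) v"
  using assms
proof (induction Bs arbitrary: v)
  case Nil
  then show ?case by (simp add: symbol_def bits_zero)
next
  case (Cons b Bs)
  then obtain x v' where v: "v = x # v'" by (metis length_Suc_conv)
  have *: "b \<in> carrier R" "symbol R Bs v' \<in> carrier R" "(if x then b else \<zero>) \<in> carrier R"
    using Cons.prems by auto
  have "bts (g \<otimes> symbol R (b # Bs) v) =
      xor_list (bts (g \<otimes> (if x then b else \<zero>))) (bts (g \<otimes> symbol R Bs v'))"
    using * Cons.prems v by (simp only: symbol_Cons r_distr) (simp add: bits_add)
  then show ?case
    using * Cons v by (auto simp: xor_list_def bits_zero)
qed

lemma mat_vec_mult_matrix: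
  assumes "length v = l" "g \<in> carrier R"
  shows "mat_vec (mult_matrix R B g) v = bts (g \<otimes> sym v)"
  using assms length_B set_B
  by (intro nth_equalityI) (auto simp: mat_vec_def mult_matrix_def bits_mult_nth)

section \<open>Parities in the field and on bit vectors\<close>

lemma parity_closed [simp]:
  assumes "\<forall>j<length U. g j \<in> carrier R" "set U \<subseteq> carrier R"
  shows "parity R g U \<in> carrier R"
  using assms unfolding parity_def by (intro finsum_closed) (auto intro: nth_closed)

lemma parity_Cons:
  assumes "\<forall>j\<le>length U. g j \<in> carrier R" "set (x # U) \<subseteq> carrier R"
  shows "parity R g (x # U) = g 0 \<otimes> x \<oplus> parity R (\<lambda>j. g (Suc j)) U"
proof -
  have "(\<lambda>j. g j \<otimes> (x # U) ! j) \<in> {..<Suc (length U)} \<rightarrow> carrier R"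
    using assms nth_closed [of "x # U"] by auto
  from finsum_lessThan_Suc [OF this] show ?thesis
    unfolding parity_def length_Cons nth_Cons_Suc by simp
qed

text \<open>The coefficient function \<open>g\<close> is general because the induction over the
  blocks shifts it by one index.\<close>

lemma parity_bits_mult_matrix:
  assumes "length bs = n" "\<forall>b\<in>set bs. length b = l" "\<forall>j<n. g j \<in> carrier R"
  shows "parity_bits l (map (\<lambda>j. mult_matrix R B (g j)) [0..<n]) bs =
    bts (parity R g (map sym bs))"
  using assms
proof (induction bs arbitrary: n g)
  case Nil
  then show ?case by (simp add: parity_def bits_zero)
next
  case (Cons b bs)
  then obtain n' where n: "n = Suc n'" "length bs = n'" by auto
  have "parity R g (map sym (b # bs)) = g 0 \<otimes> sym b \<oplus> parity R (\<lambda>j. g (Suc j)) (map sym bs)"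
    unfolding list.map using Cons.prems n by (subst parity_Cons) auto
  moreover have "parity_bits l (map (\<lambda>j. mult_matrix R B (g (Suc j))) [0..<n']) bs =
    bts (parity R (\<lambda>j. g (Suc j)) (map sym bs))"
    using Cons.prems n by (intro Cons.IH) auto
  moreover have "parity R (\<lambda>j. g (Suc j)) (map sym bs) \<in> carrier R"
    using Cons.prems n by (intro parity_closed) auto
  ultimately show ?case
    unfolding n map_upt_Suc using Cons.prems n
    by (simp add: mat_vec_mult_matrix bits_add)
qed

lemma parity_G_closed [simp]:
  "r < c \<Longrightarrow> length U = m \<Longrightarrow> set U \<subseteq> carrier R \<Longrightarrow> parity R (G r) U \<in> carrier R"
  using G_carrier by simp

lemma parity_bits_code_table:
  assumes "r < c" "length bs = m" "\<forall>b\<in>set bs. length b = l"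
  shows "parity_bits l (code_table R B G k c ! r) bs = bts (parity R (G r) (map sym bs))"
  using assms parity_bits_mult_matrix [of bs m "G r"] G_carrier by (simp add: code_table_def)

text \<open>This is where the MDS property enters: distinct codewords have distance at least
  \<open>c + 1\<close>, and a codeword consists of the symbols followed by the parities, so the two
  cardinalities add up to the distance.\<close>

lemma message_eqI:
  assumes "length U = m" "set U \<subseteq> carrier R" "length U' = m" "set U' \<subseteq> carrier R"
    and few: "card {j. j < m \<and> U ! j \<noteq> U' ! j} +
      card {r. r < c \<and> parity R (G r) U \<noteq> parity R (G r) U'} \<le> c"
  shows "U = U'"
proof (rule ccontr)
  assume ne: "U \<noteq> U'"
  define x where "x = U @ map (\<lambda>r. parity R (G r) U) [0..<c]"
  define y where "y = U' @ map (\<lambda>r. parity R (G r) U') [0..<c]"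
  let ?C = "systematic_code R G m c"
  have xy: "x \<in> ?C" "y \<in> ?C" "x \<noteq> y"
    using assms ne by (auto simp: x_def y_def systematic_code_def)
  \<comment> \<open>\<open>Min\<close> is meaningful for finite sets only; \<open>card\<close> of an
    infinite set would be 0, but the code has \<open>k ^ m > 0\<close> words.\<close>
  have "finite ?C"
  proof (rule ccontr)
    assume "infinite ?C"
    then have "card ?C = 0" by simp
    then show False using mds k_gt by (simp add: mds_code_def)
  qed
  then have "finite ((\<lambda>(x, y). hamming x y) ` (?C \<times> ?C))"
    by blast
  then have "finite {hamming x y | x y. x \<in> ?C \<and> y \<in> ?C \<and> x \<noteq> y}"
    by (rule finite_subset [rotated]) auto
  then have "min_dist ?C \<le> hamming x y"
    unfolding min_dist_def using xy by (intro Min_le) auto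
  then have "c + 1 \<le> hamming x y"
    using mds by (simp add: mds_code_def)
  moreover have "{i. i < length x \<and> x ! i \<noteq> y ! i} =
      {j. j < m \<and> U ! j \<noteq> U' ! j} \<union>
      (+) m ` {r. r < c \<and> parity R (G r) U \<noteq> parity R (G r) U'}" (is "_ = ?P \<union> ?Q")
  proof (rule Set.set_eqI)
    fix i
    show "i \<in> {i. i < length x \<and> x ! i \<noteq> y ! i} \<longleftrightarrow> i \<in> ?P \<union> ?Q"
    proof (cases "i < m")
      case True
      then show ?thesis using assms by (auto simp: x_def y_def nth_append)
    next
      case False
      then have "i = m + (i - m)" by simp
      then obtain r where "i = m + r" by blast
      then show ?thesis using assms by (auto simp: x_def y_def nth_append)
    qed
  qed
  then have "hamming x y \<le> card ?P + card ?Q"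
    by (simp add: hamming_def card_Un_le)
  moreover have "card ?Q = card {r. r < c \<and> parity R (G r) U \<noteq> parity R (G r) U'}"
    by (intro card_image) simp
  ultimately show False using few by simp
qed

end

lemma xor_list_assoc: "xor_list (xor_list u v) w = xor_list u (xor_list v w)"
  by (intro nth_equalityI) (auto simp: xor_list_def)

lemma xor_list_commute: "xor_list u v = xor_list v u"
  by (intro nth_equalityI) (auto simp: xor_list_def)

lemma xor_list_left_commute: "xor_list u (xor_list v w) = xor_list v (xor_list u w)"
  by (metis xor_list_assoc xor_list_commute)

lemma xor_list_zeros [simp]: "length v = l \<Longrightarrow> xor_list (replicate l False) v = v"
  by (intro nth_equalityI) (auto simp: xor_list_def)

lemma xor_list_cancel [simp]: "length u = length v \<Longrightarrow> xor_list u (xor_list u v) = v"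
  by (intro nth_equalityI) (auto simp: xor_list_def)

lemma length_mat_vec [simp]: "length (mat_vec M v) = length M"
  by (simp add: mat_vec_def)

lemma dot_zeros [simp]: "dot r (replicate n False) = False"
proof (induction n arbitrary: r)
  case (Suc n)
  then show ?case by (cases r) auto
qed (simp add: dot.elims)

lemma mat_vec_zeros [simp]: "mat_vec M (replicate n False) = replicate (length M) False"
  by (simp add: mat_vec_def map_replicate_const)

lemma dot_append: "length r = length x \<Longrightarrow> dot (r @ s) (x @ y) = (dot r x \<noteq> dot s y)"
  by (induction r x rule: list_induct2) auto

lemma dot_xor_list:
  assumes "length a = length x" "length b = length x"
  shows "dot (xor_list a b) x = (dot a x \<noteq> dot b x)"
  using assms
proof (induction x arbitrary: a b)
  case (Cons x xs)
  then obtain a0 as b0 bs where ab: "a = a0 # as" "b = b0 # bs"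
    by (metis length_Suc_conv)
  then have "dot (xor_list as bs) xs = (dot as xs \<noteq> dot bs xs)"
    using Cons by auto
  with ab show ?case by auto
qed auto

lemma length_parity_bits [simp]:
  "\<forall>M\<in>set Ms. length M = l \<Longrightarrow> length (parity_bits l Ms bs) = l"
  by (induction l Ms bs rule: parity_bits.induct) auto

section \<open>Gaussian elimination\<close>

definition solves :: "bool list \<Rightarrow> bit_equation list \<Rightarrow> bool" where
  "solves x es \<longleftrightarrow> (\<forall>(a, b)\<in>set es. dot a x = b)"

lemma result_consistent_op: "result (consistent_op es) \<longleftrightarrow> (\<forall>(a, b)\<in>set es. \<not> b)"
  by (induction es rule: consistent_op.induct) auto

lemma ops_consistent_op: "ops (consistent_op es) = length es + 1"
  by (induction es rule: consistent_op.induct) auto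

lemma pivot_op_None:
  "result (pivot_op es) = (None, es') \<Longrightarrow> es' = es \<and> (\<forall>(a, b)\<in>set es. a = [] \<or> \<not> hd a)"
proof (induction es arbitrary: es' rule: pivot_op.induct)
  case (2 a b es)
  then have hd: "\<not> (a \<noteq> [] \<and> hd a)" by (auto split: if_splits)
  obtain q fs where q: "result (pivot_op es) = (q, fs)" by fastforce
  then have "q = None" "es' = (a, b) # fs" using 2(2) hd by auto
  then show ?case using 2(1) [OF hd] q hd by auto
qed simp

lemma pivot_op_Some:
  "result (pivot_op es) = (Some (a, b), es') \<Longrightarrow>
    set es = insert (True # a, b) (set es') \<and> length es = Suc (length es')"
proof (induction es arbitrary: es' rule: pivot_op.induct)
  case (2 a' b' es)
  show ?case
  proof (cases "a' \<noteq> [] \<and> hd a'")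
    case True
    then have "a' = True # tl a'" by (metis list.collapse)
    then show ?thesis using 2 True by auto
  next
    case False
    obtain q fs where q: "result (pivot_op es) = (q, fs)" by fastforce
    then have "q = Some (a, b)" "es' = (a', b') # fs" using 2(2) False by auto
    then show ?thesis using 2(1) [OF False] q by auto
  qed
qed simp

lemma ops_pivot_op: "ops (pivot_op es) \<le> length es + 1"
  by (induction es rule: pivot_op.induct) (auto simp: case_prod_beta)

lemma result_eliminate_op: "result (eliminate_op q es) =
    map (\<lambda>(a, b). if a \<noteq> [] \<and> hd a then (xor_list (tl a) (fst q), b \<noteq> snd q) else (tl a, b)) es"
  by (induction q es rule: eliminate_op.induct) auto

lemma ops_eliminate_op:
  "\<forall>(a, b)\<in>set es. length a \<le> n \<Longrightarrow> ops (eliminate_op q es) \<le> length es * (n + 3) + 1"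
proof (induction q es rule: eliminate_op.induct)
  case (2 q a b es)
  then show ?case
    using ops_xor_op [of "tl a" "fst q"] by auto
qed simp

text \<open>Each round passes to a system without the leading unknown: a solution \<open>x\<close>
  of the smaller system extends by \<open>xo x\<close>, and every solution arises in this way, up to
  an arbitrary leading value when there is no pivot.\<close>

lemma solve_op_correct:
  assumes "\<forall>(a, b)\<in>set es. length a = n"
  shows "case result (solve_op n es) of
      None \<Rightarrow> \<not> (\<exists>x. length x = n \<and> solves x es)
    | Some x \<Rightarrow> length x = n \<and> solves x es"
  using assms
proof (induction n arbitrary: es)
  case 0
  have "solves [] es \<longleftrightarrow> result (consistent_op es)"
    using 0 by (auto simp: solves_def result_consistent_op)
  then show ?case by auto
next
  case (Suc n)
  obtain q es' where q: "result (pivot_op es) = (q, es')" by fastforce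
  \<comment> \<open>Without a pivot the dummy row \<open>([], False)\<close> is never added to an
    equation, because then no equation contains the leading unknown.\<close>
  define p where "p = (case q of None \<Rightarrow> ([], False) | Some e \<Rightarrow> e)"
  define fs where "fs = result (eliminate_op p es')"
  \<comment> \<open>The value of the leading unknown forced by the pivot equation, or
    \<open>False\<close> if there is no pivot.\<close>
  define xo where "xo = (\<lambda>x. case q of None \<Rightarrow> False | Some (a, b) \<Rightarrow> (b \<noteq> dot a x))"
  have sol: "result (solve_op (Suc n) es) =
      (case result (solve_op n fs) of None \<Rightarrow> None | Some x \<Rightarrow> Some (xo x # x))"
    using q by (auto simp: fs_def p_def xo_def split: option.splits)
  have sub: "set es' \<subseteq> set es"
    using pivot_op_None [of es es'] pivot_op_Some [of es _ _ es'] q by (cases q) auto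
  have p_len: "q \<noteq> None \<Longrightarrow> length (fst p) = n"
    using pivot_op_Some [of es "fst p" "snd p" es'] q Suc.prems by (auto simp: p_def)
  have shape: "\<exists>a0 as. a = a0 # as \<and> length as = n" if "(a, b) \<in> set es'" for a b
    using that sub Suc.prems by (auto simp flip: length_Suc_conv)
  have nohd: "\<not> a0" if "(a0 # as, b) \<in> set es'" "q = None" for a0 as b
    using that pivot_op_None [of es es'] q by auto
  have len: "\<forall>(a, b)\<in>set fs. length a = n"
  proof -
    have "length a' = n" if "(a', b') \<in> set fs" for a' b'
    proof -
      from that obtain ab where ab: "ab \<in> set es'" "(a', b') = (\<lambda>(a, b). if a \<noteq> [] \<and> hd a
          then (xor_list (tl a) (fst p), b \<noteq> snd p) else (tl a, b)) ab"
        unfolding fs_def result_eliminate_op set_map by (elim imageE)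
      obtain a b where [simp]: "ab = (a, b)" by fastforce
      obtain a0 as where "a = a0 # as" "length as = n" using shape [of a b] ab by auto
      then show ?thesis using ab nohd [of a0 as b] p_len by (cases q) (auto split: if_splits)
    qed
    then show ?thesis by auto
  qed
  have row: "dot a (xo x # x) = b \<longleftrightarrow>
      dot (if a \<noteq> [] \<and> hd a then xor_list (tl a) (fst p) else tl a) x =
        (if a \<noteq> [] \<and> hd a then b \<noteq> snd p else b)"
    if ab: "(a, b) \<in> set es'" and x: "length x = n" for a b x
  proof -
    obtain a0 as where a: "a = a0 # as" "length as = n" using shape ab by blast
    show ?thesis
    proof (cases a0)
      case True
      then obtain p1 p2 where q': "q = Some (p1, p2)" "p = (p1, p2)"
        using nohd ab a p_def by (cases q) auto
      moreover have "dot (xor_list as p1) x = (dot as x \<noteq> dot p1 x)"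
        using a x p_len q' by (intro dot_xor_list) auto
      ultimately show ?thesis
        using True a by (auto simp: xo_def)
    qed (use a in auto)
  qed
  have iff': "solves (xo x # x) es' \<longleftrightarrow> solves x fs" if "length x = n" for x
  proof -
    have "solves x fs \<longleftrightarrow> (\<forall>(a, b)\<in>set es'.
      dot (if a \<noteq> [] \<and> hd a then xor_list (tl a) (fst p) else tl a) x =
        (if a \<noteq> [] \<and> hd a then b \<noteq> snd p else b))"
      unfolding solves_def fs_def result_eliminate_op set_map Set.ball_simps(9)
    proof (rule ball_cong)
      fix ab assume "ab \<in> set es'"
      show "(case (case ab of (a, b) \<Rightarrow> if a \<noteq> [] \<and> hd a
            then (xor_list (tl a) (fst p), b \<noteq> snd p) else (tl a, b)) of (a, b) \<Rightarrow> dot a x = b)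
          \<longleftrightarrow> (case ab of (a, b) \<Rightarrow>
            dot (if a \<noteq> [] \<and> hd a then xor_list (tl a) (fst p) else tl a) x =
              (if a \<noteq> [] \<and> hd a then b \<noteq> snd p else b))"
        by (cases ab) simp
    qed simp
    also have "\<dots> \<longleftrightarrow> solves (xo x # x) es'"
      unfolding solves_def
    proof (rule ball_cong)
      fix ab assume "ab \<in> set es'"
      then show "(case ab of (a, b) \<Rightarrow>
          dot (if a \<noteq> [] \<and> hd a then xor_list (tl a) (fst p) else tl a) x =
            (if a \<noteq> [] \<and> hd a then b \<noteq> snd p else b)) \<longleftrightarrow>
          (case ab of (a, b) \<Rightarrow> dot a (xo x # x) = b)"
        using row [of "fst ab" "snd ab" x] that unfolding case_prod_beta prod.collapse by blast
    qed simp
    finally show ?thesis by simp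
  qed
  have es'_iff: "solves (z # x) es \<longleftrightarrow> z = xo x \<and> solves x fs"
    if "length x = n" "q \<noteq> None" for z x
  proof -
    from that obtain a b where ab: "q = Some (a, b)" by auto
    then have "solves (z # x) es \<longleftrightarrow> (z \<noteq> dot a x) = b \<and> solves (z # x) es'"
      using pivot_op_Some [of es a b es'] q by (auto simp: solves_def)
    moreover have "(z \<noteq> dot a x) = b \<longleftrightarrow> z = xo x"
      by (auto simp: xo_def ab)
    ultimately show ?thesis using iff' that by auto
  qed
  have es_None: "solves (z # x) es \<longleftrightarrow> solves x fs" if "length x = n" "q = None" for z x
  proof -
    have "es' = es" using pivot_op_None [of es es'] q that by auto
    have "dot a (z # x) = dot a (xo x # x)" if ab: "(a, b) \<in> set es" for a b
    proof -
      obtain a0 as where "a = a0 # as" using shape [of a b] ab \<open>es' = es\<close> by blast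
      then show ?thesis using nohd [of a0 as b] ab \<open>es' = es\<close> \<open>q = None\<close> by simp
    qed
    then have "solves (z # x) es \<longleftrightarrow> solves (xo x # x) es"
      unfolding solves_def by (intro ball_cong) auto
    then show ?thesis using iff' that \<open>es' = es\<close> by simp
  qed
  have IH: "case result (solve_op n fs) of
      None \<Rightarrow> \<not> (\<exists>x. length x = n \<and> solves x fs)
    | Some x \<Rightarrow> length x = n \<and> solves x fs"
    by (rule Suc.IH [OF len])
  show ?case
  proof (cases "result (solve_op n fs)")
    case None
    have "\<not> solves x es" if "length x = Suc n" for x
    proof -
      obtain z x' where "x = z # x'" "length x' = n" using \<open>length x = Suc n\<close> by (cases x) auto
      then show ?thesis using IH None es'_iff es_None by (cases "q = None") auto
    qed
    then show ?thesis using sol None by auto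
  next
    case (Some x)
    then have "length x = n" "solves x fs" using IH by auto
    then have "solves (xo x # x) es"
      using es'_iff es_None by (cases "q = None") auto
    then show ?thesis using sol Some \<open>length x = n\<close> by auto
  qed
qed

lemma length_pivot_op: "length (snd (result (pivot_op es))) \<le> length es"
  by (induction es rule: pivot_op.induct) (auto simp: case_prod_beta)

lemma set_pivot_op: "set (snd (result (pivot_op es))) \<subseteq> set es"
  by (induction es rule: pivot_op.induct) (auto simp: case_prod_beta)

text \<open>\<open>N\<close> and \<open>E\<close> bound the row length and the number of equations
  throughout the recursion, so every round has the same bound
  \<open>E * (N + 5) + N + 10\<close>.\<close>

lemma ops_solve_op:
  assumes "\<forall>(a, b)\<in>set es. length a \<le> n" "n \<le> N" "length es \<le> E"
  shows "ops (solve_op n es) \<le> (n + 1) * (E * (N + 5) + N + 10)"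
  using assms
proof (induction n arbitrary: es)
  case 0
  have "ops (solve_op 0 es) \<le> E + 2"
    using 0 by (simp add: ops_consistent_op)
  also have "E \<le> E * (N + 5)"
    by simp
  finally show ?case by simp
next
  case (Suc n)
  obtain q es' where q: "result (pivot_op es) = (q, es')" by fastforce
  define p where "p = (case q of None \<Rightarrow> ([], False) | Some e \<Rightarrow> e)"
  define fs where "fs = result (eliminate_op p es')"
  have es': "set es' \<subseteq> set es" "length es' \<le> length es"
    using set_pivot_op [of es] length_pivot_op [of es] q by auto
  have fs: "\<forall>(a, b)\<in>set fs. length a \<le> n"
  proof -
    have "length a' \<le> n" if "(a', b') \<in> set fs" for a' b'
    proof -
      from that obtain ab where ab: "ab \<in> set es'" "(a', b') = (\<lambda>(a, b). if a \<noteq> [] \<and> hd a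
          then (xor_list (tl a) (fst p), b \<noteq> snd p) else (tl a, b)) ab"
        unfolding fs_def result_eliminate_op set_map by (elim imageE)
      obtain a b where [simp]: "ab = (a, b)" by fastforce
      have "length a \<le> Suc n" using ab es' Suc.prems by auto
      then show ?thesis using ab by (auto split: if_splits)
    qed
    then show ?thesis by auto
  qed
  have fs_len: "length fs \<le> E"
    using es' Suc.prems by (simp add: fs_def result_eliminate_op)
  have A: "ops (pivot_op es) \<le> E + 1"
    using ops_pivot_op [of es] Suc.prems by linarith
  have "ops (eliminate_op p es') \<le> length es' * (Suc n + 3) + 1"
    using es' Suc.prems by (intro ops_eliminate_op) auto
  also have "length es' * (Suc n + 3) \<le> E * (N + 3)"
    using es' Suc.prems by (intro mult_le_mono) auto
  finally have B: "ops (eliminate_op p es') \<le> E * (N + 3) + 1" by simp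
  have C: "ops (solve_op n fs) \<le> (n + 1) * (E * (N + 5) + N + 10)"
    using fs fs_len Suc.prems by (intro Suc.IH) auto
  \<comment> \<open>\<open>solve_op_correct\<close> does not apply, since the row lengths are only
    bounded here; the length of a returned solution follows from the recursion alone.\<close>
  have lens: "length x = n" if "result (solve_op n fs) = Some x" for x
    using that
  proof (induction n arbitrary: fs x)
    case (Suc n)
    then show ?case by (auto split: option.splits prod.splits if_splits simp: case_prod_beta)
  qed (auto split: if_splits)
  have D: "ops (dot_op a x) \<le> N + 1" if "result (solve_op n fs) = Some x" for a x
    using ops_dot_op [of a x] lens [OF that] Suc.prems by simp
  have "ops (solve_op (Suc n) es) \<le>
      ops (pivot_op es) + ops (eliminate_op p es') + ops (solve_op n fs) + (N + 2)"
    using q D by (auto simp: fs_def p_def split: option.splits)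
  also have "\<dots> \<le> (Suc n + 1) * (E * (N + 5) + N + 10)"
    using A B C by (simp add: algebra_simps)
  finally show ?case .
qed

section \<open>Subroutines of the decoder\<close>

text \<open>The slack \<open>\<delta>\<close> in the hypothesis allows the last group of
  \<open>\<delta> + 1\<close> copies to have shrunk to a single bit: the last position read is
  \<open>(n - 1) * (\<delta> + 1)\<close>.\<close>

lemma result_sample_op:
  "n * (\<delta> + 1) \<le> length z + \<delta> \<Longrightarrow> result (sample_op \<delta> n z) = map (\<lambda>i. z ! (i * (\<delta> + 1))) [0..<n]"
proof (induction \<delta> n z rule: sample_op.induct)
  case (1 \<delta> n b z)
  have "(drop \<delta> z) ! (i * (\<delta> + 1)) = z ! (\<delta> + i * (\<delta> + 1))" if "i < n" for i
  proof (rule nth_drop)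
    show "\<delta> \<le> length z" using 1(2) that by (cases n) auto
  qed
  moreover have "n * (\<delta> + 1) \<le> length (drop \<delta> z) + \<delta>" using 1(2) by simp
  ultimately show ?case
    using 1(1) [of "drop \<delta> z"] by (simp add: map_upt_Suc ac_simps del: upt_Suc)
next
  case ("2_2" \<delta> n)
  have "n = 0"
  proof (rule ccontr)
    assume "n \<noteq> 0"
    then have "1 * (\<delta> + 1) \<le> n * (\<delta> + 1)" by (intro mult_le_mono) auto
    then show False using "2_2" by simp
  qed
  then show ?case by simp
qed auto

lemma ops_sample_op: "ops (sample_op \<delta> n z) \<le> n * (\<delta> + 3) + 1"
proof (induction \<delta> n z rule: sample_op.induct)
  case (1 \<delta> n b z)
  show ?case using ops_drop_op [of \<delta> z] 1 [of "drop \<delta> z"] by simp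
qed auto

lemma result_cons_all_op [simp]: "result (cons_all_op x xss) = map ((#) x) xss"
  by (induction xss) auto

lemma ops_cons_all_op [simp]: "ops (cons_all_op x xss) = length xss + 1"
  by (induction xss) auto

lemma set_collect_op: "set (result (collect_op f n)) = (\<Union>i\<le>n. set (result (f i)))"
  by (induction n) (auto simp: atMost_Suc)

lemma length_collect_op: "length (result (collect_op f n)) = (\<Sum>i\<le>n. length (result (f i)))"
  by (induction n) auto

lemma ops_collect_op: "ops (collect_op f n) \<le> (\<Sum>i\<le>n. ops (f i) + length (result (f i)) + 2)"
  by (induction n) auto

lemma set_cases_op: "set (result (cases_op m s)) = deletion_cases m s"
proof (induction m arbitrary: s)
  case 0
  then show ?case by (auto simp: deletion_cases_def)
next
  case (Suc m)
  have "d \<in> (\<Union>i\<le>s. (#) i ` deletion_cases m (s - i)) \<longleftrightarrow> d \<in> deletion_cases (Suc m) s" for d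
    by (cases d) (auto simp: deletion_cases_def intro!: bexI [of _ "hd d"])
  then show ?case
    using Suc by (auto simp: set_collect_op)
qed

text \<open>The hockey stick identity, in the order in which \<open>cases_op\<close> varies the
  number of deletions in the first block.\<close>

lemma sum_choose_rev: "(\<Sum>i\<le>s. (m + (s - i)) choose (s - i)) = (Suc m + s) choose s"
proof -
  have "(\<Sum>i\<le>s. (m + (s - i)) choose (s - i)) = (\<Sum>i\<le>s. (m + i) choose i)"
    by (rule sum.reindex_bij_witness [of _ "\<lambda>i. s - i" "\<lambda>i. s - i"]) auto
  also have "\<dots> = (Suc m + s) choose s"
    using sum_choose_lower [of m s] by simp
  finally show ?thesis .
qed

text \<open>For \<open>m > 0\<close> the exact count has \<open>m + s - 1\<close> on top; the larger
  value avoids natural subtraction, and only its order in \<open>m\<close> matters.\<close>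

lemma length_cases_op: "length (result (cases_op m s)) \<le> (m + s) choose s"
proof (induction m arbitrary: s)
  case (Suc m)
  have "length (result (cases_op (Suc m) s)) = (\<Sum>i\<le>s. length (result (cases_op m (s - i))))"
    by (simp add: length_collect_op)
  also have "\<dots> \<le> (\<Sum>i\<le>s. (m + (s - i)) choose (s - i))"
    by (intro sum_mono Suc)
  finally show ?case by (simp only: sum_choose_rev)
qed simp

text \<open>Each level adds at most five operations per case counted by the binomial bound, which
  makes the total linear in the number \<open>m\<close> of levels.\<close>

lemma ops_cases_op: "ops (cases_op m s) \<le> 6 * (m + 1) * ((m + s) choose s)"
proof (induction m arbitrary: s)
  case (Suc m)
  define P where "P i = (m + (s - i)) choose (s - i)" for i
  have P1: "1 \<le> P i" for i
    unfolding P_def by (metis One_nat_def Suc_leI le_add2 zero_less_binomial)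
  have "ops (cases_op (Suc m) s) \<le> 1 +
      (\<Sum>i\<le>s. ops (cases_op m (s - i)) + 2 * length (result (cases_op m (s - i))) + 3)"
    (is "_ \<le> 1 + ?S")
  proof -
    let ?f = "\<lambda>a. cases_op m (s - a) \<bind> cons_all_op a"
    have "ops (cases_op (Suc m) s) = ops (collect_op ?f s) + 1"
      by simp
    also have "\<dots> \<le> (\<Sum>i\<le>s. ops (?f i) + length (result (?f i)) + 2) + 1"
      using ops_collect_op [of ?f s] by linarith
    also have "(\<Sum>i\<le>s. ops (?f i) + length (result (?f i)) + 2) = ?S"
      by (intro sum.cong) auto
    finally show ?thesis by simp
  qed
  also have "(\<Sum>i\<le>s. ops (cases_op m (s - i)) + 2 * length (result (cases_op m (s - i))) + 3)
      \<le> (\<Sum>i\<le>s. (6 * (m + 1) + 5) * P i)"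
  proof (rule sum_mono)
    fix i
    show "ops (cases_op m (s - i)) + 2 * length (result (cases_op m (s - i))) + 3
        \<le> (6 * (m + 1) + 5) * P i"
      using Suc [of "s - i"] length_cases_op [of m "s - i"] P1 [of i]
      unfolding P_def [symmetric] by (simp add: algebra_simps)
  qed
  also have "\<dots> = (6 * (m + 1) + 5) * (\<Sum>i\<le>s. P i)"
    by (simp only: sum_distrib_left)
  also have "(\<Sum>i\<le>s. P i) = (Suc m + s) choose s"
    unfolding P_def by (rule sum_choose_rev)
  also have "1 + (6 * (m + 1) + 5) * ((Suc m + s) choose s) \<le>
      6 * (Suc m + 1) * ((Suc m + s) choose s)"
  proof -
    have "1 \<le> (Suc m + s) choose s"
      by (metis One_nat_def Suc_leI le_add2 zero_less_binomial)
    then show ?thesis by (simp add: algebra_simps)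
  qed
  finally show ?case by simp
qed simp

lemma result_all_le_op [simp]: "result (all_le_op l d) \<longleftrightarrow> (\<forall>a\<in>set d. a \<le> l)"
  by (induction d) auto

lemma ops_all_le_op [simp]: "ops (all_le_op l d) = length d + 1"
  by (induction d) auto

lemma subblock_0: "subblock l (a # d) s 0 = take (l - a) s"
  and subblock_Suc: "subblock l (a # d) s (Suc j) = subblock l d (drop (l - a) s) j"
  unfolding subblock_def sum.lessThan_Suc_shift by (simp_all add: add.commute)

lemma result_subblocks_op [simp]:
  "result (subblocks_op l d s) = map (subblock l d s) [0..<length d]"
  by (induction l d s rule: subblocks_op.induct)
    (simp_all add: map_upt_Suc subblock_0 subblock_Suc del: upt_Suc)

lemma ops_subblocks_op: "ops (subblocks_op l d s) \<le> length d * (2 * l + 3) + 1"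
proof (induction l d s rule: subblocks_op.induct)
  case (2 l a d s)
  show ?case
    using ops_take_op [of "l - a" s] ops_drop_op [of "l - a" s] 2 [of "drop (l - a) s"] by simp
qed simp

definition zero_erased :: "nat \<Rightarrow> nat list \<Rightarrow> bool list list \<Rightarrow> bool list list" where
  "zero_erased l d bs = map2 (\<lambda>a b. if a = 0 then b else replicate l False) d bs"

lemma result_zero_erased_op [simp]: "result (zero_erased_op l d bs) = zero_erased l d bs"
  by (induction l d bs rule: zero_erased_op.induct) (auto simp: zero_erased_def)

lemma ops_zero_erased_op: "ops (zero_erased_op l d bs) \<le> length d * (l + 2) + 1"
  by (induction l d bs rule: zero_erased_op.induct) auto

lemma result_xor_blocks_op [simp]: "result (xor_blocks_op xs ys) = map2 xor_list xs ys"
  by (induction xs ys rule: xor_blocks_op.induct) auto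

lemma ops_xor_blocks_op:
  "\<forall>x\<in>set xs. length x \<le> l \<Longrightarrow> ops (xor_blocks_op xs ys) \<le> length xs * (l + 2) + 1"
proof (induction xs ys rule: xor_blocks_op.induct)
  case (1 x xs y ys)
  then show ?case using ops_xor_op [of x y] by simp
qed auto

lemma result_join_rows_op [simp]: "result (join_rows_op M N) = map2 (@) M N"
  by (induction M N rule: join_rows_op.induct) auto

lemma ops_join_rows_op:
  "\<forall>r\<in>set M. length r \<le> l \<Longrightarrow> ops (join_rows_op M N) \<le> length M * (l + 2) + 1"
  by (induction M N rule: join_rows_op.induct) auto

fun erased_columns :: "nat \<Rightarrow> nat list \<Rightarrow> bit_matrix list \<Rightarrow> bit_matrix" where
  "erased_columns l (a # d) (M # Ms) =
    (if a = 0 then erased_columns l d Ms else map2 (@) M (erased_columns l d Ms))"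
| "erased_columns l _ _ = replicate l []"

lemma result_erased_columns_op [simp]:
  "result (erased_columns_op l d Ms) = erased_columns l d Ms"
  by (induction l d Ms rule: erased_columns.induct) auto

definition square :: "nat \<Rightarrow> bit_matrix \<Rightarrow> bool" where
  "square l M \<longleftrightarrow> length M = l \<and> (\<forall>r\<in>set M. length r = l)"

lemma ops_erased_columns_op:
  assumes "\<forall>M\<in>set Ms. square l M"
  shows "ops (erased_columns_op l d Ms) \<le> length d * (l * (l + 2) + 2) + l + 2"
  using assms
proof (induction l d Ms rule: erased_columns.induct)
  case (1 l a d M Ms)
  have "ops (join_rows_op M (erased_columns l d Ms)) \<le> l * (l + 2) + 1"
    using ops_join_rows_op [of M l "erased_columns l d Ms"] 1(3) by (auto simp: square_def)
  moreover have "ops (erased_columns_op l d Ms) \<le> length d * (l * (l + 2) + 2) + l + 2"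
    using 1 by auto
  ultimately show ?case by auto
qed auto

lemma length_erased_columns:
  "\<forall>M\<in>set Ms. square l M \<Longrightarrow> length (erased_columns l d Ms) = l"
  by (induction l d Ms rule: erased_columns.induct) (auto simp: square_def)

definition erasures :: "nat list \<Rightarrow> nat" where
  "erasures d = length (filter (\<lambda>a. a \<noteq> 0) d)"

lemma erasures_Cons [simp]: "erasures (a # d) = (if a = 0 then erasures d else Suc (erasures d))"
  and erasures_Nil [simp]: "erasures [] = 0"
  by (simp_all add: erasures_def)

lemma erasures_le_sum_list: "erasures d \<le> sum_list d"
  by (induction d) auto

lemma length_row_erased_columns:
  "\<forall>M\<in>set Ms. square l M \<Longrightarrow> length d = length Ms \<Longrightarrow> r \<in> set (erased_columns l d Ms) \<Longrightarrow>
    length r = erasures d * l"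
proof (induction l d Ms arbitrary: r rule: erased_columns.induct)
  case (1 l a d M Ms)
  show ?case
  proof (cases "a = 0")
    case False
    then obtain r1 r2 where r: "(r1, r2) \<in> set (zip M (erased_columns l d Ms))" "r = r1 @ r2"
      using 1(5) by auto
    then have "r1 \<in> set M" "r2 \<in> set (erased_columns l d Ms)"
      by (auto dest: set_zip_leftD set_zip_rightD)
    with r show ?thesis using 1(2) [of r2] 1(3,4) False by (simp add: square_def)
  qed (use 1 in auto)
qed auto

lemma result_attach_op [simp]: "result (attach_op M q) = zip M q"
  by (induction M q rule: attach_op.induct) auto

lemma ops_attach_op: "ops (attach_op M q) \<le> length M + 1"
  by (induction M q rule: attach_op.induct) auto

lemma ops_equations_op:
  assumes "\<forall>Ms\<in>set T. \<forall>M\<in>set Ms. square l M"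
  shows "ops (equations_op l d T qs) \<le>
    length T * (length d * (l * (l + 2) + 2) + 3 * l + 6) + 1"
  using assms
proof (induction l d T qs rule: equations_op.induct)
  case (1 l d Ms T q qs)
  have "ops (erased_columns_op l d Ms) \<le> length d * (l * (l + 2) + 2) + l + 2"
    using 1(2) by (intro ops_erased_columns_op) auto
  moreover have "ops (attach_op (erased_columns l d Ms) q) \<le> l + 1"
    using ops_attach_op [of "erased_columns l d Ms" q] length_erased_columns [of Ms l d] 1(2) by auto
  moreover have "length (zip (erased_columns l d Ms) q) \<le> l"
    using length_erased_columns [of Ms l d] 1(2) by auto
  ultimately show ?case using 1 by simp
qed auto

lemma set_equations_op:
  "set (result (equations_op l d T qs)) =
    (\<Union>(Ms, q)\<in>set (zip T qs). set (zip (erased_columns l d Ms) q))"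
  by (induction l d T qs rule: equations_op.induct) auto

lemma length_equations_op:
  "\<forall>Ms\<in>set T. \<forall>M\<in>set Ms. square l M \<Longrightarrow>
    length (result (equations_op l d T qs)) \<le> length T * l"
  by (induction l d T qs rule: equations_op.induct) (auto simp: length_erased_columns)

lemma solves_equations_op:
  assumes "\<forall>Ms\<in>set T. \<forall>M\<in>set Ms. square l M" "\<forall>q\<in>set qs. length q = l"
  shows "solves x (result (equations_op l d T qs)) \<longleftrightarrow>
    (\<forall>(Ms, q)\<in>set (zip T qs). mat_vec (erased_columns l d Ms) x = q)"
proof -
  have "(\<forall>(r, b)\<in>set (zip (erased_columns l d Ms) q). dot r x = b) \<longleftrightarrow>
      mat_vec (erased_columns l d Ms) x = q" if "(Ms, q) \<in> set (zip T qs)" for Ms q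
  proof -
    have "Ms \<in> set T" "q \<in> set qs"
      using that by (auto dest: set_zip_leftD set_zip_rightD)
    then have "length (erased_columns l d Ms) = length q"
      using assms by (simp add: length_erased_columns)
    then have "mat_vec (erased_columns l d Ms) x = q \<longleftrightarrow>
        (\<forall>i<length q. dot (erased_columns l d Ms ! i) x = q ! i)"
      by (subst list_eq_iff_nth_eq) (auto simp: mat_vec_def)
    then show ?thesis
      using \<open>length (erased_columns l d Ms) = length q\<close> by (auto simp: set_zip)
  qed
  then show ?thesis
    unfolding solves_def set_equations_op by (simp add: case_prod_beta)
qed

lemma result_count_erased_op [simp]: "result (count_erased_op d) = erasures d"
  by (induction d) auto

lemma ops_count_erased_op [simp]: "ops (count_erased_op d) = length d + 1"
  by (induction d) auto

fun fill :: "nat list \<Rightarrow> bool list list \<Rightarrow> bool list list \<Rightarrow> bool list list" where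
  "fill (a # d) (b # bs) xs =
    (if a = 0 then b # fill d bs xs else hd xs # fill d bs (tl xs))"
| "fill _ _ _ = []"

lemma result_fill_op [simp]: "result (fill_op d bs xs) = fill d bs xs"
  by (induction d bs xs rule: fill_op.induct) auto

lemma ops_fill_op: "ops (fill_op d bs xs) \<le> length d + 1"
  by (induction d bs xs rule: fill_op.induct) auto

lemma length_fill [simp]: "length (fill d bs xs) = min (length d) (length bs)"
  by (induction d bs xs rule: fill.induct) auto

lemma nth_fill_unerased: "j < length d \<Longrightarrow> j < length bs \<Longrightarrow> d ! j = 0 \<Longrightarrow> fill d bs xs ! j = bs ! j"
  by (induction d bs xs arbitrary: j rule: fill.induct) (auto simp: nth_Cons split: nat.splits)

lemma length_nth_fill:
  assumes "\<forall>j<length d. d ! j = 0 \<longrightarrow> length (bs ! j) = l" "\<forall>x\<in>set xs. length x = l"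
    "length xs = erasures d" "length bs = length d" "y \<in> set (fill d bs xs)"
  shows "length y = l"
  using assms
proof (induction d bs xs rule: fill.induct)
  case (1 a d b bs xs)
  have *: "\<forall>j<length d. d ! j = 0 \<longrightarrow> length (bs ! j) = l" using 1(3) by fastforce
  show ?case
  proof (cases "a = 0")
    case True
    then show ?thesis using 1 * by force
  next
    case False
    then obtain x xs' where "xs = x # xs'" using 1(5) by (cases xs) auto
    then show ?thesis using 1(2) * 1(4-) False by auto
  qed
qed auto

text \<open>Turns a string that agrees with the received blocks into values of the unknowns, so that
  an unsolvable system excludes every decoded string.\<close>

lemma fill_surj:
  assumes "length Y = length d" "length bs = length d"
    "\<forall>j<length d. d ! j = 0 \<longrightarrow> Y ! j = bs ! j"
  shows "\<exists>xs. length xs = erasures d \<and> set xs \<subseteq> set Y \<and> Y = fill d bs xs"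
  using assms
proof (induction d arbitrary: Y bs)
  case (Cons a d)
  then obtain y Y' b bs' where Y: "Y = y # Y'" "bs = b # bs'" by (metis length_Suc_conv)
  have "\<forall>j<length d. d ! j = 0 \<longrightarrow> Y' ! j = bs' ! j" using Cons(4) Y by fastforce
  then obtain xs where xs: "length xs = erasures d" "set xs \<subseteq> set Y'" "Y' = fill d bs' xs"
    using Cons.IH [of Y' bs'] Cons.prems Y by auto
  show ?case
  proof (cases "a = 0")
    case True
    then have "y = b" using Cons(4) Y by force
    then show ?thesis using xs Y True by auto
  next
    case False
    then show ?thesis using xs Y by (intro exI [of _ "y # xs"]) auto
  qed
qed auto

text \<open>By linearity a parity splits into the part of the known blocks, with zeros in place of
  the erased ones, and the part of the erased blocks, whose matrices stand side by side and act on
  the concatenated unknowns.\<close>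

lemma parity_bits_fill:
  assumes "\<forall>M\<in>set Ms. square l M" "length Ms = length d" "length bs = length d"
    "\<forall>j<length d. d ! j = 0 \<longrightarrow> length (bs ! j) = l"
    "\<forall>x\<in>set xs. length x = l" "length xs = erasures d"
  shows "parity_bits l Ms (fill d bs xs) =
    xor_list (parity_bits l Ms (zero_erased l d bs)) (mat_vec (erased_columns l d Ms) (concat xs))"
  using assms
proof (induction d arbitrary: Ms bs xs)
  case Nil
  then show ?case by (simp add: zero_erased_def mat_vec_def)
next
  case (Cons a d)
  then obtain M Ms' b bs' where M: "Ms = M # Ms'" "bs = b # bs'" by (metis length_Suc_conv)
  have *: "\<forall>j<length d. d ! j = 0 \<longrightarrow> length (bs' ! j) = l" using Cons(5) M by fastforce
  have sq: "square l M" "\<forall>M\<in>set Ms'. square l M" "length Ms' = length d" "length bs' = length d"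
    using Cons M by auto
  show ?case
  proof (cases "a = 0")
    case True
    have "parity_bits l Ms' (fill d bs' xs) = xor_list (parity_bits l Ms' (zero_erased l d bs'))
        (mat_vec (erased_columns l d Ms') (concat xs))"
      using Cons.prems True * sq by (intro Cons.IH) auto
    then show ?thesis
      using True M by (simp add: zero_erased_def xor_list_assoc)
  next
    case False
    then obtain x xs' where x: "xs = x # xs'" using Cons.prems by (cases xs) auto
    have IH: "parity_bits l Ms' (fill d bs' xs') = xor_list (parity_bits l Ms' (zero_erased l d bs'))
        (mat_vec (erased_columns l d Ms') (concat xs'))"
      using Cons.prems False x * sq by (intro Cons.IH) auto
    have mv: "mat_vec (map2 (@) M N) (x @ z) = xor_list (mat_vec M x) (mat_vec N z)"
      if "length N = l" for N z
      using that Cons.prems x sq(1)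
      by (intro nth_equalityI)
        (auto simp: mat_vec_def xor_list_def square_def dot_append)
    have len: "length (parity_bits l Ms' w) = l" for w
      using sq by (intro length_parity_bits) (auto simp: square_def)
    have "parity_bits l Ms (zero_erased l (a # d) bs) = parity_bits l Ms' (zero_erased l d bs')"
      using False M sq len by (simp add: zero_erased_def square_def)
    moreover have "mat_vec (erased_columns l (a # d) Ms) (concat xs) =
        xor_list (mat_vec M x) (mat_vec (erased_columns l d Ms') (concat xs'))"
      using False M x sq by (simp add: mv length_erased_columns)
    ultimately show ?thesis
      using False M x IH by (simp add: xor_list_left_commute)
  qed
qed

lemma result_superseqs_op:
  assumes "length bs = length d" "length Y = length d"
  shows "result (superseqs_op d bs Y) \<longleftrightarrow> (\<forall>j<length d. d ! j > 0 \<longrightarrow> subseq (bs ! j) (Y ! j))"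
  using assms
proof (induction d arbitrary: bs Y)
  case (Cons a d)
  then obtain b bs' y Y' where "bs = b # bs'" "Y = y # Y'" by (metis length_Suc_conv)
  then show ?case using Cons by (auto simp: All_less_Suc2)
qed auto

lemma ops_superseqs_op:
  "\<forall>y\<in>set Y. length y \<le> l \<Longrightarrow> ops (superseqs_op d bs Y) \<le> length d * (l + 2) + 1"
proof (induction d bs Y rule: superseqs_op.induct)
  case (1 a d b bs y ys)
  then show ?case using ops_subseq_op [of b y] by simp
qed auto

lemma result_all_equal_op [simp]: "result (all_equal_op Y Zs) \<longleftrightarrow> (\<forall>Z\<in>set Zs. Y = Z)"
  by (induction Zs) auto

lemma ops_all_equal_op:
  "\<forall>y\<in>set Y. length y \<le> l \<Longrightarrow> ops (all_equal_op Y Zs) \<le> length Zs * (length Y * (l + 2) + 2) + 1"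
proof (induction Zs)
  case (Cons Z Zs)
  then show ?case using ops_equal_blocks_op [of Y l Z] by simp
qed simp

lemma concat_blocks: "length x = n * l \<Longrightarrow> concat (map (block l x) [0..<n]) = x"
proof (induction n arbitrary: x)
  case (Suc n)
  have "concat (map (block l (drop l x)) [0..<n]) = drop l x"
    using Suc by simp
  then show ?case
    by (simp add: map_upt_Suc block_0 block_Suc del: upt_Suc)
qed simp

lemma length_block: "length x = n * l \<Longrightarrow> j < n \<Longrightarrow> length (block l x j) = l"
proof -
  assume "length x = n * l" "j < n"
  moreover have "(j + 1) * l \<le> n * l" using \<open>j < n\<close> by (intro mult_le_mono) auto
  ultimately show ?thesis by (simp add: block_def)
qed

lemma block_concat:
  "\<forall>b\<in>set bs. length b = l \<Longrightarrow> j < length bs \<Longrightarrow> block l (concat bs) j = bs ! j"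
proof (induction bs arbitrary: j)
  case (Cons b bs)
  then show ?case by (cases j) (auto simp: block_0 block_Suc)
qed simp

lemma set_check_all_op:
  "set (result (check_all_op T l \<delta> ps s ds)) =
    {Z. \<exists>d\<in>set ds. result (check_op T l \<delta> ps s d) = Some Z}"
  by (induction ds) (auto split: option.splits)

lemma length_check_all_op: "length (result (check_all_op T l \<delta> ps s ds)) \<le> length ds"
  by (induction ds) (auto split: option.splits)

text \<open>The first string equals all others iff the set of strings is a singleton; this links the
  list of the program, which may have repetitions, to the set in \<open>gc_decode\<close>.\<close>

lemma result_output_op:
  "result (output_op k Zs) =
    (if \<exists>Z. set Zs = {Z} then Some (take k (concat (the_elem (set Zs)))) else None)"
proof (cases Zs)
  case (Cons Y Ys)
  show ?thesis
  proof (cases "\<forall>Z\<in>set Ys. Y = Z")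
    case True
    then have "set Zs = {Y}" using Cons by auto
    moreover have "result (output_op k Zs) = Some (take k (concat Y))" using Cons True by simp
    ultimately show ?thesis by simp
  next
    case False
    then have "\<not> (\<exists>Z. set Zs = {Z})" using Cons by auto
    then show ?thesis using Cons False by simp
  qed
qed auto

lemma sum_sizes:
  assumes "length d = m" "sum_list d = \<delta>" "\<forall>a\<in>set d. a \<le> l"
  shows "(\<Sum>i<m. l - d ! i) = m * l - \<delta>" "\<delta> \<le> m * l"
proof -
  have s: "(\<Sum>i<m. d ! i) = \<delta>"
    using assms sum_list_sum_nth [of d] by (simp add: atLeast0LessThan)
  have "(\<Sum>i<m. l - d ! i) = (\<Sum>i<m. l) - (\<Sum>i<m. d ! i)"
    using assms by (intro sum_subtractf_nat) auto
  then show "(\<Sum>i<m. l - d ! i) = m * l - \<delta>"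
    using s by simp
  have "(\<Sum>i<m. d ! i) \<le> (\<Sum>i<m. l)"
    using assms by (intro sum_mono) auto
  then show "\<delta> \<le> m * l" using s by simp
qed

lemma length_subblock:
  assumes "length d = m" "sum_list d = \<delta>" "\<forall>a\<in>set d. a \<le> l" "length s = m * l - \<delta>" "j < m"
  shows "length (subblock l d s j) = l - d ! j"
proof -
  have "(\<Sum>i<j. l - d ! i) + (l - d ! j) = (\<Sum>i<Suc j. l - d ! i)"
    by simp
  also have "\<dots> \<le> (\<Sum>i<m. l - d ! i)"
    using assms by (intro sum_mono2) auto
  also have "\<dots> = length s"
    using assms sum_sizes by metis
  finally show ?thesis by (simp add: subblock_def)
qed

section \<open>Correctness of the check of a single case\<close>

context gc
begin

abbreviation T :: "bit_matrix list list" where "T \<equiv> code_table R B G k c"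

lemma length_T [simp]: "length T = c"
  by (simp add: code_table_def)

lemma square_T: "\<forall>Ms\<in>set T. \<forall>M\<in>set Ms. square l M"
  by (auto simp: code_table_def square_def mult_matrix_def length_B)

lemma length_nth_T: "r < c \<Longrightarrow> length (T ! r) = m"
  by (simp add: code_table_def)

lemma square_nth_T: "r < c \<Longrightarrow> \<forall>M\<in>set (T ! r). square l M"
  using square_T by (metis length_T nth_mem)

text \<open>Uniqueness of erasure decoding: the strings differ in at most \<open>\<delta>\<close>
  erased symbols and at most the \<open>c - \<delta>\<close> remaining parities, in total in at most
  \<open>c\<close> places.\<close>

lemma symbols_eqI:
  assumes "length Y = m" "set Y \<subseteq> carrier R" "length Y' = m" "set Y' \<subseteq> carrier R"
    and d: "d \<in> deletion_cases m \<delta>"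
    and agree: "\<forall>j<m. d ! j = 0 \<longrightarrow> Y ! j = Y' ! j"
    and par: "\<forall>r<\<delta>. parity R (G r) Y = parity R (G r) Y'"
  shows "Y = Y'"
proof (rule message_eqI)
  have "card {j. j < m \<and> Y ! j \<noteq> Y' ! j} \<le> card {j. j < m \<and> d ! j \<noteq> 0}"
    using agree by (intro card_mono) auto
  also have "\<dots> = erasures d"
    using d by (simp add: erasures_def length_filter_conv_card deletion_cases_def)
  also have "\<dots> \<le> \<delta>"
    using d erasures_le_sum_list [of d] by (simp add: deletion_cases_def)
  finally have 1: "card {j. j < m \<and> Y ! j \<noteq> Y' ! j} \<le> \<delta>" .
  have "card {r. r < c \<and> parity R (G r) Y \<noteq> parity R (G r) Y'} \<le> card {\<delta>..<c}"
    using par by (intro card_mono) (auto simp: not_less [symmetric])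
  then show "card {j. j < m \<and> Y ! j \<noteq> Y' ! j} +
      card {r. r < c \<and> parity R (G r) Y \<noteq> parity R (G r) Y'} \<le> c"
    using 1 c_gt by simp
qed (use assms in auto)

text \<open>Through \<open>fill\<close>, the solutions of the linear system are exactly the decoded
  strings, and by \<open>symbols_eqI\<close> there is at most one of these; so the arbitrary choices
  of \<open>solve_op\<close> do no harm.\<close>

lemma check_op_correct:
  assumes p: "length p = c" "set p \<subseteq> carrier R"
    and s: "length s = m * l - \<delta>"
    and d: "d \<in> deletion_cases m \<delta>"
  shows "result (check_op T l \<delta> (map bts p) s d) = Some Z \<longleftrightarrow>
    (\<exists>Y. possible_case R B G k \<delta> c p s d Y \<and> Z = map bts Y)"
proof (cases "\<forall>a\<in>set d. a \<le> l")
  case False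
  then have "\<not> (\<forall>j<m. d ! j \<le> l)"
    using d by (auto simp: deletion_cases_def in_set_conv_nth)
  then show ?thesis
    using False by (auto simp: check_op_def possible_case_def)
next
  case True
  have len_d: "length d = m" and sum_d: "sum_list d = \<delta>"
    using d by (auto simp: deletion_cases_def)
  define bs where "bs = map (subblock l d s) [0..<m]"
  define n where "n = erasures d"
  define qs where "qs = map (\<lambda>Ms. parity_bits l Ms (zero_erased l d bs)) T"
  \<comment> \<open>The syndrome: the received parities minus the contribution of the unerased
    blocks, which is what the erased blocks have to supply.\<close>
  define syn where "syn = map2 xor_list (map bts p) qs"
  define es where "es = result (equations_op l d (take \<delta> T) syn)"
  have len_bs: "length bs = m" by (simp add: bs_def)
  have bs_l: "\<forall>j<length d. d ! j = 0 \<longrightarrow> length (bs ! j) = l"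
    using length_subblock [OF len_d sum_d True s] by (auto simp: bs_def len_d)
  have len_par: "length (parity_bits l Ms w) = l" if "Ms \<in> set T" for Ms w
    using that square_T by (intro length_parity_bits) (auto simp: square_def)
  have zip_syn: "set (zip (take \<delta> T) syn) =
      (\<lambda>r. (T ! r, xor_list (bts (p ! r)) (parity_bits l (T ! r) (zero_erased l d bs)))) ` {..<\<delta>}"
  proof -
    have "zip (take \<delta> T) syn = map (\<lambda>r. (T ! r,
        xor_list (bts (p ! r)) (parity_bits l (T ! r) (zero_erased l d bs)))) [0..<\<delta>]"
      using p c_gt by (intro nth_equalityI) (auto simp: syn_def qs_def)
    then show ?thesis by (simp add: atLeast0LessThan)
  qed
  have W: "length (fill d bs xs) = m" "\<forall>b\<in>set (fill d bs xs). length b = l"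
    "set (map sym (fill d bs xs)) \<subseteq> carrier R"
    if "length xs = n" "\<forall>x\<in>set xs. length x = l" for xs
  proof -
    show "length (fill d bs xs) = m" by (simp add: len_d len_bs)
    show "\<forall>b\<in>set (fill d bs xs). length b = l"
    proof
      fix b assume b: "b \<in> set (fill d bs xs)"
      show "length b = l"
        by (rule length_nth_fill [OF bs_l that(2) _ _ b]) (simp_all add: that(1) n_def len_bs len_d)
    qed
    show "set (map sym (fill d bs xs)) \<subseteq> carrier R" by auto
  qed
  have solves: "solves (concat xs) es \<longleftrightarrow>
      erasure_decoded R B G k \<delta> p s d (map sym (fill d bs xs))"
    if xs: "length xs = n" "\<forall>x\<in>set xs. length x = l" for xs
  proof -
    have "solves (concat xs) es \<longleftrightarrow>
      (\<forall>r<\<delta>. mat_vec (erased_columns l d (T ! r)) (concat xs) =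
        xor_list (bts (p ! r)) (parity_bits l (T ! r) (zero_erased l d bs)))"
    proof -
      have "\<forall>Ms\<in>set (take \<delta> T). \<forall>M\<in>set Ms. square l M"
        using square_T by (auto dest: in_set_takeD)
      moreover have "\<forall>q\<in>set syn. length q = l"
        using len_par nth_closed [OF p(2)] by (auto simp: syn_def qs_def set_zip p(1))
      ultimately show ?thesis
        unfolding es_def by (subst solves_equations_op) (auto simp: zip_syn)
    qed
    also have "\<dots> \<longleftrightarrow> (\<forall>r<\<delta>. parity_bits l (T ! r) (fill d bs xs) = bts (p ! r))"
    proof (intro all_cong)
      fix r assume "r < \<delta>"
      then have r: "r < c" using c_gt by simp
      define P E Q where "P = parity_bits l (T ! r) (zero_erased l d bs)"
        and "E = mat_vec (erased_columns l d (T ! r)) (concat xs)" and "Q = bts (p ! r)"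
      have "length P = l" "length E = l" "length Q = l"
        using r p len_par [of "T ! r"] length_erased_columns [OF square_nth_T [OF r]]
        by (auto simp: P_def E_def Q_def nth_closed)
      then have "E = xor_list Q P \<longleftrightarrow> xor_list P E = Q"
        using xor_list_cancel [of P E] xor_list_cancel [of P Q] xor_list_commute [of P Q] by auto
      moreover have "parity_bits l (T ! r) (fill d bs xs) = xor_list P E"
        unfolding P_def E_def using xs r len_d len_bs bs_l
        by (intro parity_bits_fill) (auto simp: n_def square_nth_T length_nth_T)
      ultimately show "mat_vec (erased_columns l d (T ! r)) (concat xs) =
          xor_list (bts (p ! r)) (parity_bits l (T ! r) (zero_erased l d bs)) \<longleftrightarrow>
          parity_bits l (T ! r) (fill d bs xs) = bts (p ! r)"
        by (simp add: P_def E_def Q_def)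
    qed
    also have "\<dots> \<longleftrightarrow> (\<forall>r<\<delta>. parity R (G r) (map sym (fill d bs xs)) = p ! r)"
      using W [OF xs] p c_gt
      by (intro all_cong) (auto simp: parity_bits_code_table bits_eq_iff nth_closed)
    also have "\<dots> \<longleftrightarrow> erasure_decoded R B G k \<delta> p s d (map sym (fill d bs xs))"
      using W [OF xs] len_d len_bs
      by (auto simp: erasure_decoded_def nth_fill_unerased bs_def)
    finally show ?thesis .
  qed
  have uniq: "Y = Y'"
    if "erasure_decoded R B G k \<delta> p s d Y" "erasure_decoded R B G k \<delta> p s d Y'" for Y Y'
    using that d by (intro symbols_eqI [of Y Y' d]) (auto simp: erasure_decoded_def)
  have n_l: "\<forall>(a, b)\<in>set es. length a = n * l"
  proof -
    have "length a = n * l" if "(a, b) \<in> set es" for a b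
    proof -
      from that obtain r where r: "r < \<delta>" "a \<in> set (erased_columns l d (T ! r))"
        unfolding es_def set_equations_op zip_syn by (auto dest: set_zip_leftD)
      then show ?thesis
        using length_row_erased_columns [of "T ! r" l d a] square_nth_T [of r] c_gt len_d
        by (simp add: length_nth_T n_def)
    qed
    then show ?thesis by auto
  qed
  note solver = solve_op_correct [OF n_l]
  show ?thesis
  proof (cases "result (solve_op (n * l) es)")
    case None
    have "result (check_op T l \<delta> (map bts p) s d) = None"
      using True None
      by (simp add: check_op_def es_def syn_def qs_def bs_def n_def len_d)
    \<comment> \<open>The unknowns that \<open>fill_surj\<close> extracts from a decoded string
      would solve the system.\<close>
    moreover have False if poss: "possible_case R B G k \<delta> c p s d Y" for Y
    proof -
      have Y: "erasure_decoded R B G k \<delta> p s d Y"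
        using poss by (simp add: possible_case_def)
      have agree: "\<forall>j<length d. d ! j = 0 \<longrightarrow> map bts Y ! j = bs ! j"
        using Y len_d length_subblock [OF len_d sum_d True s]
        by (auto simp: erasure_decoded_def bs_def bits_symbol)
      have "length (map bts Y) = length d" "length bs = length d"
        using Y len_d len_bs by (auto simp: erasure_decoded_def)
      from fill_surj [OF this agree]
      obtain xs where xs: "length xs = n" "set xs \<subseteq> set (map bts Y)" "map bts Y = fill d bs xs"
        unfolding n_def by blast
      have YR: "set Y \<subseteq> carrier R" using Y by (simp add: erasure_decoded_def)
      then have xs_l: "\<forall>x\<in>set xs. length x = l"
        using xs(2) length_bits by (metis (no_types, lifting) imageE image_set subsetD)
      have "map sym (fill d bs xs) = Y"
        unfolding xs(3) [symmetric] using YR by (auto intro!: map_idI simp: symbol_bits)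
      then have "solves (concat xs) es"
        using solves [OF xs(1) xs_l] Y by simp
      moreover have "length (concat xs) = n * l"
        using xs_l xs(1) by (induction xs arbitrary: n) auto
      ultimately show False using solver None by auto
    qed
    ultimately show ?thesis by auto
  next
    case (Some x)
    then have x: "length x = n * l" "solves x es" using solver by auto
    define xs where "xs = map (block l x) [0..<n]"
    have xs: "length xs = n" "\<forall>x\<in>set xs. length x = l"
      using length_block [OF x(1)] by (auto simp: xs_def)
    have "concat xs = x" using concat_blocks [OF x(1)] by (simp add: xs_def)
    define V where "V = fill d bs xs"
    note WV = W [OF xs, folded V_def]
    have dec: "erasure_decoded R B G k \<delta> p s d (map sym V)"
      using solves [OF xs] x \<open>concat xs = x\<close> by (simp add: V_def)
    have V: "map bts (map sym V) = V"
      using WV by (auto intro!: map_idI simp: bits_symbol)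
    have res: "result (check_op T l \<delta> (map bts p) s d) =
        (if map (\<lambda>Ms. parity_bits l Ms V) (drop \<delta> T) = drop \<delta> (map bts p) \<and>
          (\<forall>j<m. d ! j > 0 \<longrightarrow> subseq (bs ! j) (V ! j)) then Some V else None)"
    proof -
      have "result (superseqs_op d bs V) = (\<forall>j<m. d ! j > 0 \<longrightarrow> subseq (bs ! j) (V ! j))"
        using WV len_d len_bs by (subst result_superseqs_op) auto
      then show ?thesis
        using True Some
        by (auto simp add: check_op_def es_def syn_def qs_def bs_def n_def len_d V_def xs_def)
    qed
    have c1: "map (\<lambda>Ms. parity_bits l Ms V) (drop \<delta> T) = drop \<delta> (map bts p) \<longleftrightarrow>
        (\<forall>r. \<delta> \<le> r \<and> r < c \<longrightarrow> parity R (G r) (map sym V) = p ! r)"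
    proof -
      have "map (\<lambda>Ms. parity_bits l Ms V) (drop \<delta> T) = drop \<delta> (map bts p) \<longleftrightarrow>
        (\<forall>i<c - \<delta>. parity_bits l (T ! (\<delta> + i)) V = bts (p ! (\<delta> + i)))"
        using p by (auto simp: list_eq_iff_nth_eq)
      also have "\<dots> \<longleftrightarrow> (\<forall>i<c - \<delta>. parity R (G (\<delta> + i)) (map sym V) = p ! (\<delta> + i))"
        using WV p by (intro all_cong) (auto simp: parity_bits_code_table bits_eq_iff nth_closed)
      also have "\<dots> \<longleftrightarrow> (\<forall>r. \<delta> \<le> r \<and> r < c \<longrightarrow> parity R (G r) (map sym V) = p ! r)"
      proof (intro iffI allI impI)
        fix r assume "\<forall>i<c - \<delta>. parity R (G (\<delta> + i)) (map sym V) = p ! (\<delta> + i)" "\<delta> \<le> r \<and> r < c"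
        then show "parity R (G r) (map sym V) = p ! r"
          by (auto dest: spec [of _ "r - \<delta>"])
      qed simp
      finally show ?thesis .
    qed
    have "possible_case R B G k \<delta> c p s d (map sym V) \<longleftrightarrow>
        map (\<lambda>Ms. parity_bits l Ms V) (drop \<delta> T) = drop \<delta> (map bts p) \<and>
          (\<forall>j<m. d ! j > 0 \<longrightarrow> subseq (bs ! j) (V ! j))"
      unfolding c1 possible_case_def
      using dec True len_d WV by (auto simp: bs_def bits_symbol)
    then have "result (check_op T l \<delta> (map bts p) s d) = Some Z \<longleftrightarrow>
        possible_case R B G k \<delta> c p s d (map sym V) \<and> Z = V"
      using res by auto
    also have "\<dots> \<longleftrightarrow> (\<exists>Y. possible_case R B G k \<delta> c p s d Y \<and> Z = map bts Y)"
    proof -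
      have "Y = map sym V" if "possible_case R B G k \<delta> c p s d Y" for Y
        using uniq [OF dec, of Y] that by (simp add: possible_case_def)
      then show ?thesis using V by metis
    qed
    finally show ?thesis .
  qed
qed

end

section \<open>Deletions\<close>

text \<open>A surviving symbol has moved to the left by the number \<open>t\<close> of deletions
  before it, which is at most the total number of deletions.\<close>

lemma subseq_nth:
  assumes "subseq xs ys" "j < length xs"
  shows "\<exists>t. t + length xs \<le> length ys \<and> xs ! j = ys ! (j + t)"
  using assms
proof (induction arbitrary: j rule: list_emb.induct)
  case (list_emb_Cons xs ys y)
  then obtain t where "t + length xs \<le> length ys" "xs ! j = ys ! (j + t)" by blast
  then show ?case by (intro exI [of _ "Suc t"]) auto
next
  case (list_emb_Cons2 x y xs ys)
  show ?case
  proof (cases j)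
    case 0
    then show ?thesis
      using list_emb_Cons2 list_emb_length by (intro exI [of _ 0]) auto
  next
    case (Suc j')
    then obtain t where "t + length xs \<le> length ys" "xs ! j' = ys ! (j' + t)"
      using list_emb_Cons2 by auto
    then show ?thesis using Suc by (intro exI [of _ t]) auto
  qed
qed simp

section \<open>The repetition code and deletions at given positions\<close>

lemma length_repeat_bits [simp]: "length (repeat_bits r bs) = length bs * r"
  by (induction bs) (auto simp: repeat_bits_def)

lemma nth_repeat_bits:
  "i < length bs \<Longrightarrow> t < r \<Longrightarrow> repeat_bits r bs ! (i * r + t) = bs ! i"
proof (induction bs arbitrary: i)
  case (Cons b bs)
  have *: "repeat_bits r (b # bs) = replicate r b @ repeat_bits r bs"
    by (simp add: repeat_bits_def)
  show ?case
  proof (cases i)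
    case 0
    then show ?thesis using Cons unfolding * by (simp add: nth_append)
  next
    case (Suc i')
    then show ?thesis using Cons unfolding * by (simp add: nth_append)
  qed
qed simp

text \<open>Before the deletions, position \<open>i * (\<delta> + 1)\<close> holds the first copy of
  bit \<open>i\<close>; the shift is at most \<open>\<delta>\<close>, so the symbol now found there
  still comes from the same group of copies.\<close>

lemma subseq_repeat_bits:
  assumes "subseq z (repeat_bits (\<delta> + 1) b)" "length z = length b * (\<delta> + 1) - \<delta>" "i < length b"
  shows "z ! (i * (\<delta> + 1)) = b ! i"
proof -
  have "(i + 1) * (\<delta> + 1) \<le> length b * (\<delta> + 1)"
    using assms(3) by (intro mult_le_mono) auto
  then have "i * (\<delta> + 1) < length z" "length z + \<delta> = length b * (\<delta> + 1)"
    using assms(2) by auto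
  moreover from subseq_nth [OF assms(1) calculation(1)] obtain t
    where "t + length z \<le> length (repeat_bits (\<delta> + 1) b)"
      "z ! (i * (\<delta> + 1)) = repeat_bits (\<delta> + 1) b ! (i * (\<delta> + 1) + t)"
    by blast
  ultimately have "t \<le> \<delta>" "z ! (i * (\<delta> + 1)) = repeat_bits (\<delta> + 1) b ! (i * (\<delta> + 1) + t)"
    by simp_all
  then show ?thesis
    using assms(3) nth_repeat_bits [of i b t "\<delta> + 1"] by simp
qed

text \<open>Every \<open>b'\<close> of this length that explains \<open>z\<close> is read off from
  \<open>z\<close> by sampling, which gives uniqueness.\<close>

lemma the_subseq_repeat_bits:
  assumes "subseq z (repeat_bits (\<delta> + 1) b)" "length z = length b * (\<delta> + 1) - \<delta>"
  shows "(THE b'. length b' = length b \<and> subseq z (repeat_bits (\<delta> + 1) b')) = b"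
proof (rule the_equality)
  fix b' assume b': "length b' = length b \<and> subseq z (repeat_bits (\<delta> + 1) b')"
  show "b' = b"
    using b' assms subseq_repeat_bits [of z \<delta> b'] subseq_repeat_bits [of z \<delta> b]
    by (intro nth_equalityI) auto
qed (use assms in simp)

lemma length_delete_at: "D \<subseteq> {..<length xs} \<Longrightarrow> length (delete_at D xs) = length xs - card D"
proof -
  assume D: "D \<subseteq> {..<length xs}"
  have "{i. i < length xs \<and> i \<in> - D} = {..<length xs} - D" by auto
  then show ?thesis
    using D by (simp add: delete_at_def length_nths card_Diff_subset finite_subset [of D])
qed

lemma delete_at_append:
  "delete_at D (xs @ ys) = delete_at D xs @ delete_at {j. j + length xs \<in> D} ys"
  unfolding delete_at_def nths_append by (simp add: Compl_eq)

lemma delete_at_cong: "D \<inter> {..<length xs} = E \<inter> {..<length xs} \<Longrightarrow> delete_at D xs = delete_at E xs"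
  unfolding delete_at_def nths_def
  by (rule arg_cong [where f = "map fst"], rule filter_cong [OF refl])
    (fastforce dest: set_zip_rightD)

lemma delete_at_empty: "D \<inter> {..<length xs} = {} \<Longrightarrow> delete_at D xs = xs"
  by (auto simp: delete_at_def intro!: nths_all)

lemma subseq_delete_at: "subseq (delete_at D xs) xs"
  unfolding delete_at_def subseq_conv_nths by blast

lemma nth_delete_at:
  assumes "i < length xs" "i \<notin> D"
  shows "delete_at D xs ! (i - card (D \<inter> {..<i})) = xs ! i"
proof -
  have xs: "xs = take i xs @ xs ! i # drop (Suc i) xs"
    using assms(1) by (rule id_take_nth_drop)
  have "length (delete_at D (take i xs)) = length (delete_at (D \<inter> {..<i}) (take i xs))"
    by (subst delete_at_cong [of D _ "D \<inter> {..<i}"]) auto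
  also have "\<dots> = i - card (D \<inter> {..<i})"
    using assms(1) by (subst length_delete_at) auto
  finally have len: "length (delete_at D (take i xs)) = i - card (D \<inter> {..<i})" .
  have "delete_at D xs = delete_at D (take i xs) @ delete_at {j. j + i \<in> D} (xs ! i # drop (Suc i) xs)"
    using assms(1) by (subst xs, subst delete_at_append) simp
  also have "delete_at {j. j + i \<in> D} (xs ! i # drop (Suc i) xs) =
      xs ! i # delete_at {j. Suc j + i \<in> D} (drop (Suc i) xs)"
    using assms(2) by (simp add: delete_at_def nths_Cons Compl_eq)
  finally show ?thesis
    using len by (simp add: nth_append)
qed

text \<open>Truncation to \<open>k - \<delta>\<close> bits acts as further deletions:
  \<open>D'\<close> collects the message positions that are deleted or survive only beyond the cut.
  It has exactly \<open>\<delta>\<close> elements because at least \<open>k - \<delta>\<close>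
  message bits survive, and it is the same for all \<open>u\<close>.\<close>

lemma take_delete_at_exists:
  assumes "D \<subseteq> {..<n}" "card D \<le> \<delta>" "\<delta> \<le> k" "k \<le> n"
  shows "\<exists>D'. D' \<subseteq> {..<k} \<and> card D' = \<delta> \<and>
    (\<forall>u. length u = k \<longrightarrow> take (k - \<delta>) (delete_at D u) = delete_at D' u)"
proof -
  define I where "I = {i. i < k \<and> i \<notin> D \<and> card {i'. i' \<notin> D \<and> i' < i} < k - \<delta>}"
  define D' where "D' = {..<k} - I"
  have eq: "take (k - \<delta>) (delete_at D u) = delete_at D' u" if "length u = k" for u :: "'b list"
  proof -
    have "take (k - \<delta>) (delete_at D u) = nths (nths u (- D)) {..<k - \<delta>}"
      unfolding nths_upt_eq_take delete_at_def ..
    also have "\<dots> = delete_at {i. \<not> (i \<notin> D \<and> card {i'. i' \<notin> D \<and> i' < i} < k - \<delta>)} u"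
      unfolding nths_nths delete_at_def by (rule arg_cong [where f = "nths u"]) auto
    also have "\<dots> = delete_at D' u"
      using that by (intro delete_at_cong) (auto simp: D'_def I_def)
    finally show ?thesis .
  qed
  have D': "D' \<subseteq> {..<k}" by (auto simp: D'_def)
  \<comment> \<open>The cardinality of \<open>D'\<close> is read off from string lengths, by
    applying the polymorphic \<open>eq\<close> to a dummy string of units.\<close>
  let ?u = "replicate k ()"
  have "length (delete_at D ?u) = k - card (D \<inter> {..<k})"
    by (subst delete_at_cong [of D _ "D \<inter> {..<k}"]) (auto simp: length_delete_at)
  moreover have "card (D \<inter> {..<k}) \<le> \<delta>"
  proof -
    have "finite D" using assms(1) finite_subset by blast
    then have "card (D \<inter> {..<k}) \<le> card D" by (intro card_mono) auto
    then show ?thesis using assms(2) by simp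
  qed
  ultimately have "length (take (k - \<delta>) (delete_at D ?u)) = k - \<delta>" by simp
  then have "k - card D' = k - \<delta>"
    using eq [of ?u] D' by (simp add: length_delete_at)
  moreover have "card D' \<le> k"
    using card_mono [OF _ D'] by simp
  ultimately have "card D' = \<delta>" using assms by simp
  then show ?thesis using D' eq by blast
qed

lemma sum_list_eq_sum: "length d = m \<Longrightarrow> sum_list d = (\<Sum>i<m. d ! i)"
  by (simp add: sum_list_sum_nth atLeast0LessThan)

section \<open>Block count, padding and the received string\<close>

context gc
begin

lemma l_pos: "l \<ge> 1"
proof -
  have "e \<noteq> 0" using k_gt c_gt \<delta>_ge k_eq by (cases "e = 0") auto
  then show ?thesis using l_eq by simp
qed

text \<open>The second bound says that the padding is shorter than one block, which later confines
  it to the last block.\<close>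

lemma m_bounds: "k \<le> m * l" "m * l < k + l"
proof -
  have log: "log 2 (real k) = real l"
    unfolding l_eq by (simp add: k_eq log_nat_power)
  have pos: "real l > 0" using l_pos by simp
  have c: "real m = of_int \<lceil>real k / real l\<rceil>"
    unfolding nblocks_def log by simp
  have "real k / real l \<le> real m"
    unfolding c by linarith
  then have "real k \<le> real (m * l)"
    using pos by (simp add: divide_le_eq)
  then show "k \<le> m * l" by linarith
  have "real m < real k / real l + 1"
    unfolding c by linarith
  then have "real m * real l < (real k / real l + 1) * real l"
    using pos by (intro mult_strict_right_mono)
  also have "\<dots> = real k + real l"
    using pos by (simp add: field_simps)
  finally show "m * l < k + l"
    by (metis of_nat_add of_nat_less_iff of_nat_mult)
qed

lemma \<delta>_le_k: "\<delta> \<le> k"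
  using k_gt c_gt by simp

lemma length_padding [simp]: "length (padding k) = m * l - k"
  by (simp add: padding_def)

definition padded :: "bool list \<Rightarrow> bool list" where
  "padded u = u @ padding k"

lemma length_padded [simp]: "length u = k \<Longrightarrow> length (padded u) = m * l"
  using m_bounds by (simp add: padded_def)

abbreviation syms :: "bool list \<Rightarrow> 'a list" where
  "syms u \<equiv> message_symbols R B k u"

definition parities :: "bool list \<Rightarrow> 'a list" where
  "parities u = map (\<lambda>r. parity R (G r) (syms u)) [0..<c]"

lemma length_syms [simp]: "length (syms u) = m"
  by (simp add: message_symbols_def)

lemma set_syms: "set (syms u) \<subseteq> carrier R"
  by (auto simp: message_symbols_def)

lemma nth_syms: "j < m \<Longrightarrow> syms u ! j = sym (block l (padded u) j)"
  by (simp add: message_symbols_def padded_def)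

lemma map_bits_syms:
  assumes "length u = k"
  shows "map bts (syms u) = map (block l (padded u)) [0..<m]"
  using length_block [OF length_padded [OF assms]]
  by (intro nth_equalityI) (auto simp: nth_syms bits_symbol)

lemma concat_bits_syms: "length u = k \<Longrightarrow> concat (map bts (syms u)) = padded u"
  using concat_blocks [of "padded u" m l] map_bits_syms by simp

lemma length_parities [simp]: "length (parities u) = c"
  and set_parities: "set (parities u) \<subseteq> carrier R"
  and nth_parities: "r < c \<Longrightarrow> parities u ! r = parity R (G r) (syms u)"
  using set_syms by (auto simp: parities_def)

abbreviation parity_string :: "bool list \<Rightarrow> bool list" where
  "parity_string u \<equiv> concat (map bts (parities u))"

lemma gc_encode_eq: "gc_encode R B G k \<delta> c u = u @ repeat_bits (\<delta> + 1) (parity_string u)"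
  by (simp add: gc_encode_def parities_def Let_def)

lemma length_concat_bits: "set p \<subseteq> carrier R \<Longrightarrow> length (concat (map bts p)) = length p * l"
  by (induction p) auto

lemma block_concat_bits:
  "set p \<subseteq> carrier R \<Longrightarrow> j < length p \<Longrightarrow> block l (concat (map bts p)) j = bts (p ! j)"
  using block_concat [of "map bts p" l j] by (auto simp: subset_iff)

lemma length_gc_encode:
  "length u = k \<Longrightarrow> length (gc_encode R B G k \<delta> c u) = k + c * (\<delta> + 1) * l"
  using length_concat_bits [OF set_parities] by (simp add: gc_encode_eq algebra_simps)

abbreviation tail :: "bool list \<Rightarrow> bool list" where
  "tail y \<equiv> drop (length y - (c * (\<delta> + 1) * l - \<delta>)) y"

context
  fixes u :: "bool list" and D :: "nat set"
  assumes u: "length u = k" and D: "D \<subseteq> {..<k + c * (\<delta> + 1) * l}" "card D \<le> \<delta>"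
begin

definition received :: "bool list" where
  "received = delete_at D (gc_encode R B G k \<delta> c u)"

lemma finite_D: "finite D"
  using D finite_subset by blast

lemma received_eq:
  "received = delete_at D u @ delete_at {j. j + k \<in> D} (repeat_bits (\<delta> + 1) (parity_string u))"
  by (simp add: received_def gc_encode_eq delete_at_append u)

lemma length_delete_u: "length (delete_at D u) \<ge> k - \<delta>"
proof -
  have "length (delete_at D u) = length (delete_at (D \<inter> {..<k}) u)"
    by (subst delete_at_cong [of D _ "D \<inter> {..<k}"]) (auto simp: u)
  also have "\<dots> = k - card (D \<inter> {..<k})"
    by (subst length_delete_at) (auto simp: u)
  also have "card (D \<inter> {..<k}) \<le> card D"
    using finite_D by (intro card_mono) auto
  ultimately show ?thesis using D by linarith
qed

text \<open>Fewer than \<open>\<delta>\<close> deletions in the parity part leave a longer string;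
  cutting it to the expected length removes bits in front, which again is a deletion. So the tail
  always looks as if exactly \<open>\<delta>\<close> bits were lost.\<close>

lemma tail_received:
  "subseq (tail received) (repeat_bits (\<delta> + 1) (parity_string u))"
  "length (tail received) = length (parity_string u) * (\<delta> + 1) - \<delta>"
proof -
  let ?rep = "repeat_bits (\<delta> + 1) (parity_string u)"
  let ?P = "c * (\<delta> + 1) * l"
  define E where "E = {j. j + k \<in> D}"
  define y2 where "y2 = delete_at E ?rep"
  have len: "length (parity_string u) = c * l"
    using length_concat_bits [OF set_parities] by simp
  have "(\<lambda>j. j + k) ` E \<subseteq> D" by (auto simp: E_def)
  then have "card E \<le> card D"
    using finite_D card_inj_on_le [of "\<lambda>j. j + k" E D] by (auto simp: inj_on_def)
  moreover have "E \<subseteq> {..<length ?rep}"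
    using D len by (auto simp: E_def algebra_simps)
  then have "length y2 = ?P - card E"
    using len by (simp add: y2_def length_delete_at algebra_simps)
  ultimately have y2: "?P - \<delta> \<le> length y2"
    using D by linarith
  then have t: "tail received = drop (length y2 - (?P - \<delta>)) y2"
    unfolding received_eq E_def [symmetric] y2_def [symmetric] by simp
  have "subseq (tail received) y2"
    unfolding t by (intro suffix_imp_subseq suffix_drop)
  then show "subseq (tail received) ?rep"
    using subseq_delete_at unfolding y2_def by (rule subseq_order.order_trans)
  show "length (tail received) = length (parity_string u) * (\<delta> + 1) - \<delta>"
    using y2 len unfolding t by (simp add: algebra_simps)
qed

lemma recovered_parities_received: "recovered_parities R B k \<delta> c received = parities u"
proof -
  have len: "length (parity_string u) = c * l"
    using length_concat_bits [OF set_parities] by simp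
  have "(THE b. length b = c * l \<and> subseq (tail received) (repeat_bits (\<delta> + 1) b)) = parity_string u"
    using the_subseq_repeat_bits [OF tail_received] len by simp
  then have "recovered_parities R B k \<delta> c received =
      map (\<lambda>r. sym (block l (parity_string u) r)) [0..<c]"
    by (simp add: recovered_parities_def Let_def)
  also have "\<dots> = parities u"
    using set_parities [of u]
    by (intro nth_equalityI) (auto simp: block_concat_bits symbol_bits nth_closed)
  finally show ?thesis .
qed

lemma sample_op_received: "result (sample_op \<delta> (c * l) (tail received)) = parity_string u"
proof -
  have len: "length (parity_string u) = c * l"
    using length_concat_bits [OF set_parities] by simp
  have "result (sample_op \<delta> (c * l) (tail received)) =
      map (\<lambda>i. tail received ! (i * (\<delta> + 1))) [0..<c * l]"
    using tail_received(2) len by (intro result_sample_op) simp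
  also have "\<dots> = parity_string u"
    using subseq_repeat_bits [OF tail_received] len by (intro nth_equalityI) auto
  finally show ?thesis .
qed

lemma take_received: "take (k - \<delta>) received = take (k - \<delta>) (delete_at D u)"
  using length_delete_u by (simp add: received_eq)

definition cases_found :: "'a list set" where
  "cases_found = {Y. \<exists>d\<in>deletion_cases m \<delta>.
    possible_case R B G k \<delta> c (parities u) (received_systematic k \<delta> received) d Y}"

lemma gc_decode_received:
  "gc_decode R B G k \<delta> c received =
    (if \<exists>Y. cases_found = {Y} then Some (take k (concat (map bts (the_elem cases_found)))) else None)"
  by (simp add: gc_decode_def recovered_parities_received cases_found_def Let_def)

lemma length_received_systematic: "length (received_systematic k \<delta> received) = m * l - \<delta>"
  using length_delete_u m_bounds \<delta>_le_k
  by (simp add: received_systematic_def take_received)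

text \<open>\<open>map bts\<close> is injective on the candidates, so passing from field symbols to
  blocks of bits preserves whether there is exactly one decoded string.\<close>

lemma gc_decode_op_received:
  "result (gc_decode_op T k \<delta> c received) = gc_decode R B G k \<delta> c received"
proof -
  define Zs where "Zs = result (check_all_op T l \<delta> (map bts (parities u))
    (received_systematic k \<delta> received) (result (cases_op m \<delta>)))"
  have ps: "map (block l (parity_string u)) [0..<c] = map bts (parities u)"
    using set_parities [of u] by (intro nth_equalityI) (auto simp: block_concat_bits)
  have res: "result (gc_decode_op T k \<delta> c received) = result (output_op k Zs)"
    using sample_op_received ps
    by (simp add: gc_decode_op_def Zs_def received_systematic_def padding_def)
  have Zs: "set Zs = map bts ` cases_found"
  proof (rule Set.set_eqI)
    fix Z
    have "Z \<in> set Zs \<longleftrightarrow> (\<exists>d\<in>deletion_cases m \<delta>. \<exists>Y. possible_case R B G k \<delta> c (parities u)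
        (received_systematic k \<delta> received) d Y \<and> Z = map bts Y)"
      unfolding Zs_def set_check_all_op set_cases_op
      using check_op_correct [OF length_parities set_parities length_received_systematic]
      by auto
    then show "Z \<in> set Zs \<longleftrightarrow> Z \<in> map bts ` cases_found"
      by (auto simp: cases_found_def)
  qed
  have inj: "inj_on (map bts) cases_found"
  proof (rule inj_onI)
    fix Y Y' assume *: "Y \<in> cases_found" "Y' \<in> cases_found" "map bts Y = map bts Y'"
    have "set Y \<subseteq> carrier R" "set Y' \<subseteq> carrier R"
      using * by (auto simp: cases_found_def possible_case_def erasure_decoded_def)
    moreover have "inj_on bts (carrier R)"
      by (auto intro: inj_onI simp: bits_eq_iff)
    ultimately show "Y = Y'"
      using *(3) by (metis inj_on_map_eq_map le_sup_iff inj_on_subset)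
  qed
  have iff': "(\<exists>Z. set Zs = {Z}) \<longleftrightarrow> (\<exists>Y. cases_found = {Y})"
    unfolding Zs by (metis (no_types, lifting) card_1_singleton_iff card_image inj One_nat_def)
  show ?thesis
  proof (cases "\<exists>Y. cases_found = {Y}")
    case True
    then obtain Y where "cases_found = {Y}" by blast
    then show ?thesis using res Zs by (simp add: result_output_op gc_decode_received)
  next
    case False
    then show ?thesis using res iff' by (simp add: result_output_op gc_decode_received)
  qed
qed

end

end

section \<open>The correct guess\<close>

lemma card_Int_lessThan_split:
  "i \<le> j \<Longrightarrow> card (E \<inter> {..<j}) = card (E \<inter> {..<i}) + card (E \<inter> {i..<j})" for i j :: nat
  by (subst card_Un_disjoint [symmetric]) (auto intro!: arg_cong [where f = card])

lemma card_Int_lessThan_le: "card (E \<inter> {..<i}) \<le> i" for i :: nat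
  using card_mono [of "{..<i}" "E \<inter> {..<i}"] by simp

definition hits :: "nat set \<Rightarrow> nat \<Rightarrow> nat \<Rightarrow> nat" where
  "hits E l j = card (E \<inter> {j * l..<(j + 1) * l})"

lemma sum_hits: "(\<Sum>i<j. hits E l i) = card (E \<inter> {..<j * l})"
proof (induction j)
  case (Suc j)
  have "card (E \<inter> {..<Suc j * l}) = card (E \<inter> {..<j * l}) + hits E l j"
    using card_Int_lessThan_split [of "j * l" "Suc j * l" E] by (simp add: hits_def)
  then show ?case using Suc by simp
qed simp

lemma hits_le: "hits E l j \<le> l"
  using card_mono [of "{j * l..<(j + 1) * l}" "E \<inter> {j * l..<(j + 1) * l}"] by (simp add: hits_def)

text \<open>The guess that counts the deletions of \<open>E\<close> per block cuts the received
  string at the true block boundaries: \<open>j * l - card (E \<inter> {..<j * l})\<close> bits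
  survive before block \<open>j\<close>.\<close>

lemma subblock_hits:
  assumes "j < m" "length w = m * l"
  shows "subblock l (map (hits E l) [0..<m]) (delete_at E w) j = delete_at {i. i + j * l \<in> E} (block l w j)"
proof -
  have jl: "j * l + l \<le> m * l"
    using mult_le_mono1 [of "Suc j" m l] assms(1) by simp
  have w: "w = take (j * l) w @ block l w j @ drop (j * l + l) w"
    unfolding block_def by (metis append_take_drop_id drop_drop add.commute)
  have len: "length (block l w j) = l"
    using assms by (rule length_block [rotated])
  have p: "length (delete_at E (take (j * l) w)) = j * l - card (E \<inter> {..<j * l})"
    using assms jl by (subst delete_at_cong [of E _ "E \<inter> {..<j * l}"]) (auto simp: length_delete_at)
  have "{i. i + j * l \<in> E} \<inter> {..<l} = (\<lambda>i. i - j * l) ` (E \<inter> {j * l..<(j + 1) * l})"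
    by (force simp: image_iff)
  then have "card ({i. i + j * l \<in> E} \<inter> {..<l}) = hits E l j"
    unfolding hits_def by (auto intro!: card_image inj_onI)
  then have q: "length (delete_at {i. i + j * l \<in> E} (block l w j)) = l - hits E l j"
    using len by (subst delete_at_cong [of _ _ "{i. i + j * l \<in> E} \<inter> {..<l}"]) (auto simp: length_delete_at)
  have "(\<Sum>i<j. l - map (hits E l) [0..<m] ! i) = (\<Sum>i<j. l - hits E l i)"
    using assms(1) by (intro sum.cong) auto
  also have "\<dots> = j * l - card (E \<inter> {..<j * l})"
    by (subst sum_subtractf_nat) (auto simp: hits_le sum_hits)
  finally have r: "(\<Sum>i<j. l - map (hits E l) [0..<m] ! i) = length (delete_at E (take (j * l) w))"
    using p by simp
  have "delete_at E w = delete_at E (take (j * l) w) @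
      delete_at {i. i + j * l \<in> E} (block l w j) @
      delete_at {i. i + length (block l w j) + j * l \<in> E} (drop (j * l + l) w)"
  proof -
    have "delete_at E w = delete_at E (take (j * l) w @ block l w j @ drop (j * l + l) w)"
      using w by (rule arg_cong)
    moreover have "length (take (j * l) w) = j * l" using assms jl by simp
    ultimately show ?thesis by (simp add: delete_at_append add.assoc)
  qed
  then show ?thesis
    using r q assms(1) by (simp add: subblock_def)
qed

text \<open>An undeleted position \<open>p\<close> is moved to position \<open>p - card (E \<inter> {..<p})\<close>.\<close>

lemma rank_strict_mono:
  fixes p q :: nat
  assumes "p \<notin> E" "p < q"
  shows "p - card (E \<inter> {..<p}) < q - card (E \<inter> {..<q})"
proof -
  have "card (E \<inter> {p..<q}) \<le> card {p<..<q}"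
    using assms by (intro card_mono) (auto simp: less_le)
  then show ?thesis
    using card_Int_lessThan_split [of p q E] card_Int_lessThan_le [of E p] assms by simp
qed

text \<open>Counting: the rank is injective on the undeleted positions, and there are as many of
  these as received positions.\<close>

lemma rank_surj:
  fixes t M :: nat
  assumes "E \<subseteq> {..<M}" "t < M - card E"
  shows "\<exists>p<M. p \<notin> E \<and> p - card (E \<inter> {..<p}) = t"
proof -
  let ?f = "\<lambda>p. p - card (E \<inter> {..<p})"
  have fin: "finite E" using assms(1) finite_subset by blast
  have inj: "inj_on ?f ({..<M} - E)"
  proof (rule inj_onI)
    fix p q assume "p \<in> {..<M} - E" "q \<in> {..<M} - E" "?f p = ?f q"
    then show "p = q"
      using rank_strict_mono [of p E q] rank_strict_mono [of q E p] by (cases p q rule: linorder_cases) auto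
  qed
  have sub: "?f ` ({..<M} - E) \<subseteq> {..<M - card E}"
  proof -
    have "E \<inter> {..<M} = E" using assms(1) by auto
    then show ?thesis using rank_strict_mono [of _ E M] by auto
  qed
  have "card (?f ` ({..<M} - E)) = M - card E"
    using inj assms(1) fin by (simp add: card_image card_Diff_subset)
  then have "?f ` ({..<M} - E) = {..<M - card E}"
    using sub by (intro card_subset_eq) auto
  then have "t \<in> ?f ` ({..<M} - E)"
    using assms(2) by simp
  then show ?thesis by auto
qed

context gc
begin

definition case_of :: "nat set \<Rightarrow> nat list" where
  "case_of E = map (hits E l) [0..<m]"

lemma case_of_deletion_cases:
  assumes "E \<subseteq> {..<k}" "card E = \<delta>"
  shows "case_of E \<in> deletion_cases m \<delta>"
proof -
  have "E \<inter> {..<m * l} = E" using assms m_bounds by auto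
  then have "sum_list (case_of E) = \<delta>"
    using assms sum_hits [of E l m]
    by (simp add: case_of_def sum_list_eq_sum [of _ m])
  then show ?thesis by (simp add: deletion_cases_def case_of_def)
qed

lemma possible_case_of:
  assumes u: "length u = k"
  shows "possible_case R B G k \<delta> c (parities u) (delete_at E (padded u)) (case_of E) (syms u)"
proof -
  have sub: "subblock l (case_of E) (delete_at E (padded u)) j =
      delete_at {i. i + j * l \<in> E} (block l (padded u) j)" if "j < m" for j
    using that u unfolding case_of_def by (intro subblock_hits) auto
  have len: "length (block l (padded u) j) = l" if "j < m" for j
    using length_block [OF length_padded [OF u] that] .
  have zero: "delete_at {i. i + j * l \<in> E} (block l (padded u) j) = block l (padded u) j"
    if "j < m" "case_of E ! j = 0" for j
  proof (rule delete_at_empty)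
    have "E \<inter> {j * l..<(j + 1) * l} = {}"
      using that by (simp add: case_of_def hits_def)
    then show "{i. i + j * l \<in> E} \<inter> {..<length (block l (padded u) j)} = {}"
      using len [OF that(1)] by auto
  qed
  show ?thesis
    unfolding possible_case_def erasure_decoded_def
    using sub zero len c_gt set_syms subseq_delete_at
    by (auto simp: nth_parities nth_syms bits_symbol hits_le case_of_def)
qed

text \<open>\<open>E\<close> depends on \<open>D\<close> alone and not on \<open>u\<close>, so
  messages can be counted for a fixed \<open>E\<close>.\<close>

lemma received_systematic_exists:
  assumes D: "D \<subseteq> {..<k + c * (\<delta> + 1) * l}" "card D \<le> \<delta>"
  shows "\<exists>E. E \<subseteq> {..<k} \<and> card E = \<delta> \<and>
    (\<forall>u. length u = k \<longrightarrow> received_systematic k \<delta> (received u D) = delete_at E (padded u))"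
proof -
  obtain E where E: "E \<subseteq> {..<k}" "card E = \<delta>"
    "\<forall>u::bool list. length u = k \<longrightarrow> take (k - \<delta>) (delete_at D u) = delete_at E u"
    using take_delete_at_exists [OF D \<delta>_le_k] by auto
  have "received_systematic k \<delta> (received u D) = delete_at E (padded u)" if u: "length u = k" for u
  proof -
    have "delete_at {j. j + k \<in> E} (padding k) = padding k"
      using E(1) by (intro delete_at_empty) auto
    moreover have "take (k - \<delta>) (received u D) = take (k - \<delta>) (delete_at D u)"
      by (rule take_received [OF u D])
    ultimately show ?thesis
      using E(3) u unfolding received_systematic_def padded_def delete_at_append by simp
  qed
  with E show ?thesis by blast
qed

lemma syms_cases_found:
  assumes "length u = k" "D \<subseteq> {..<k + c * (\<delta> + 1) * l}" "card D \<le> \<delta>"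
  shows "syms u \<in> cases_found u D"
proof -
  obtain E where E: "E \<subseteq> {..<k}" "card E = \<delta>"
    "received_systematic k \<delta> (received u D) = delete_at E (padded u)"
    using received_systematic_exists [OF assms(2,3)] assms(1) by blast
  have "possible_case R B G k \<delta> c (parities u) (received_systematic k \<delta> (received u D))
      (case_of E) (syms u)"
    unfolding E(3) by (rule possible_case_of [OF assms(1)])
  then show ?thesis
    unfolding cases_found_def [OF assms] using case_of_deletion_cases [OF E(1,2)] by blast
qed

lemma gc_decode_correct:
  assumes "length u = k" "D \<subseteq> {..<k + c * (\<delta> + 1) * l}" "card D \<le> \<delta>"
    and "gc_decode R B G k \<delta> c (received u D) \<noteq> None"
  shows "gc_decode R B G k \<delta> c (received u D) = Some u"
proof -
  have dec: "gc_decode R B G k \<delta> c (received u D) =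
    (if \<exists>Y. cases_found u D = {Y}
     then Some (take k (concat (map bts (the_elem (cases_found u D))))) else None)"
    using assms by (intro gc_decode_received)
  then obtain Y where Y: "cases_found u D = {Y}"
    using assms(4) by (auto split: if_splits)
  then have "Y = syms u" using syms_cases_found [OF assms(1-3)] by auto
  then show ?thesis
    using dec Y assms(1) by (simp add: concat_bits_syms padded_def)
qed

lemma gc_decode_failure:
  assumes "length u = k" "D \<subseteq> {..<k + c * (\<delta> + 1) * l}" "card D \<le> \<delta>"
    and "gc_decode R B G k \<delta> c (received u D) = None"
  shows "\<exists>Y\<in>cases_found u D. Y \<noteq> syms u"
proof -
  have dec: "gc_decode R B G k \<delta> c (received u D) =
    (if \<exists>Y. cases_found u D = {Y}
     then Some (take k (concat (map bts (the_elem (cases_found u D))))) else None)"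
    using assms by (intro gc_decode_received)
  have "cases_found u D \<noteq> {syms u}"
  proof
    assume "cases_found u D = {syms u}"
    then have "gc_decode R B G k \<delta> c (received u D) \<noteq> None" using dec by simp
    then show False using assms(4) by simp
  qed
  then show ?thesis using syms_cases_found [OF assms(1-3)] by blast
qed

end

section \<open>Wrong guesses\<close>

text \<open>An injective self-map of a finite set is onto, and the preimage of the minimum is the
  minimum: a larger preimage would force the minimum to be mapped below itself.\<close>

lemma strict_mono_on_finite_fixpoint:
  fixes f :: "nat \<Rightarrow> nat"
  assumes "finite S" "S \<noteq> {}" "f ` S \<subseteq> S" "\<And>i j. i \<in> S \<Longrightarrow> j \<in> S \<Longrightarrow> i < j \<Longrightarrow> f i < f j"
  shows "\<exists>i\<in>S. f i = i"
proof -
  let ?i = "Min S"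
  have i: "?i \<in> S" "\<And>j. j \<in> S \<Longrightarrow> ?i \<le> j" using assms(1,2) by auto
  have "inj_on f S"
    using assms(4) by (intro inj_onI) (metis less_irrefl linorder_neqE_nat)
  then have "f ` S = S"
    using assms(1,3) endo_inj_surj by blast
  then obtain j where j: "j \<in> S" "f j = ?i" using i(1) by (metis imageE)
  have "\<not> ?i < j"
    using assms(3,4) i j by (metis image_subset_iff not_less)
  then have "j = ?i" using i(2) [OF j(1)] by simp
  then show ?thesis using j by blast
qed

lemma card_block_le:
  fixes E :: "nat set"
  assumes "finite E"
  shows "card {j. E \<inter> {j * l..<(j + 1) * l} \<noteq> {}} \<le> card E" "finite {j. E \<inter> {j * l..<(j + 1) * l} \<noteq> {}}"
proof -
  have sub: "{j. E \<inter> {j * l..<(j + 1) * l} \<noteq> {}} \<subseteq> (\<lambda>i. i div l) ` E"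
  proof
    fix j assume "j \<in> {j. E \<inter> {j * l..<(j + 1) * l} \<noteq> {}}"
    then obtain i where i: "i \<in> E" "j * l \<le> i" "i < (j + 1) * l" by auto
    then have "i div l = j"
      by (intro div_nat_eqI) (auto simp: mult.commute)
    with i(1) show "j \<in> (\<lambda>i. i div l) ` E" by blast
  qed
  then show "card {j. E \<inter> {j * l..<(j + 1) * l} \<noteq> {}} \<le> card E"
    using assms by (meson card_image_le card_mono finite_imageI le_trans)
  show "finite {j. E \<inter> {j * l..<(j + 1) * l} \<noteq> {}}"
    using sub assms finite_subset by blast
qed

context gc
begin

lemma parity_add:
  assumes "length U = m" "length Y = m" "set U \<subseteq> carrier R" "set Y \<subseteq> carrier R" "r < c"
  shows "parity R (G r) (map2 (\<oplus>) U Y) = parity R (G r) U \<oplus> parity R (G r) Y"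
proof -
  have "parity R (G r) (map2 (\<oplus>) U Y) =
      (\<Oplus>j\<in>{..<m}. (G r j \<otimes> U ! j) \<oplus> (G r j \<otimes> Y ! j))"
    unfolding parity_def using assms
    by (intro finsum_cong') (auto simp: nth_closed G_carrier r_distr)
  also have "\<dots> = parity R (G r) U \<oplus> parity R (G r) Y"
    unfolding parity_def using assms
    by (subst finsum_addf) (auto simp: nth_closed G_carrier)
  finally show ?thesis .
qed

end

text \<open>A guess \<open>d\<close> is compared with the actual deletions \<open>E\<close> of message bits.\<close>

locale guess = gc +
  fixes E :: "nat set" and d :: "nat list"
  assumes E: "E \<subseteq> {..<k}" "card E = \<delta>"
    and d: "d \<in> deletion_cases m \<delta>" "\<forall>a\<in>set d. a \<le> l"
begin

section \<open>Guessed deletions \<open>pre\<close>, actual deletions \<open>hit\<close>, and the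
  resulting alignment\<close>

definition pre :: "nat \<Rightarrow> nat" where
  "pre j = (\<Sum>i<j. d ! i)"

definition hit :: "nat \<Rightarrow> nat" where
  "hit i = card (E \<inter> {..<i})"

lemma len_d: "length d = m" and sum_d: "sum_list d = \<delta>"
  using d by (auto simp: deletion_cases_def)

lemma d_le: "j < m \<Longrightarrow> d ! j \<le> l"
  using d len_d by auto

lemma fin_E: "finite E"
  using E finite_subset by blast

lemma pre_mono: "i \<le> j \<Longrightarrow> pre i \<le> pre j"
  unfolding pre_def by (intro sum_mono2) auto

lemma pre_Suc: "pre (Suc j) = pre j + d ! j"
  by (simp add: pre_def)

lemma pre_m: "pre m = \<delta>"
  using sum_d len_d by (simp add: pre_def sum_list_eq_sum)

text \<open>The guess removes at most \<open>l\<close> bits from each block; this keeps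
  \<open>target\<close> increasing and inside the received string.\<close>

lemma pre_diff: "i \<le> j \<Longrightarrow> j \<le> m \<Longrightarrow> pre j \<le> pre i + (j - i) * l"
proof (induction j)
  case (Suc j)
  show ?case
  proof (cases "i = Suc j")
    case False
    then have "pre j \<le> pre i + (j - i) * l" "d ! j \<le> l"
      using Suc d_le by auto
    then show ?thesis using False Suc.prems by (simp add: pre_Suc Suc_diff_le)
  qed simp
qed simp

lemma pre_le: "j \<le> m \<Longrightarrow> pre j \<le> j * l"
  using pre_diff [of 0 j] by (simp add: pre_def)

lemma hit_le: "hit i \<le> i"
  unfolding hit_def by (rule card_Int_lessThan_le)

lemma hit_M: "hit (m * l) = \<delta>"
proof -
  have "E \<inter> {..<m * l} = E" using E m_bounds by auto
  then show ?thesis using E by (simp add: hit_def)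
qed

text \<open>The position of the received string at which the guess looks for bit \<open>i\<close> of
  an unerased block.\<close>

definition target :: "nat \<Rightarrow> nat" where
  "target i = i - pre (i div l)"

definition unerased :: "nat set" where
  "unerased = {i. i < m * l \<and> d ! (i div l) = 0}"

lemma div_less_m: "i < m * l \<Longrightarrow> i div l < m"
  by (simp add: less_mult_imp_div_less)

lemma pre_div_le: "i < m * l \<Longrightarrow> pre (i div l) \<le> i"
  using pre_le [of "i div l"] div_less_m [of i] div_times_less_eq_dividend [of i l]
  by (meson le_trans less_imp_le)

lemma target_strict_mono:
  assumes "i \<in> unerased" "i' \<in> unerased" "i < i'"
  shows "target i < target i'"
proof -
  let ?j = "i div l" and ?j' = "i' div l"
  have lt: "i < m * l" "i' < m * l" "d ! ?j = 0" using assms by (auto simp: unerased_def)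
  have jj: "?j \<le> ?j'" using assms(3) by (simp add: div_le_mono)
  show ?thesis
  proof (cases "?j = ?j'")
    case True
    then show ?thesis using assms(3) pre_div_le [OF lt(1)] by (simp add: target_def)
  next
    case False
    then have j: "Suc ?j \<le> ?j'" using jj by simp
    have "pre ?j' \<le> pre (Suc ?j) + (?j' - Suc ?j) * l"
      using j div_less_m [OF lt(2)] by (intro pre_diff) auto
    then have "pre ?j' \<le> pre ?j + (?j' - Suc ?j) * l"
      using lt by (simp add: pre_Suc)
    moreover have "i < Suc ?j * l"
      using l_pos dividend_less_div_times [of l i] by simp
    moreover have "?j' * l \<le> i'" by simp
    moreover have "Suc ?j * l + (?j' - Suc ?j) * l = ?j' * l"
      using j by (metis add_diff_inverse_nat add_mult_distrib not_less)
    ultimately have "i + pre ?j' < i' + pre ?j" by linarith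
    then show ?thesis
      using pre_div_le [OF lt(1)] pre_div_le [OF lt(2)] by (simp add: target_def)
  qed
qed

lemma target_less:
  assumes "i \<in> unerased"
  shows "target i < m * l - \<delta>"
proof -
  let ?j = "i div l"
  have lt: "i < m * l" "d ! ?j = 0" using assms by (auto simp: unerased_def)
  have j: "Suc ?j \<le> m" using div_less_m [OF lt(1)] by simp
  have "pre m \<le> pre (Suc ?j) + (m - Suc ?j) * l"
    using j by (intro pre_diff) auto
  then have "\<delta> \<le> pre ?j + (m - Suc ?j) * l"
    using lt by (simp add: pre_Suc pre_m)
  moreover have "i < Suc ?j * l"
    using l_pos dividend_less_div_times [of l i] by simp
  moreover have "Suc ?j * l + (m - Suc ?j) * l = m * l"
    using j by (metis add_diff_inverse_nat add_mult_distrib not_less)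
  ultimately show ?thesis
    using pre_div_le [OF lt(1)] by (simp add: target_def)
qed

text \<open>The guess takes the bit of \<open>u\<close> at position \<open>source i\<close> for the bit at position \<open>i\<close>.\<close>

definition source :: "nat \<Rightarrow> nat" where
  "source i = (SOME p. p < m * l \<and> p \<notin> E \<and> p - hit p = target i)"

lemma source:
  assumes "i \<in> unerased"
  shows "source i < m * l" "source i \<notin> E" "source i - hit (source i) = target i"
proof -
  have "E \<subseteq> {..<m * l}" using E m_bounds by auto
  then have "\<exists>p<m * l. p \<notin> E \<and> p - hit p = target i"
    using rank_surj [of E "m * l" "target i"] target_less [OF assms] E by (simp add: hit_def)
  then have "source i < m * l \<and> source i \<notin> E \<and> source i - hit (source i) = target i"
    unfolding source_def by (rule someI_ex [of "\<lambda>p. p < m * l \<and> p \<notin> E \<and> p - hit p = target i"])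
  then show "source i < m * l" "source i \<notin> E" "source i - hit (source i) = target i" by auto
qed

lemma rank_less: "p \<notin> E \<Longrightarrow> p < q \<Longrightarrow> p - hit p < q - hit q"
  unfolding hit_def by (rule rank_strict_mono)

lemma source_strict_mono:
  assumes "i \<in> unerased" "i' \<in> unerased" "i < i'"
  shows "source i < source i'"
proof (rule ccontr)
  assume "\<not> source i < source i'"
  then consider "source i = source i'" | "source i' < source i" by linarith
  then show False
    using target_strict_mono [OF assms] source [OF assms(1)] source [OF assms(2)]
      rank_less [of "source i'" "source i"] by cases auto
qed

text \<open>Ranks of undeleted positions are distinct, so \<open>source i\<close> and
  \<open>i\<close> coincide as soon as \<open>i\<close> survives with rank
  \<open>target i\<close>.\<close>

lemma source_eq_iff:
  assumes "i \<in> unerased"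
  shows "source i = i \<longleftrightarrow> i \<notin> E \<and> hit i = pre (i div l)"
proof -
  have lt: "i < m * l" using assms by (simp add: unerased_def)
  have rank_iff: "i - hit i = target i \<longleftrightarrow> hit i = pre (i div l)"
    using hit_le [of i] pre_div_le [OF lt] by (auto simp: target_def)
  show ?thesis
  proof
    assume "source i = i"
    then show "i \<notin> E \<and> hit i = pre (i div l)"
      using source [OF assms] rank_iff by simp
  next
    assume *: "i \<notin> E \<and> hit i = pre (i div l)"
    then have "source i - hit (source i) = i - hit i"
      using source [OF assms] rank_iff by simp
    then show "source i = i"
      using * source(2) [OF assms] rank_less [of i "source i"] rank_less [of "source i" i]
      by (cases i "source i" rule: linorder_cases) auto
  qed
qed

definition moved :: "nat set" where
  "moved = {i \<in> unerased. source i \<noteq> i}"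

text \<open>The padding lies in the last block. If that block is unerased, all guessed deletions
  precede it, and all actual ones precede the padding; both counts are then \<open>\<delta>\<close>
  and the padding is aligned. Hence moved positions carry message bits.\<close>

lemma moved_less: "i \<in> moved \<Longrightarrow> i < k"
proof (rule ccontr)
  assume i: "i \<in> moved" "\<not> i < k"
  then have lt: "i < m * l" "d ! (i div l) = 0" "i \<in> unerased"
    by (auto simp: moved_def unerased_def)
  have "E \<inter> {..<i} = E" using i E by auto
  then have "hit i = \<delta>" using E by (simp add: hit_def)
  moreover have "pre (i div l) = \<delta>"
  proof -
    have "m * l < (i div l + 2) * l"
    proof -
      have "i < Suc (i div l) * l"
        using l_pos dividend_less_div_times [of l i] by simp
      then show ?thesis using i m_bounds by simp
    qed
    then have "m \<le> Suc (i div l)" unfolding mult_less_cancel2 by simp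
    then have "m = Suc (i div l)" using div_less_m [OF lt(1)] by simp
    then show ?thesis using pre_m pre_Suc [of "i div l"] lt(2) by simp
  qed
  moreover have "i \<notin> E" using i E by auto
  ultimately have "source i = i" using source_eq_iff [OF lt(3)] by simp
  then show False using i by (simp add: moved_def)
qed

text \<open>Applied with \<open>S\<close> the set of positions at which two messages differ that
  share all unmoved bits and all sums over moved positions.\<close>

lemma moved_chain:
  assumes "S \<subseteq> moved" "source ` S \<subseteq> S"
  shows "S = {}"
proof (rule ccontr)
  assume "S \<noteq> {}"
  moreover have "finite S"
    using assms(1) moved_less finite_subset [of S "{..<k}"] by auto
  moreover have "source i < source j" if "i \<in> S" "j \<in> S" "i < j" for i j
    using that assms(1) by (intro source_strict_mono) (auto simp: moved_def)
  ultimately obtain i where "i \<in> S" "source i = i"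
    using strict_mono_on_finite_fixpoint [of S source] assms(2) by blast
  then show False using assms(1) by (auto simp: moved_def)
qed

section \<open>Messages confused by a guess, and the difference of the two codewords\<close>

definition confused :: "bool list \<Rightarrow> 'a list \<Rightarrow> bool" where
  "confused u Y \<longleftrightarrow> length u = k \<and> Y \<noteq> syms u \<and>
    possible_case R B G k \<delta> c (parities u) (delete_at E (padded u)) d Y"

definition difference :: "bool list \<Rightarrow> 'a list \<Rightarrow> 'a list" where
  "difference u Y = map2 (\<oplus>) (syms u) Y"

lemma nth_source:
  assumes "length w = m * l" "i \<in> unerased"
  shows "delete_at E w ! target i = w ! source i"
  using nth_delete_at [of "source i" w E] source [OF assms(2)] assms(1) by (simp add: hit_def)

context
  fixes u Y
  assumes cf: "confused u Y"
begin

lemma confusedD: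
  "length u = k" "Y \<noteq> syms u" "length Y = m" "set Y \<subseteq> carrier R"
  "r < c \<Longrightarrow> parity R (G r) Y = parity R (G r) (syms u)"
  "j < m \<Longrightarrow> d ! j = 0 \<Longrightarrow> Y ! j = sym (subblock l d (delete_at E (padded u)) j)"
  using cf c_gt nth_parities [of r u]
  by (cases "r < \<delta>"; auto simp: confused_def possible_case_def erasure_decoded_def nth_parities)+

lemma length_difference: "length (difference u Y) = m"
  by (simp add: difference_def confusedD)

lemma set_difference: "set (difference u Y) \<subseteq> carrier R"
  using confusedD(3,4) set_syms
  by (auto simp: difference_def set_zip nth_closed)

lemma parity_difference: "r < c \<Longrightarrow> parity R (G r) (difference u Y) = \<zero>"
  unfolding difference_def using confusedD set_syms
  by (subst parity_add) (auto simp: add_self)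

text \<open>Sub-block \<open>j\<close> starts at \<open>j * l - pre j\<close>, so its bit
  \<open>i mod l\<close> is the received bit at \<open>target i\<close>; undoing the deletions leads
  to \<open>source i\<close>.\<close>

lemma nth_bits_unerased:
  assumes "i \<in> unerased"
  shows "bts (Y ! (i div l)) ! (i mod l) = padded u ! source i"
proof -
  let ?j = "i div l" and ?s = "delete_at E (padded u)"
  have lt: "i < m * l" "d ! ?j = 0" using assms by (auto simp: unerased_def)
  have j: "?j < m" using div_less_m [OF lt(1)] .
  have t: "i mod l < l" using l_pos by simp
  have len_s: "length ?s = m * l - \<delta>"
    using E m_bounds confusedD(1) by (subst length_delete_at) auto
  have len: "length (subblock l d ?s ?j) = l"
    using length_subblock [OF len_d sum_d d(2) len_s j] lt(2) by simp
  have "(\<Sum>i<?j. l - d ! i) = (\<Sum>i<?j. l) - pre ?j"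
    unfolding pre_def using j d_le by (intro sum_subtractf_nat) auto
  then have start: "(\<Sum>i<?j. l - d ! i) = ?j * l - pre ?j" by simp
  have "?j * l - pre ?j + i mod l = target i"
  proof -
    have "?j * l + i mod l = i" by simp
    then show ?thesis using pre_le [of ?j] j by (simp add: target_def)
  qed
  moreover have "target i < length ?s"
    using target_less [OF assms] len_s by simp
  ultimately have "subblock l d ?s ?j ! (i mod l) = ?s ! target i"
    unfolding subblock_def start using lt(2) t by simp
  then show ?thesis
    using len confusedD(6) [OF j lt(2)] nth_source [OF length_padded [OF confusedD(1)] assms]
    by (simp add: bits_symbol)
qed

lemma nth_bits_difference:
  assumes "i \<in> unerased"
  shows "bts (difference u Y ! (i div l)) ! (i mod l) \<longleftrightarrow> padded u ! i \<noteq> padded u ! source i"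
proof -
  let ?j = "i div l"
  have lt: "i < m * l" using assms by (auto simp: unerased_def)
  have j: "?j < m" using div_less_m [OF lt] .
  have t: "i mod l < l" using l_pos by simp
  have blk: "length (block l (padded u) ?j) = l"
    by (rule length_block [OF length_padded [OF confusedD(1)] j])
  have "?j * l \<le> length (padded u)"
    unfolding length_padded [OF confusedD(1)] using j by simp
  then have blk_nth: "block l (padded u) ?j ! (i mod l) = padded u ! i"
    using t by (simp add: block_def)
  have "bts (difference u Y ! ?j) =
      xor_list (block l (padded u) ?j) (bts (Y ! ?j))"
    using j blk confusedD(3,4) set_syms
    by (simp add: difference_def nth_closed bits_add) (simp add: nth_syms bits_symbol)
  then show ?thesis
    using nth_bits_unerased [OF assms] blk blk_nth t j confusedD(3,4)
    by (simp add: xor_list_def nth_closed)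
qed

end

definition erased :: "nat set" where
  "erased = {j. j < m \<and> d ! j \<noteq> 0}"

definition free :: "nat set" where
  "free = {j. j < m \<and> (\<forall>i\<in>unerased. i div l = j \<longrightarrow> i \<in> moved)}"

text \<open>The blocks in which \<open>Y\<close> may differ from the message; elsewhere every bit is
  read from its true position.\<close>

definition varying :: "nat set" where
  "varying = {j. j < m \<and> (j \<in> erased \<or> (\<exists>i\<in>moved. i div l = j))}"

lemma erased_free: "erased \<subseteq> free"
  by (auto simp: erased_def free_def unerased_def)

lemma finite_blocks [simp]: "finite erased" "finite free" "finite varying"
  by (auto simp: erased_def free_def varying_def)

lemma card_erased: "card erased \<le> \<delta>"
proof -
  have "card erased = erasures d"
    using len_d by (simp add: erased_def erasures_def length_filter_conv_card)
  then show ?thesis using erasures_le_sum_list [of d] sum_d by simp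
qed

lemma block_index: "j < m \<Longrightarrow> t < l \<Longrightarrow> j * l + t < m * l"
proof -
  assume "j < m" "t < l"
  then have "j * l + t < Suc j * l" by simp
  also have "\<dots> \<le> m * l" using \<open>j < m\<close> by (intro mult_le_mono) auto
  finally show ?thesis .
qed

lemma unerased_block: "j < m \<Longrightarrow> j \<notin> erased \<Longrightarrow> t < l \<Longrightarrow> j * l + t \<in> unerased"
  using block_index [of j t] by (simp add: unerased_def erased_def)

lemma div_mod_block: "t < l \<Longrightarrow> (j * l + t) div l = j" "t < l \<Longrightarrow> (j * l + t) mod l = t"
  by simp_all

lemma hit_block:
  assumes "E \<inter> {j * l..<(j + 1) * l} = {}" "j * l \<le> i" "i \<le> (j + 1) * l"
  shows "hit i = hit (j * l)"
proof -
  have "E \<inter> {j * l..<i} = {}" using assms by auto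
  then show ?thesis
    using card_Int_lessThan_split [OF assms(2), of E] by (simp add: hit_def)
qed

lemma source_eq_iff_block:
  assumes "i \<in> unerased" "E \<inter> {i div l * l..<(i div l + 1) * l} = {}"
  shows "source i = i \<longleftrightarrow> hit (i div l * l) = pre (i div l)"
proof -
  have i: "i div l * l \<le> i" "i < (i div l + 1) * l"
    using l_pos dividend_less_div_times [of l i] by simp_all
  then have "i \<in> {i div l * l..<(i div l + 1) * l}" by simp
  then have "i \<notin> E" using assms(2) by blast
  moreover have "hit i = hit (i div l * l)"
    using assms(2) i by (intro hit_block) auto
  ultimately show ?thesis
    using source_eq_iff [OF assms(1)] by simp
qed

text \<open>Within an unerased block the alignment can change only if a bit of that block is
  deleted.\<close>

lemma varying_free: "varying - free \<subseteq> {j. E \<inter> {j * l..<(j + 1) * l} \<noteq> {}}"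
proof
  fix j assume j: "j \<in> varying - free"
  then obtain i i' where i: "i \<in> unerased" "i div l = j" "source i \<noteq> i"
    and i': "i' \<in> unerased" "i' div l = j" "source i' = i'"
    using erased_free by (auto simp: varying_def free_def moved_def)
  then show "j \<in> {j. E \<inter> {j * l..<(j + 1) * l} \<noteq> {}}"
    using source_eq_iff_block [of i] source_eq_iff_block [of i'] by auto
qed

lemma card_varying: "card varying \<le> card free + \<delta>"
proof -
  have "card varying \<le> card (free \<union> (varying - free))"
    by (intro card_mono) auto
  also have "\<dots> \<le> card free + card (varying - free)"
    by (rule card_Un_le)
  also have "card (varying - free) \<le> card {j. E \<inter> {j * l..<(j + 1) * l} \<noteq> {}}"
    using varying_free card_block_le(2) [OF fin_E] by (intro card_mono)
  also have "\<dots> \<le> \<delta>"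
    using card_block_le(1) [OF fin_E] E by simp
  finally show ?thesis by simp
qed

text \<open>\<open>Y\<close> has the parities of the message and agrees with it outside the varying
  blocks, so with at most \<open>c\<close> of these the code distance would force equality.\<close>

lemma confused_varying:
  assumes cf: "confused u Y"
  shows "card varying > c"
proof (rule ccontr)
  assume le: "\<not> c < card varying"
  note D = confusedD [OF cf]
  have "Y ! j = syms u ! j" if j: "j < m" "j \<notin> varying" for j
  proof -
    have "bts (Y ! j) = block l (padded u) j"
    proof (rule nth_equalityI)
      show "length (bts (Y ! j)) = length (block l (padded u) j)"
        using j D(3,4) length_block [OF length_padded [OF D(1)] j(1)] by (simp add: nth_closed)
      fix t assume "t < length (bts (Y ! j))"
      then have t: "t < l" using j D(3,4) by (simp add: nth_closed)
      have un: "j * l + t \<in> unerased"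
        using j t by (intro unerased_block) (auto simp: varying_def)
      have "j * l + t \<notin> moved" using j t by (auto simp: varying_def)
      then have "source (j * l + t) = j * l + t" using un by (simp add: moved_def)
      then have "bts (Y ! j) ! t = padded u ! (j * l + t)"
        using nth_bits_unerased [OF cf un] t by simp
      also have "\<dots> = block l (padded u) j ! t"
        using t j D(1) by (simp add: block_def)
      finally show "bts (Y ! j) ! t = block l (padded u) j ! t" .
    qed
    then show ?thesis
      using j D(3,4) by (metis nth_closed nth_syms symbol_bits)
  qed
  then have "{j. j < m \<and> Y ! j \<noteq> syms u ! j} \<subseteq> varying" by blast
  then have "card {j. j < m \<and> Y ! j \<noteq> syms u ! j} \<le> card varying"
    by (intro card_mono) auto
  moreover have none: "{r. r < c \<and> parity R (G r) Y \<noteq> parity R (G r) (syms u)} = {}"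
    using D(5) by auto
  have "card {r. r < c \<and> parity R (G r) Y \<noteq> parity R (G r) (syms u)} = 0"
    unfolding none by simp
  ultimately have "card {j. j < m \<and> Y ! j \<noteq> syms u ! j} +
      card {r. r < c \<and> parity R (G r) Y \<noteq> parity R (G r) (syms u)} \<le> c"
    using le by linarith
  then have "Y = syms u"
    using D(3,4) set_syms by (intro message_eqI) auto
  then show False using D(2) by simp
qed

text \<open>Both differences have zero parities, so they coincide once they agree outside at most
  \<open>c\<close> blocks. At an unmoved position both have bit 0; erased blocks, about which
  nothing is known, are put into \<open>C\<close>.\<close>

lemma difference_eqI:
  assumes cf: "confused u Y" and cf': "confused u' Y'"
    and C: "C \<subseteq> {..<m}" "card C \<le> c" "erased \<subseteq> C"
    and agree: "\<And>i. i \<in> moved \<Longrightarrow> i div l \<notin> C \<Longrightarrow>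
      (padded u ! i \<noteq> padded u ! source i) = (padded u' ! i \<noteq> padded u' ! source i)"
  shows "difference u Y = difference u' Y'"
proof (rule message_eqI)
  show "length (difference u Y) = m" "length (difference u' Y') = m"
    using length_difference [OF cf] length_difference [OF cf'] .
  show R: "set (difference u Y) \<subseteq> carrier R" "set (difference u' Y') \<subseteq> carrier R"
    using set_difference [OF cf] set_difference [OF cf'] .
  have nth: "difference u Y ! j \<in> carrier R" "difference u' Y' ! j \<in> carrier R" if "j < m" for j
    using that R length_difference [OF cf] length_difference [OF cf'] by (auto intro!: nth_closed)
  have eq: "difference u Y ! j = difference u' Y' ! j" if j: "j < m" "j \<notin> C" for j
  proof -
    have "bts (difference u Y ! j) = bts (difference u' Y' ! j)"
    proof (rule nth_equalityI)
      show "length (bts (difference u Y ! j)) = length (bts (difference u' Y' ! j))"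
        using nth [OF j(1)] by simp
      fix t assume "t < length (bts (difference u Y ! j))"
      then have t: "t < l" using nth [OF j(1)] by simp
      have un: "j * l + t \<in> unerased"
        using j t C by (intro unerased_block) auto
      have "(padded u ! (j * l + t) \<noteq> padded u ! source (j * l + t)) =
          (padded u' ! (j * l + t) \<noteq> padded u' ! source (j * l + t))"
        using agree [of "j * l + t"] un j t by (cases "j * l + t \<in> moved") (auto simp: moved_def)
      then show "bts (difference u Y ! j) ! t = bts (difference u' Y' ! j) ! t"
        using nth_bits_difference [OF cf un] nth_bits_difference [OF cf' un] t by simp
    qed
    then show ?thesis using nth [OF j(1)] by (simp add: bits_eq_iff)
  qed
  have "card {j. j < m \<and> difference u Y ! j \<noteq> difference u' Y' ! j} \<le> card C"
    using eq C(1) finite_subset by (intro card_mono) auto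
  moreover have none:
    "{r. r < c \<and> parity R (G r) (difference u Y) \<noteq> parity R (G r) (difference u' Y')} = {}"
    using parity_difference [OF cf] parity_difference [OF cf'] by auto
  have "card {r. r < c \<and> parity R (G r) (difference u Y) \<noteq> parity R (G r) (difference u' Y')} = 0"
    unfolding none by simp
  ultimately show "card {j. j < m \<and> difference u Y ! j \<noteq> difference u' Y' ! j} +
      card {r. r < c \<and> parity R (G r) (difference u Y) \<noteq> parity R (G r) (difference u' Y')} \<le> c"
    using C(2) by linarith
qed

definition confused_messages :: "bool list set" where
  "confused_messages = {u. \<exists>Y. confused u Y}"

text \<open>
  A confused message is determined by the sums \<open>u ! i + u ! source i\<close> over the moved positions
  outside the blocks of \<open>C\<close>, together with its bits at the positions which are not moved: the first
  data fix the difference of the two codewords off \<open>C\<close>, hence everywhere.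
\<close>

lemma card_confused_messages:
  assumes C: "C \<subseteq> {..<m}" "card C \<le> c" "erased \<subseteq> C"
  shows "card confused_messages * 2 ^ (l * card (C \<inter> free - erased)) \<le> 2 ^ k"
proof -
  \<comment> \<open>The moved positions whose sums are not recorded; the code recovers these sums
    from the remaining ones.\<close>
  define A where "A = {i \<in> moved. i div l \<in> C}"
  define f where "f u = {i \<in> {..<k} - A. if i \<in> moved then padded u ! i \<noteq> padded u ! source i
    else padded u ! i}" for u
  have A: "A \<subseteq> {..<k}" using moved_less by (auto simp: A_def)
  have inj: "inj_on f confused_messages"
  proof (rule inj_onI)
    fix u u' assume "u \<in> confused_messages" "u' \<in> confused_messages" and feq: "f u = f u'"
    then obtain Y Y' where cf: "confused u Y" "confused u' Y'" by (auto simp: confused_messages_def)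
    have len: "length u = k" "length u' = k" using cf confusedD(1) by blast+
    have same: "i \<in> f u \<longleftrightarrow> i \<in> f u'" for i using feq by simp
    have "difference u Y = difference u' Y'"
    proof (rule difference_eqI [OF cf C])
      fix i assume "i \<in> moved" "i div l \<notin> C"
      then show "(padded u ! i \<noteq> padded u ! source i) = (padded u' ! i \<noteq> padded u' ! source i)"
        using same [of i] moved_less [of i] by (auto simp: f_def A_def)
    qed
    then have step: "(padded u ! i \<noteq> padded u ! source i) = (padded u' ! i \<noteq> padded u' ! source i)"
      if "i \<in> moved" for i
      using nth_bits_difference [OF cf(1), of i] nth_bits_difference [OF cf(2), of i] that
      by (simp add: moved_def)
    \<comment> \<open>With equal sums at \<open>i\<close>, a disagreement at \<open>i\<close> forces
      one at \<open>source i\<close>, so \<open>S\<close> is closed under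
      \<open>source\<close>.\<close>
    define S where "S = {i. i < m * l \<and> padded u ! i \<noteq> padded u' ! i}"
    have "S \<subseteq> moved"
    proof
      fix i assume i: "i \<in> S"
      have "i < k"
        using i len by (auto simp: S_def padded_def nth_append split: if_splits)
      show "i \<in> moved"
      proof (rule ccontr)
        assume "i \<notin> moved"
        then have "padded u ! i = padded u' ! i"
          using same [of i] \<open>i < k\<close> by (auto simp: f_def A_def)
        then show False using i by (simp add: S_def)
      qed
    qed
    moreover have "source ` S \<subseteq> S"
    proof
      fix p assume "p \<in> source ` S"
      then obtain i where i: "i \<in> S" "p = source i" by blast
      then have "i \<in> moved" using \<open>S \<subseteq> moved\<close> by blast
      then show "p \<in> S"
        using step i source(1) [of i] by (auto simp: S_def moved_def)
    qed
    ultimately have "S = {}" by (rule moved_chain)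
    then have "padded u = padded u'"
      using len by (intro nth_equalityI) (auto simp: S_def)
    then show "u = u'" using len by (simp add: padded_def)
  qed
  have "card confused_messages = card (f ` confused_messages)"
    using inj by (simp add: card_image)
  also have "\<dots> \<le> card (Pow ({..<k} - A))"
    by (intro card_mono) (auto simp: f_def)
  also have "\<dots> = 2 ^ (k - card A)"
    using A finite_subset [OF A] by (simp add: card_Pow card_Diff_subset)
  finally have "card confused_messages * 2 ^ card A \<le> 2 ^ (k - card A) * 2 ^ card A"
    by simp
  also have "\<dots> = 2 ^ k"
    using card_mono [OF _ A] by (simp flip: power_add)
  finally have main: "card confused_messages * 2 ^ card A \<le> 2 ^ k" .
  have inj_index: "inj_on (\<lambda>(j, t). j * l + t) ((C \<inter> free - erased) \<times> {..<l})"
  proof (rule inj_onI)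
    fix p q assume pq: "p \<in> (C \<inter> free - erased) \<times> {..<l}" "q \<in> (C \<inter> free - erased) \<times> {..<l}"
      and eq: "(\<lambda>(j, t). j * l + t) p = (\<lambda>(j, t). j * l + t) q"
    obtain j t j' t' where p: "p = (j, t)" "q = (j', t')" by fastforce
    then have "j * l + t = j' * l + t'" "t < l" "t' < l" using pq eq by auto
    then have "j = j'" "t = t'" by (metis div_mod_block(1), metis div_mod_block(2))
    then show "p = q" using p by simp
  qed
  \<comment> \<open>Every position of a free unerased block is moved, so each such block of
    \<open>C\<close> contributes \<open>l\<close> elements to \<open>A\<close>.\<close>
  have "l * card (C \<inter> free - erased) = card ((C \<inter> free - erased) \<times> {..<l})"
    by (simp add: card_cartesian_product)
  also have "\<dots> = card ((\<lambda>(j, t). j * l + t) ` ((C \<inter> free - erased) \<times> {..<l}))"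
    by (simp add: card_image [OF inj_index])
  also have "\<dots> \<le> card A"
  proof (rule card_mono)
    show "finite A" using A finite_subset by blast
    show "(\<lambda>(j, t). j * l + t) ` ((C \<inter> free - erased) \<times> {..<l}) \<subseteq> A"
    proof
      fix i assume "i \<in> (\<lambda>(j, t). j * l + t) ` ((C \<inter> free - erased) \<times> {..<l})"
      then obtain j t where i: "i = j * l + t"
        and *: "j \<in> C" "j \<in> free" "j \<notin> erased" "t \<in> {..<l}"
        by auto
      then have "j * l + t \<in> unerased" by (intro unerased_block) (auto simp: free_def)
      then show "i \<in> A" using * by (auto simp: i A_def free_def)
    qed
  qed
  finally have "(2::nat) ^ (l * card (C \<inter> free - erased)) \<le> 2 ^ card A"
    by (intro power_increasing) auto
  then have "card confused_messages * 2 ^ (l * card (C \<inter> free - erased)) \<le>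
      card confused_messages * 2 ^ card A"
    by (rule mult_le_mono2)
  also note main
  finally show ?thesis .
qed

lemma two_power_l: "2 ^ (l * n) = k ^ n"
  using k_eq l_eq by (simp add: power_mult)

lemma card_confused_messages_many_free:
  assumes "card free \<ge> c"
  shows "card confused_messages * k ^ (c - \<delta>) \<le> 2 ^ k"
proof -
  obtain C where C: "erased \<subseteq> C" "C \<subseteq> free" "card C = c"
    using exists_subset_between [OF _ assms erased_free] card_erased c_gt by fastforce
  have "finite C" using C finite_subset by (meson finite_blocks)
  then have "card (C - erased) \<ge> c - \<delta>"
    using C card_erased diff_card_le_card_Diff [of erased C] by simp
  moreover have "C \<inter> free - erased = C - erased" using C by auto
  ultimately have "(2::nat) ^ (l * (c - \<delta>)) \<le> 2 ^ (l * card (C \<inter> free - erased))"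
    by (intro power_increasing mult_le_mono) auto
  then have "card confused_messages * 2 ^ (l * (c - \<delta>)) \<le>
      card confused_messages * 2 ^ (l * card (C \<inter> free - erased))"
    by (rule mult_le_mono2)
  also have "\<dots> \<le> 2 ^ k"
  proof (rule card_confused_messages)
    show "C \<subseteq> {..<m}" using C(2) by (auto simp: free_def)
  qed (use C in simp_all)
  finally show ?thesis by (simp add: two_power_l)
qed

text \<open>Here the whole of \<open>free\<close> serves as \<open>C\<close>. The exponent is a
  natural subtraction: for \<open>c + 1 \<le> 2 * \<delta>\<close> the claim degenerates to the
  trivial bound \<open>2 ^ k\<close>.\<close>

lemma card_confused_messages_few_free:
  assumes "card free < c"
  shows "card confused_messages * k ^ (c + 1 - 2 * \<delta>) \<le> 2 ^ k"
proof (cases "confused_messages = {}")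
  case False
  then have "c < card varying" using confused_varying by (auto simp: confused_messages_def)
  then have "card free \<ge> c + 1 - \<delta>" using card_varying by simp
  then have "card (free - erased) \<ge> c + 1 - 2 * \<delta>"
    using card_erased diff_card_le_card_Diff [of erased free] by simp
  then have "(2::nat) ^ (l * (c + 1 - 2 * \<delta>)) \<le> 2 ^ (l * card (free \<inter> free - erased))"
    by (intro power_increasing mult_le_mono) auto
  then have "card confused_messages * 2 ^ (l * (c + 1 - 2 * \<delta>)) \<le>
      card confused_messages * 2 ^ (l * card (free \<inter> free - erased))"
    by (rule mult_le_mono2)
  also have "\<dots> \<le> 2 ^ k"
  proof (rule card_confused_messages)
    show "free \<subseteq> {..<m}" by (auto simp: free_def)
  qed (use erased_free assms in simp_all)
  finally show ?thesis by (simp add: two_power_l)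
qed simp

text \<open>
  If \<open>j\<close> is erased but not hit, then the guess is misaligned on one side of \<open>j\<close>, and all blocks
  from \<open>j\<close> to the next hit block on this side are free.
\<close>

lemma erased_near_hit:
  assumes j: "j \<in> erased"
  shows "\<exists>j'. E \<inter> {j' * l..<(j' + 1) * l} \<noteq> {} \<and> j \<le> j' + card free \<and> j' \<le> j + card free"
proof (cases "E \<inter> {j * l..<(j + 1) * l} = {}")
  case False
  then show ?thesis by auto
next
  case True
  have jm: "j < m" and dj: "d ! j \<noteq> 0" using j by (auto simp: erased_def)
  let ?hit = "\<lambda>j. E \<inter> {j * l..<(j + 1) * l} \<noteq> {}"
  have hit_range: "hit (a * l) = hit (b * l)"
    if "a \<le> b" "\<And>i. a \<le> i \<Longrightarrow> i < b \<Longrightarrow> \<not> ?hit i" for a b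
    using that
  proof (induction b)
    case (Suc b)
    show ?case
    proof (cases "a = Suc b")
      case False
      then have "hit (a * l) = hit (b * l)" using Suc by auto
      moreover have "hit (Suc b * l) = hit (b * l)"
        using Suc.prems(2) [of b] False Suc.prems(1) by (intro hit_block) auto
      ultimately show ?thesis by simp
    qed simp
  qed simp
  have free: "b \<in> free" if "b < m" "\<not> ?hit b" "hit (b * l) \<noteq> pre b" for b
  proof -
    have "i \<in> moved" if "i \<in> unerased" "i div l = b" for i
      using that source_eq_iff_block [of i] \<open>\<not> ?hit b\<close> \<open>hit (b * l) \<noteq> pre b\<close> by (auto simp: moved_def)
    then show ?thesis using \<open>b < m\<close> by (auto simp: free_def)
  qed
  have jfree: "j \<in> free" using j erased_free by blast
  have hit_Suc: "hit (Suc j * l) = hit (j * l)"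
    using hit_range [of j "Suc j"] True by (metis le_SucI le_refl less_Suc_eq_le antisym)
  show ?thesis
  \<comment> \<open>Block \<open>j\<close> has guessed deletions but no actual one, so either the
    guess is ahead after block \<open>j\<close>, or it was behind before it.\<close>
  proof (cases "pre (Suc j) > hit (Suc j * l)")
    case gt: True
    \<comment> \<open>Both counts end at \<open>\<delta>\<close>; a guess that is ahead must still
      be caught up by actual deletions.\<close>
    have "\<exists>j'>j. j' < m \<and> ?hit j'"
    proof (rule ccontr)
      assume "\<not> ?thesis"
      then have "hit (Suc j * l) = hit (m * l)"
        using jm by (intro hit_range) auto
      then show False
        using gt pre_mono [of "Suc j" m] jm by (simp add: hit_M pre_m)
    qed
    then obtain j0 where j0: "j < j0" "j0 < m" "?hit j0" by blast
    define j' where "j' = (LEAST j'. j < j' \<and> ?hit j')"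
    have j': "j < j'" "?hit j'"
      using LeastI [of "\<lambda>j'. j < j' \<and> ?hit j'" j0] j0 by (auto simp: j'_def)
    have "j' \<le> j0"
      unfolding j'_def using j0 by (intro Least_le) auto
    have none: "\<not> ?hit b" if "j \<le> b" "b < j'" for b
      using that not_less_Least [of b "\<lambda>j'. j < j' \<and> ?hit j'"] True
      by (cases "b = j") (auto simp: j'_def)
    \<comment> \<open>Up to \<open>j'\<close> the actual count is constant while the guessed count
      can only grow, so the two stay different.\<close>
    have "{j..<j'} \<subseteq> free"
    proof
      fix b assume b: "b \<in> {j..<j'}"
      show "b \<in> free"
      proof (cases "b = j")
        case False
        then have "hit (Suc j * l) = hit (b * l)"
          using b none by (intro hit_range) auto
        moreover have "pre (Suc j) \<le> pre b" using b False by (intro pre_mono) auto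
        ultimately show ?thesis
          using gt b none \<open>j' \<le> j0\<close> j0 by (intro free) auto
      qed (use jfree in simp)
    qed
    then have "j' - j \<le> card free"
      using card_mono [of free "{j..<j'}"] by simp
    then show ?thesis using j' by (intro exI [of _ j']) auto
  next
    case False
    then have lt: "pre j < hit (j * l)"
      using hit_Suc dj by (simp add: pre_Suc)
    \<comment> \<open>The actual count starts at 0 and is positive at the beginning of block
      \<open>j\<close>.\<close>
    have "\<exists>j'<j. ?hit j'"
    proof (rule ccontr)
      assume "\<not> ?thesis"
      then have "hit (0 * l) = hit (j * l)"
        by (intro hit_range) auto
      then show False using lt hit_le [of 0] by simp
    qed
    then obtain j0 where j0: "j0 < j" "?hit j0" by blast
    define j' where "j' = (GREATEST j'. j' < j \<and> ?hit j')"
    have j': "j' < j" "?hit j'"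
      using GreatestI_nat [of "\<lambda>j'. j' < j \<and> ?hit j'" j0 j] j0 by (auto simp: j'_def)
    have none: "\<not> ?hit b" if "j' < b" "b < j" for b
      using that Greatest_le_nat [of "\<lambda>j'. j' < j \<and> ?hit j'" b j] by (auto simp: j'_def)
    have "{j'<..j} \<subseteq> free"
    proof
      fix b assume b: "b \<in> {j'<..j}"
      show "b \<in> free"
      proof (cases "b = j")
        case False
        then have "hit (b * l) = hit (j * l)"
          using b none by (intro hit_range) auto
        moreover have "pre b \<le> pre j" using b by (intro pre_mono) auto
        ultimately show ?thesis
          using lt b none jm False by (intro free) auto
      qed (use jfree in simp)
    qed
    then have "j - j' \<le> card free"
      using card_mono [of free "{j'<..j}"] by simp
    then show ?thesis using j' by (intro exI [of _ j']) auto
  qed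
qed

end

section \<open>Failure probability\<close>

lemma pmf_replicate_pmf_coin:
  "length u = n \<Longrightarrow> pmf (replicate_pmf n (bernoulli_pmf (1 / 2))) u = (1 / 2) ^ n"
proof (induction n arbitrary: u)
  case (Suc n)
  then obtain b u' where u: "u = b # u'" "length u' = n" by (metis length_Suc_conv)
  let ?p = "bernoulli_pmf (1 / 2)"
  have "replicate_pmf (Suc n) ?p = map_pmf (\<lambda>(x, xs). x # xs) (pair_pmf ?p (replicate_pmf n ?p))"
    by (simp add: pair_pmf_def map_bind_pmf bind_assoc_pmf bind_return_pmf map_pmf_def)
  moreover have "inj (\<lambda>(x, xs). x # xs :: bool list)"
    by (auto intro: injI)
  ultimately have "pmf (replicate_pmf (Suc n) ?p) ((\<lambda>(x, xs). x # xs) (b, u')) =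
      pmf (pair_pmf ?p (replicate_pmf n ?p)) (b, u')"
    by (simp only: pmf_map_inj')
  also have "\<dots> = pmf ?p b * pmf (replicate_pmf n ?p) u'"
    by (rule pmf_pair)
  finally have "pmf (replicate_pmf (Suc n) ?p) u = pmf ?p b * pmf (replicate_pmf n ?p) u'"
    by (simp add: u)
  also have "pmf ?p b = 1 / 2"
    by (cases b) (simp_all add: pmf_bernoulli_True pmf_bernoulli_False)
  finally show ?case using Suc.IH [OF u(2)] by simp
qed (simp add: pmf_return)

lemma prob_replicate_pmf_coin:
  "measure_pmf.prob (replicate_pmf n (bernoulli_pmf (1 / 2))) S = card {u \<in> S. length u = n} / 2 ^ n"
proof -
  let ?p = "replicate_pmf n (bernoulli_pmf (1 / 2))"
  let ?L = "{u :: bool list. length u = n}"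
  have fin: "finite ?L"
    using finite_lists_length_eq [of "UNIV :: bool set" n] by simp
  have "set_pmf ?p \<subseteq> ?L" by (auto simp: set_replicate_pmf)
  then have "measure_pmf.prob ?p S = measure_pmf.prob ?p (S \<inter> ?L)"
  proof -
    have "S \<inter> ?L \<inter> set_pmf ?p = S \<inter> set_pmf ?p"
      using \<open>set_pmf ?p \<subseteq> ?L\<close> by blast
    then show ?thesis by (metis measure_Int_set_pmf)
  qed
  also have "\<dots> = (\<Sum>u\<in>S \<inter> ?L. pmf ?p u)"
    using fin by (intro measure_measure_pmf_finite) auto
  also have "\<dots> = (\<Sum>u\<in>S \<inter> ?L. (1 / 2) ^ n)"
    by (intro sum.cong) (auto simp: pmf_replicate_pmf_coin)
  also have "\<dots> = card {u \<in> S. length u = n} / 2 ^ n"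
  proof -
    have "S \<inter> ?L = {u \<in> S. length u = n}" by auto
    then show ?thesis by (simp add: power_divide)
  qed
  finally show ?thesis .
qed

text \<open>Conditioning on the second component: the draws are exchanged first, because
  \<open>pair_pmf\<close> draws the first component first.\<close>

lemma prob_pair_pmf_le:
  assumes "\<And>y. y \<in> set_pmf q \<Longrightarrow> measure_pmf.prob p {x. P x y} \<le> b"
  shows "measure_pmf.prob (pair_pmf p q) {(x, y). P x y} \<le> b"
proof -
  let ?X = "{(x, y). P x y}"
  have "b \<ge> 0"
    using assms set_pmf_not_empty [of q] measure_nonneg order_trans by blast
  have "pair_pmf p q = bind_pmf q (\<lambda>y. map_pmf (\<lambda>x. (x, y)) p)"
    unfolding pair_pmf_def map_pmf_def by (rule bind_commute_pmf)
  then have "emeasure (pair_pmf p q) ?X = (\<integral>\<^sup>+y. emeasure (map_pmf (\<lambda>x. (x, y)) p) ?X \<partial>measure_pmf q)"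
    by simp
  also have "\<dots> \<le> (\<integral>\<^sup>+y. ennreal b \<partial>measure_pmf q)"
  proof (rule nn_integral_mono_AE)
    have "emeasure (map_pmf (\<lambda>x. (x, y)) p) ?X \<le> ennreal b" if "y \<in> set_pmf q" for y
      using assms [OF that] by (simp add: vimage_def measure_pmf.emeasure_eq_measure ennreal_leI)
    then show "AE y in measure_pmf q. emeasure (map_pmf (\<lambda>x. (x, y)) p) ?X \<le> ennreal b"
      by (simp add: AE_measure_pmf_iff)
  qed
  also have "\<dots> = ennreal b" by simp
  finally show ?thesis
    using \<open>b \<ge> 0\<close> by (simp add: measure_pmf.emeasure_eq_measure)
qed

section \<open>Counting all guesses, and those concentrated near the deletions\<close>

lemma finite_deletion_cases: "finite (deletion_cases m s)"
  and card_deletion_cases: "card (deletion_cases m s) \<le> (m + s) choose s"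
  using card_length [of "result (cases_op m s)"] length_cases_op [of m s]
  by (auto simp flip: set_cases_op)

definition near :: "nat \<Rightarrow> nat \<Rightarrow> nat set \<Rightarrow> nat set" where
  "near l c E = (\<Union>j\<in>{j. E \<inter> {j * l..<(j + 1) * l} \<noteq> {}}. {j - c..j + c})"

lemma finite_near: "finite E \<Longrightarrow> finite (near l c E)"
  unfolding near_def by (intro finite_UN_I card_block_le) auto

lemma card_near:
  assumes "finite E"
  shows "card (near l c E) \<le> card E * (2 * c + 1)"
proof -
  let ?H = "{j. E \<inter> {j * l..<(j + 1) * l} \<noteq> {}}"
  have "card (near l c E) \<le> (\<Sum>j\<in>?H. card {j - c..j + c})"
    unfolding near_def by (intro card_UN_le card_block_le assms)
  also have "\<dots> \<le> (\<Sum>j\<in>?H. 2 * c + 1)"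
    by (intro sum_mono) auto
  also have "\<dots> = card ?H * (2 * c + 1)" by simp
  also have "\<dots> \<le> card E * (2 * c + 1)"
    using card_block_le(1) [OF assms] by (rule mult_le_mono1)
  finally show ?thesis .
qed

text \<open>Such a guess is determined by its entries on \<open>S\<close>, each of which lies
  between 0 and \<open>s\<close>.\<close>

lemma card_supported_cases:
  assumes "finite S"
  shows "card {d \<in> deletion_cases m s. \<forall>j<m. d ! j \<noteq> 0 \<longrightarrow> j \<in> S} \<le> (s + 1) ^ card S"
proof -
  let ?X = "{d \<in> deletion_cases m s. \<forall>j<m. d ! j \<noteq> 0 \<longrightarrow> j \<in> S}"
  let ?f = "\<lambda>d. restrict (\<lambda>j. if j < m then d ! j else 0) S"
  have inj: "inj_on ?f ?X"
  proof (rule inj_onI)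
    fix d d' assume dd: "d \<in> ?X" "d' \<in> ?X" and eq: "?f d = ?f d'"
    show "d = d'"
    proof (rule nth_equalityI)
      show "length d = length d'" using dd by (simp add: deletion_cases_def)
      fix j assume "j < length d"
      then have j: "j < m" using dd by (simp add: deletion_cases_def)
      show "d ! j = d' ! j"
      proof (cases "j \<in> S")
        case True
        then show ?thesis using fun_cong [OF eq, of j] j by simp
      next
        case False
        then show ?thesis using dd j by (metis (mono_tags, lifting) mem_Collect_eq)
      qed
    qed
  qed
  have "d ! j \<le> s" if "d \<in> deletion_cases m s" "j < m" for d j
    using that member_le_sum_list [of "d ! j" d] by (auto simp: deletion_cases_def)
  then have "?f ` ?X \<subseteq> PiE S (\<lambda>_. {..s})" by auto
  then have "card (?f ` ?X) \<le> card (PiE S (\<lambda>_. {..s}))"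
    using assms by (intro card_mono finite_PiE) auto
  then show ?thesis
    unfolding card_image [OF inj] using assms by (simp add: card_PiE)
qed

context guess
begin

lemma few_free_near:
  assumes "card free < c" "j < m" "d ! j \<noteq> 0"
  shows "j \<in> near l c E"
proof -
  have "j \<in> erased" using assms by (simp add: erased_def)
  then obtain j' where "E \<inter> {j' * l..<(j' + 1) * l} \<noteq> {}" "j \<le> j' + card free" "j' \<le> j + card free"
    using erased_near_hit by blast
  then show ?thesis
    unfolding near_def using assms(1) by (intro UN_I [of j']) auto
qed

lemma real_bound:
  assumes "card confused_messages * k ^ a \<le> 2 ^ k"
  shows "card confused_messages / 2 ^ k \<le> real k powr - real a"
proof -
  have k: "real k > 0" using k_gt by simp
  have "real (card confused_messages) * real k ^ a \<le> 2 ^ k"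
    using assms by (metis of_nat_le_iff of_nat_mult of_nat_power of_nat_numeral)
  then show ?thesis
    using k by (simp add: powr_minus powr_realpow field_simps)
qed

text \<open>The weaker term is charged only to guesses whose erased blocks lie near the deletions,
  so in the sum over all guesses it occurs a bounded number of times.\<close>

lemma confused_messages_bound:
  "card confused_messages / 2 ^ k \<le> real k powr (real \<delta> - real c) +
    (if \<forall>j<m. d ! j \<noteq> 0 \<longrightarrow> j \<in> near l c E then real k powr (2 * real \<delta> - real c - 1) else 0)"
proof (cases "card free < c")
  case True
  have k: "real k \<ge> 1" using k_gt by simp
  have "card confused_messages / 2 ^ k \<le> real k powr - real (c + 1 - 2 * \<delta>)"
    by (rule real_bound [OF card_confused_messages_few_free [OF True]])
  \<comment> \<open>Only an inequality: \<open>c + 1 - 2 * \<delta>\<close> may have been truncated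
    to 0, and then the exponent on the right is positive.\<close>
  also have "\<dots> \<le> real k powr (2 * real \<delta> - real c - 1)"
    using k by (intro powr_mono) (auto simp: of_nat_diff_if)
  finally show ?thesis
    using few_free_near [OF True] by (simp add: add_increasing)
next
  case False
  have "card confused_messages / 2 ^ k \<le> real k powr - real (c - \<delta>)"
    using False by (intro real_bound card_confused_messages_many_free) simp
  also have "- real (c - \<delta>) = real \<delta> - real c" using c_gt by simp
  finally show ?thesis by (simp add: add_increasing2)
qed

end

context gc
begin

lemma fraction_failures:
  assumes D: "D \<subseteq> {..<k + c * (\<delta> + 1) * l}" "card D \<le> \<delta>"
  shows "card {u. length u = k \<and> gc_decode R B G k \<delta> c (received u D) = None} / 2 ^ k \<le>
    real ((m + \<delta>) choose \<delta>) * real k powr (real \<delta> - real c) +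
    real ((\<delta> + 1) ^ (\<delta> * (2 * c + 1))) * real k powr (2 * real \<delta> - real c - 1)"
    (is "card ?F / _ \<le> _")
proof -
  obtain E where E: "E \<subseteq> {..<k}" "card E = \<delta>"
    "\<forall>u. length u = k \<longrightarrow> received_systematic k \<delta> (received u D) = delete_at E (padded u)"
    using received_systematic_exists [OF D] by blast
  \<comment> \<open>A guess with an entry above \<open>l\<close> is never a possible case, so the
    guesses in \<open>V\<close> account for all failures.\<close>
  define V where "V = {d \<in> deletion_cases m \<delta>. \<forall>a\<in>set d. a \<le> l}"
  \<comment> \<open>\<open>guess.confused_messages\<close> spelled out independently of the locale,
    whose assumptions hold for the guesses in \<open>V\<close>.\<close>
  define Q where "Q d = {u. \<exists>Y. length u = k \<and> Y \<noteq> syms u \<and>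
    possible_case R B G k \<delta> c (parities u) (delete_at E (padded u)) d Y}" for d
  have finV: "finite V" using finite_deletion_cases by (simp add: V_def)
  have guess: "guess R B G k \<delta> c e E d" if "d \<in> V" for d
    using that E by unfold_locales (auto simp: V_def)
  have Q_eq: "Q d = guess.confused_messages R B G k \<delta> c E d" if "d \<in> V" for d
    using guess [OF that] by (simp add: guess.confused_messages_def guess.confused_def Q_def)
  have finQ: "finite (Q d)" for d
    by (rule finite_subset [OF _ finite_lists_length_eq [of UNIV k]]) (auto simp: Q_def)
  define S where "S = near l c E"
  have finS: "finite S" and cardS: "card S \<le> \<delta> * (2 * c + 1)"
    using finite_near [of E l c] card_near [of E l c] E finite_subset [OF E(1)]
    by (auto simp: S_def)
  let ?x = "real k powr (real \<delta> - real c)" and ?y = "real k powr (2 * real \<delta> - real c - 1)"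
  have "?F \<subseteq> (\<Union>d\<in>V. Q d)"
  proof
    fix u assume u: "u \<in> ?F"
    then have "length u = k" by simp
    have "\<exists>Y\<in>cases_found u D. Y \<noteq> syms u"
      using u by (intro gc_decode_failure [OF \<open>length u = k\<close> D]) simp
    then obtain Y d where "d \<in> deletion_cases m \<delta>" "Y \<noteq> syms u"
      and p: "possible_case R B G k \<delta> c (parities u) (delete_at E (padded u)) d Y"
      using cases_found_def [OF \<open>length u = k\<close> D] E(3) \<open>length u = k\<close> by auto
    moreover have "\<forall>a\<in>set d. a \<le> l"
      using p \<open>d \<in> deletion_cases m \<delta>\<close>
      by (auto simp: possible_case_def deletion_cases_def in_set_conv_nth)
    ultimately show "u \<in> (\<Union>d\<in>V. Q d)"
      using \<open>length u = k\<close> by (auto simp: V_def Q_def)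
  qed
  then have "card ?F \<le> card (\<Union>d\<in>V. Q d)"
    using finV finQ by (intro card_mono) auto
  also have "\<dots> \<le> (\<Sum>d\<in>V. card (Q d))"
    using finV by (rule card_UN_le)
  finally have "real (card ?F) \<le> (\<Sum>d\<in>V. real (card (Q d)))"
    unfolding of_nat_sum [symmetric] of_nat_le_iff .
  then have "card ?F / 2 ^ k \<le> (\<Sum>d\<in>V. real (card (Q d))) / 2 ^ k"
    by (rule divide_right_mono) simp
  also have "\<dots> = (\<Sum>d\<in>V. card (Q d) / 2 ^ k)"
    by (rule sum_divide_distrib)
  also have "\<dots> \<le> (\<Sum>d\<in>V. ?x + (if \<forall>j<m. d ! j \<noteq> 0 \<longrightarrow> j \<in> S then ?y else 0))"
  proof (rule sum_mono)
    fix d assume "d \<in> V"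
    show "card (Q d) / 2 ^ k \<le> ?x + (if \<forall>j<m. d ! j \<noteq> 0 \<longrightarrow> j \<in> S then ?y else 0)"
      unfolding S_def Q_eq [OF \<open>d \<in> V\<close>] by (rule guess.confused_messages_bound [OF guess [OF \<open>d \<in> V\<close>]])
  qed
  also have "\<dots> = card V * ?x + card {d \<in> V. \<forall>j<m. d ! j \<noteq> 0 \<longrightarrow> j \<in> S} * ?y"
    using finV by (simp add: sum.distrib sum.If_cases Int_def)
  also have "\<dots> \<le> real ((m + \<delta>) choose \<delta>) * ?x + real ((\<delta> + 1) ^ (\<delta> * (2 * c + 1))) * ?y"
  proof (intro add_mono mult_right_mono)
    have "card V \<le> card (deletion_cases m \<delta>)"
      using finite_deletion_cases by (intro card_mono) (auto simp: V_def)
    then show "real (card V) \<le> real ((m + \<delta>) choose \<delta>)"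
      using card_deletion_cases [of m \<delta>] by simp
    have "card {d \<in> V. \<forall>j<m. d ! j \<noteq> 0 \<longrightarrow> j \<in> S} \<le>
        card {d \<in> deletion_cases m \<delta>. \<forall>j<m. d ! j \<noteq> 0 \<longrightarrow> j \<in> S}"
      using finite_deletion_cases [of m \<delta>] by (intro card_mono) (auto simp: V_def)
    also have "\<dots> \<le> (\<delta> + 1) ^ card S"
      by (rule card_supported_cases [OF finS])
    also have "\<dots> \<le> (\<delta> + 1) ^ (\<delta> * (2 * c + 1))"
      using cardS by (intro power_increasing) auto
    finally show "real (card {d \<in> V. \<forall>j<m. d ! j \<noteq> 0 \<longrightarrow> j \<in> S}) \<le>
        real ((\<delta> + 1) ^ (\<delta> * (2 * c + 1)))"
      by (simp only: of_nat_le_iff)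
  qed auto
  finally show ?thesis .
qed

text \<open>\<open>fraction_failures\<close> gives the same bound for every deletion set, so
  averaging over random sets of any size \<open>s \<le> \<delta>\<close> preserves it.\<close>

lemma prob_failure:
  assumes "s \<le> \<delta>"
  shows "measure_pmf.prob
      (pair_pmf (replicate_pmf k (bernoulli_pmf (1 / 2)))
        (pmf_of_set {D. D \<subseteq> {..<k + c * (\<delta> + 1) * l} \<and> card D = s}))
      {(u, D). gc_decode R B G k \<delta> c (delete_at D (gc_encode R B G k \<delta> c u)) = None} \<le>
    real ((m + \<delta>) choose \<delta>) * real k powr (real \<delta> - real c) +
    real ((\<delta> + 1) ^ (\<delta> * (2 * c + 1))) * real k powr (2 * real \<delta> - real c - 1)"
proof (rule prob_pair_pmf_le)
  let ?N = "k + c * (\<delta> + 1) * l"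
  let ?Ds = "{D. D \<subseteq> {..<?N} \<and> card D = s}"
  fix D assume D: "D \<in> set_pmf (pmf_of_set ?Ds)"
  have "finite ?Ds" by (rule finite_subset [of _ "Pow {..<?N}"]) auto
  \<comment> \<open>\<open>set_pmf_of_set\<close> requires a nonempty set;
    \<open>s \<le> \<delta> \<le> k\<close> provides a witness.\<close>
  moreover have "{..<s} \<in> ?Ds" using assms \<delta>_le_k by auto
  then have "?Ds \<noteq> {}" by blast
  ultimately have "set_pmf (pmf_of_set ?Ds) = ?Ds"
    by (intro set_pmf_of_set)
  then have D': "D \<subseteq> {..<?N}" "card D \<le> \<delta>" using D assms by auto
  have "{u \<in> {u. gc_decode R B G k \<delta> c (delete_at D (gc_encode R B G k \<delta> c u)) = None}. length u = k}
      = {u. length u = k \<and> gc_decode R B G k \<delta> c (received u D) = None}"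
    using received_def [OF _ D'] by auto
  then show "measure_pmf.prob (replicate_pmf k (bernoulli_pmf (1 / 2)))
      {u. gc_decode R B G k \<delta> c (delete_at D (gc_encode R B G k \<delta> c u)) = None} \<le>
    real ((m + \<delta>) choose \<delta>) * real k powr (real \<delta> - real c) +
    real ((\<delta> + 1) ^ (\<delta> * (2 * c + 1))) * real k powr (2 * real \<delta> - real c - 1)"
    unfolding prob_replicate_pmf_coin using fraction_failures [OF D'] by simp
qed

end

section \<open>Operation counts\<close>

lemma ops_check_all_op:
  assumes "\<And>d. d \<in> set ds \<Longrightarrow> ops (check_op T l \<delta> ps s d) \<le> K"
  shows "ops (check_all_op T l \<delta> ps s ds) \<le> length ds * (K + 1) + 1"
  using assms
proof (induction ds)
  case (Cons d ds)
  then have "ops (check_op T l \<delta> ps s d) \<le> K"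
    "ops (check_all_op T l \<delta> ps s ds) \<le> length ds * (K + 1) + 1" by auto
  then show ?case by simp
qed simp

lemma ops_output_op:
  assumes "\<And>Z. Z \<in> set Zs \<Longrightarrow> length Z = m \<and> (\<forall>b\<in>set Z. length b = l)"
  shows "ops (output_op k Zs) \<le> length Zs * (m * (l + 2) + 2) + m * l + 2 * m + k + 5"
proof (cases Zs)
  case (Cons Y Ys)
  then have Y: "length Y = m" "\<forall>b\<in>set Y. length b = l" using assms by auto
  have "ops (all_equal_op Y Ys) \<le> length Ys * (m * (l + 2) + 2) + 1"
    using ops_all_equal_op [of Y l Ys] Y by simp
  moreover have "length (concat Y) = length Y * l"
    using Y(2) by (induction Y) auto
  then have "ops (concat_op Y) = m * l + 2 * m + 1"
    using Y by (simp add: ops_concat_op)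
  moreover have "ops (take_op k (concat Y)) \<le> k + 1"
    by (rule ops_take_op)
  ultimately show ?thesis using Cons by simp
qed simp

text \<open>The factor 2 covers \<open>n = 3\<close>, where \<open>n * n\<close> exceeds
  \<open>2 ^ n\<close>.\<close>

lemma square_le_two_power: "n * n \<le> 2 * 2 ^ n" for n :: nat
proof -
  have large: "n * n \<le> 2 ^ n" if "4 \<le> n" for n :: nat
    using that
  proof (induction n rule: dec_induct)
    case (step n)
    have "2 * n + 1 \<le> n * n"
      using mult_le_mono1 [OF \<open>4 \<le> n\<close>, of n] \<open>4 \<le> n\<close> by linarith
    then show ?case using step(3) by simp
  qed simp
  have "4 \<le> n \<Longrightarrow> n * n \<le> 2 * 2 ^ n" using large [of n] by linarith
  moreover have "n = 0 \<or> n = 1 \<or> n = 2 \<or> n = 3 \<or> 4 \<le> n" by linarith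
  ultimately show ?thesis by (elim disjE) simp_all
qed

context gc
begin

lemma l_le_k: "l \<le> k"
  unfolding l_eq using less_exp [of e] by (simp add: k_eq)

lemma ml_le: "m * l \<le> 2 * k" and m_le: "m \<le> 2 * k"
proof -
  show "m * l \<le> 2 * k" using m_bounds(2) l_le_k by linarith
  moreover have "m * 1 \<le> m * l" using l_pos by (intro mult_le_mono2)
  ultimately show "m \<le> 2 * k" by linarith
qed

lemma ll_le: "l * l \<le> 2 * k"
  unfolding l_eq using square_le_two_power [of e] by (simp add: k_eq)

lemma k_pos: "1 \<le> k" using k_gt by simp

lemma mll_le: "m * l * l \<le> 2 * (k * l)"
  using mult_le_mono1 [OF ml_le, of l] by (simp add: mult.assoc)

text \<open>Each parity takes \<open>m\<close> products of an \<open>l\<close> by \<open>l\<close>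
  matrix with a vector, and \<open>m * l * l\<close> is \<open>O(k * l)\<close>. \<open>X\<close> is
  \<open>k * l\<close> for the encoder and \<open>k * k\<close> for the decoder.\<close>

lemma ops_parities_op_gc:
  assumes "set T' \<subseteq> set T" "length T' \<le> c" "length bs = m" "\<forall>b\<in>set bs. length b = l"
    and X: "k \<le> X" "k * l \<le> X"
  shows "ops (parities_op l T' bs) \<le> 21 * c * X + 1"
proof -
  have "ops (parities_op l T' bs) \<le> length T' * (length bs * (l * (l + 2) + l + 3) + l + 3) + 1"
    using assms square_T by (intro ops_parities_op) (auto simp: square_def)
  also have "length bs * (l * (l + 2) + l + 3) + l + 3 = m * l * l + 3 * (m * l) + 3 * m + l + 3"
    using assms(3) by (simp add: algebra_simps)
  also have "\<dots> \<le> 21 * X"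
    using mll_le ml_le m_le l_le_k k_pos X by linarith
  also have "length T' * (21 * X) + 1 \<le> c * (21 * X) + 1"
    using assms(2) by simp
  finally show ?thesis by (simp add: algebra_simps)
qed

lemma ops_gc_encode_op:
  assumes u: "length u = k"
  shows "ops (gc_encode_op T k \<delta> u) \<le> (40 + 40 * c + 2 * c * \<delta>) * (k * l)"
    "result (gc_encode_op T k \<delta> u) = gc_encode R B G k \<delta> c u"
proof -
  let ?X = "k * l"
  define bs where "bs = map (block l (padded u)) [0..<m]"
  have kX: "k \<le> ?X" using l_pos by simp
  have bs: "length bs = m" "\<forall>b\<in>set bs. length b = l"
    using length_block [OF length_padded [OF u]] by (auto simp: bs_def)
  have sym_bs: "map sym bs = syms u"
    by (simp add: bs_def message_symbols_def padded_def)
  have par: "map (\<lambda>Ms. parity_bits l Ms bs) T = map bts (parities u)"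
    by (rule nth_equalityI) (auto simp: parity_bits_code_table bs nth_parities sym_bs)
  have len: "length (parity_string u) = c * l"
    using length_concat_bits [OF set_parities] by simp
  have "result (gc_encode_op T k \<delta> u) =
      u @ repeat_bits (\<delta> + 1) (concat (map (\<lambda>Ms. parity_bits l Ms bs) T))"
    by (simp add: gc_encode_op_def bs_def padded_def padding_def)
  then show "result (gc_encode_op T k \<delta> u) = gc_encode R B G k \<delta> c u"
    by (simp add: par gc_encode_eq)
  have "ops (gc_encode_op T k \<delta> u) =
      (m * l - k + 1) + (k + 1) + ops (chunks_op m l (padded u)) + ops (parities_op l T bs) +
      (c * l + 2 * c + 1) + ops (repeat_op (\<delta> + 1) (parity_string u)) + (k + 1) + 1"
    using u len par
    by (simp add: gc_encode_op_def bs_def padded_def padding_def ops_concat_op)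
  moreover have "ops (chunks_op m l (padded u)) \<le> m * (2 * l + 3) + 1"
    by (rule ops_chunks_op)
  moreover have "m * (2 * l + 3) = 2 * (m * l) + 3 * m" by (simp add: algebra_simps)
  moreover have "ops (parities_op l T bs) \<le> 21 * c * ?X + 1"
    using bs kX by (intro ops_parities_op_gc) auto
  moreover have "ops (repeat_op (\<delta> + 1) (parity_string u)) = c * l * (2 * \<delta> + 5) + 1"
    using len by (simp add: ops_repeat_op algebra_simps)
  moreover have "c * l * (2 * \<delta> + 5) = 2 * c * \<delta> * l + 5 * (c * l)" by (simp add: algebra_simps)
  moreover have "2 * c * \<delta> * l \<le> 2 * c * \<delta> * ?X" "c * l \<le> c * ?X" "c \<le> c * ?X" "1 \<le> ?X"
    using k_pos l_pos by simp_all
  moreover have "(40 + 40 * c + 2 * c * \<delta>) * ?X = 40 * ?X + 40 * (c * ?X) + 2 * c * \<delta> * ?X"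
    by (simp add: algebra_simps)
  moreover have "21 * c * ?X = 21 * (c * ?X)" by simp
  ultimately show "ops (gc_encode_op T k \<delta> u) \<le> (40 + 40 * c + 2 * c * \<delta>) * ?X"
    using ml_le m_le kX k_pos by linarith
qed

text \<open>A generous constant; the cube stems from Gaussian elimination with at most
  \<open>\<delta> * l\<close> unknowns and equations.\<close>

definition check_const :: nat where
  "check_const = 100 + 100 * c + 100 * (\<delta> + 1) ^ 3"

text \<open>Elimination is cubic in \<open>l\<close>, which \<open>l \<le> k\<close> and
  \<open>l * l \<le> 2 * k\<close> turn into \<open>O(k * k)\<close>. A quadratic cost per case
  suffices: the number of cases supplies the factor \<open>(k / log k) ^ \<delta>\<close> of the
  decoding bound.\<close>

lemma ops_check_op:
  assumes p: "length p = c" "set p \<subseteq> carrier R"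
    and s: "length s = m * l - \<delta>"
    and d: "d \<in> deletion_cases m \<delta>"
  shows "ops (check_op T l \<delta> (map bts p) s d) \<le> check_const * (k * k)"
proof (cases "\<forall>a\<in>set d. a \<le> l")
  case False
  have "ops (check_op T l \<delta> (map bts p) s d) = m + 2"
    using False d by (auto simp: check_op_def deletion_cases_def)
  also have "\<dots> \<le> 4 * (k * k)"
    using m_le k_pos mult_le_mono2 [OF k_pos, of k] by linarith
  also have "\<dots> \<le> check_const * (k * k)"
    by (intro mult_le_mono1) (simp add: check_const_def)
  finally show ?thesis .
next
  case True
  let ?X = "k * k"
  have kX: "k \<le> ?X" "k * l \<le> ?X" "1 \<le> ?X"
    using l_le_k k_pos by simp_all
  have len_d: "length d = m" and sum_d: "sum_list d = \<delta>"
    using d by (auto simp: deletion_cases_def)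
  define bs where "bs = map (subblock l d s) [0..<m]"
  define n where "n = erasures d"
  define zs where "zs = zero_erased l d bs"
  define qs where "qs = map (\<lambda>Ms. parity_bits l Ms zs) T"
  define syn where "syn = map2 xor_list (map bts p) qs"
  define es where "es = result (equations_op l d (take \<delta> T) syn)"
  have n: "n \<le> \<delta>" using erasures_le_sum_list [of d] sum_d by (simp add: n_def)
  have nl: "n * l \<le> \<delta> * l" using n by (rule mult_le_mono1)
  have len_bs: "length bs = m" by (simp add: bs_def)
  have bs_l: "\<forall>j<length d. d ! j = 0 \<longrightarrow> length (bs ! j) = l"
    using length_subblock [OF len_d sum_d True s] by (auto simp: bs_def len_d)
  have zs: "length zs = m" "\<forall>z\<in>set zs. length z = l"
    using len_d len_bs bs_l by (auto simp: zs_def zero_erased_def set_zip)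
  have sq: "\<forall>Ms\<in>set (take \<delta> T). \<forall>M\<in>set Ms. square l M"
    using square_T by (auto dest: in_set_takeD)
  have ps_l: "\<forall>x\<in>set (map bts p). length x \<le> l"
    using p by auto
  have n_l: "\<forall>(a, b)\<in>set es. length a = n * l"
  proof -
    have "length a = n * l" if "(a, b) \<in> set es" for a b
    proof -
      from that obtain Ms q where M: "(Ms, q) \<in> set (zip (take \<delta> T) syn)" "a \<in> set (erased_columns l d Ms)"
        unfolding es_def set_equations_op by (auto dest: set_zip_leftD)
      then have "Ms \<in> set T" by (auto dest: set_zip_leftD in_set_takeD)
      then have "\<forall>M\<in>set Ms. square l M" "length Ms = m"
        using square_T by (auto simp: code_table_def)
      then show ?thesis
        using length_row_erased_columns [OF _ _ M(2)] len_d by (simp add: n_def)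
    qed
    then show ?thesis by auto
  qed
  have len_es: "length es \<le> \<delta> * l"
    using length_equations_op [OF sq, of d syn] c_gt by (simp add: es_def)
  note solver = solve_op_correct [OF n_l]
  define rest where "rest x = (let xs = map (block l x) [0..<n]; Y = fill d bs xs in
    ops (chunks_op n l x) + ops (fill_op d bs xs) + ops (drop_op \<delta> T) +
    ops (parities_op l (drop \<delta> T) Y) + ops (drop_op \<delta> (map bts p)) +
    ops (equal_blocks_op (map (\<lambda>Ms. parity_bits l Ms Y) (drop \<delta> T)) (drop \<delta> (map bts p))) +
    ops (superseqs_op d bs Y) + 1)" for x
  have total: "ops (check_op T l \<delta> (map bts p) s d) =
      ops (all_le_op l d) + ops (subblocks_op l d s) + ops (zero_erased_op l d bs) +
      ops (parities_op l T zs) + ops (xor_blocks_op (map bts p) qs) + ops (take_op \<delta> T) +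
      ops (equations_op l d (take \<delta> T) syn) + ops (count_erased_op d) + ops (solve_op (n * l) es) +
      (case result (solve_op (n * l) es) of None \<Rightarrow> 1 | Some x \<Rightarrow> rest x)"
    using True
    by (simp add: check_op_def bs_def n_def zs_def qs_def syn_def es_def rest_def len_d Let_def
        split: option.split)
  have rest: "rest x \<le> (30 + 3 * \<delta>) * ?X + 30 * (c * ?X)" if "result (solve_op (n * l) es) = Some x" for x
  proof -
    define xs where "xs = map (block l x) [0..<n]"
    define Y where "Y = fill d bs xs"
    have x: "length x = n * l" using solver that by simp
    have xs: "length xs = n" "\<forall>x\<in>set xs. length x = l"
      using length_block [OF x] by (auto simp: xs_def)
    have Y: "length Y = m" "\<forall>y\<in>set Y. length y = l"
    proof -
      show "length Y = m" by (simp add: Y_def len_d len_bs)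
      show "\<forall>y\<in>set Y. length y = l"
      proof
        fix y assume y: "y \<in> set Y"
        show "length y = l"
          by (rule length_nth_fill [OF bs_l xs(2) _ _ y [unfolded Y_def]])
            (simp_all add: xs(1) n_def len_bs len_d)
      qed
    qed
    have "ops (chunks_op n l x) \<le> n * (2 * l + 3) + 1" by (rule ops_chunks_op)
    moreover have "n * (2 * l + 3) \<le> \<delta> * (5 * k)"
      using n l_le_k k_pos by (intro mult_le_mono) linarith+
    moreover have "\<delta> * (5 * k) \<le> 5 * (k * k)" using \<delta>_le_k by simp
    moreover have "ops (fill_op d bs xs) \<le> m + 1" using ops_fill_op [of d bs xs] len_d by simp
    moreover have "ops (drop_op \<delta> T) \<le> c + 1" using ops_drop_op_length [of \<delta> T] by simp
    moreover have "ops (drop_op \<delta> (map bts p)) \<le> c + 1"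
      using ops_drop_op_length [of \<delta> "map bts p"] p by simp
    moreover have "ops (parities_op l (drop \<delta> T) Y) \<le> 21 * c * ?X + 1"
      using Y kX by (intro ops_parities_op_gc) (auto dest: in_set_dropD)
    moreover have "ops (equal_blocks_op (map (\<lambda>Ms. parity_bits l Ms Y) (drop \<delta> T)) (drop \<delta> (map bts p)))
        \<le> c * (l + 2) + 1"
    proof -
      have "\<forall>z\<in>set (map (\<lambda>Ms. parity_bits l Ms Y) (drop \<delta> T)). length z \<le> l"
      proof
        fix z assume "z \<in> set (map (\<lambda>Ms. parity_bits l Ms Y) (drop \<delta> T))"
        then obtain Ms where "Ms \<in> set T" "z = parity_bits l Ms Y" by (auto dest: in_set_dropD)
        then show "length z \<le> l"
          using square_T length_parity_bits [of Ms l Y] by (simp add: square_def)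
      qed
      from ops_equal_blocks_op [OF this, of "drop \<delta> (map bts p)"] show ?thesis
        by (rule order_trans) (simp add: mult_le_mono1 del: mult_Suc_right add_2_eq_Suc')
    qed
    moreover have "c * (l + 2) \<le> c * (3 * ?X)"
      using l_le_k kX by (intro mult_le_mono2) linarith
    moreover have "ops (superseqs_op d bs Y) \<le> m * (l + 2) + 1"
      using ops_superseqs_op [of Y l d bs] Y len_d by simp
    moreover have "m * (l + 2) = m * l + 2 * m" by (simp add: algebra_simps)
    moreover have "c \<le> c * ?X" using kX by simp
    moreover have "21 * c * ?X = 21 * (c * ?X)" "c * (3 * ?X) = 3 * (c * ?X)" by simp_all
    moreover have "(30 + 3 * \<delta>) * ?X = 30 * ?X + 3 * \<delta> * ?X" by (simp add: algebra_simps)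
    moreover have "rest x = ops (chunks_op n l x) + ops (fill_op d bs xs) + ops (drop_op \<delta> T) +
        ops (parities_op l (drop \<delta> T) Y) + ops (drop_op \<delta> (map bts p)) +
        ops (equal_blocks_op (map (\<lambda>Ms. parity_bits l Ms Y) (drop \<delta> T)) (drop \<delta> (map bts p))) +
        ops (superseqs_op d bs Y) + 1"
      by (simp add: rest_def Let_def xs_def Y_def)
    ultimately show ?thesis using ml_le m_le kX by linarith
  qed
  have rest': "(case result (solve_op (n * l) es) of None \<Rightarrow> 1 | Some x \<Rightarrow> rest x)
      \<le> (30 + 3 * \<delta>) * ?X + 30 * (c * ?X)"
  proof (cases "result (solve_op (n * l) es)")
    case None
    have "1 \<le> (30 + 3 * \<delta>) * ?X" using mult_le_mono [of 1 "30 + 3 * \<delta>" 1 ?X] kX(3) by simp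
    then show ?thesis using None by (simp only: option.case)
  qed (use rest in simp)
  have "ops (solve_op (n * l) es) \<le> (n * l + 1) * (\<delta> * l * (\<delta> * l + 5) + \<delta> * l + 10)"
    using n_l nl len_es by (intro ops_solve_op) auto
  \<comment> \<open>Since \<open>l \<ge> 1\<close>, the quantity \<open>(\<delta> + 1) * l\<close>
    dominates \<open>\<delta> * l + 1\<close>; the factor 15 absorbs the lower-order terms.\<close>
  also have "\<dots> \<le> ((\<delta> + 1) * l) * (15 * (((\<delta> + 1) * l) * ((\<delta> + 1) * l)))"
  proof (intro mult_le_mono)
    let ?L = "(\<delta> + 1) * l"
    have L: "\<delta> * l + 1 \<le> ?L" using l_pos by simp
    then show "n * l + 1 \<le> ?L" using nl by linarith
    have L1: "1 \<le> ?L" using L by linarith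
    have "\<delta> * l * (\<delta> * l + 5) \<le> ?L * (5 * ?L)"
      using L L1 by (intro mult_le_mono) linarith+
    moreover have "?L * 1 \<le> ?L * ?L" using L1 by (intro mult_le_mono2)
    moreover have "?L * (5 * ?L) = 5 * (?L * ?L)" by simp
    ultimately show "\<delta> * l * (\<delta> * l + 5) + \<delta> * l + 10 \<le> 15 * (?L * ?L)"
      using L L1 by linarith
  qed
  also have "\<dots> = 15 * (\<delta> + 1) ^ 3 * (l * (l * l))"
    by (simp add: power3_eq_cube algebra_simps)
  also have "\<dots> \<le> 15 * (\<delta> + 1) ^ 3 * (k * (2 * k))"
    by (rule mult_le_mono2, rule mult_le_mono [OF l_le_k ll_le])
  finally have solve: "ops (solve_op (n * l) es) \<le> 30 * ((\<delta> + 1) ^ 3 * ?X)"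
    by (simp add: mult.assoc mult.left_commute)
  have "ops (all_le_op l d) = m + 1" using len_d by simp
  moreover have "ops (subblocks_op l d s) \<le> m * (2 * l + 3) + 1"
    using ops_subblocks_op [of l d s] len_d by simp
  moreover have "m * (2 * l + 3) = 2 * (m * l) + 3 * m" by (simp add: algebra_simps)
  moreover have "ops (zero_erased_op l d bs) \<le> m * (l + 2) + 1"
    using ops_zero_erased_op [of l d bs] len_d by simp
  moreover have "m * (l + 2) = m * l + 2 * m" by (simp add: algebra_simps)
  moreover have "ops (parities_op l T zs) \<le> 21 * c * ?X + 1"
    using zs kX by (intro ops_parities_op_gc) auto
  moreover have "21 * c * ?X = 21 * (c * ?X)" by simp
  moreover have "ops (xor_blocks_op (map bts p) qs) \<le> c * (l + 2) + 1"
    using ops_xor_blocks_op [OF ps_l, of qs] p by simp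
  moreover have "c * (l + 2) \<le> c * (3 * ?X)"
    using l_le_k kX by (intro mult_le_mono2) linarith
  moreover have "c * (3 * ?X) = 3 * (c * ?X)" by simp
  moreover have "ops (take_op \<delta> T) \<le> \<delta> + 1" by (rule ops_take_op)
  moreover have "ops (equations_op l d (take \<delta> T) syn) \<le> \<delta> * (21 * ?X) + 1"
  proof -
    have "ops (equations_op l d (take \<delta> T) syn) \<le>
        length (take \<delta> T) * (length d * (l * (l + 2) + 2) + 3 * l + 6) + 1"
      by (rule ops_equations_op [OF sq])
    also have "length d * (l * (l + 2) + 2) + 3 * l + 6 = m * l * l + 2 * (m * l) + 2 * m + 3 * l + 6"
      using len_d by (simp add: algebra_simps)
    also have "length (take \<delta> T) = \<delta>" using c_gt by simp
    also have "\<delta> * (m * l * l + 2 * (m * l) + 2 * m + 3 * l + 6) + 1 \<le> \<delta> * (21 * ?X) + 1"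
      using mll_le ml_le m_le l_le_k kX
      by (intro add_mono mult_le_mono2 order_refl) linarith
    finally show ?thesis .
  qed
  moreover have "\<delta> * (21 * ?X) = 21 * (\<delta> * ?X)" by simp
  moreover have "(30 + 3 * \<delta>) * ?X = 30 * ?X + 3 * (\<delta> * ?X)" by (simp add: algebra_simps)
  moreover have "ops (count_erased_op d) = m + 1" using len_d by simp
  moreover have "\<delta> * ?X \<le> (\<delta> + 1) ^ 3 * ?X"
  proof (rule mult_le_mono1)
    have "\<delta> \<le> (\<delta> + 1) ^ 1" by simp
    also have "\<dots> \<le> (\<delta> + 1) ^ 3" by (rule power_increasing) auto
    finally show "\<delta> \<le> (\<delta> + 1) ^ 3" .
  qed
  moreover have "check_const * ?X = 100 * ?X + 100 * (c * ?X) + 100 * ((\<delta> + 1) ^ 3 * ?X)"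
    by (simp add: check_const_def algebra_simps)
  ultimately show ?thesis
    using total rest' solve ml_le m_le kX \<delta>_le_k by linarith
qed

definition decode_const :: nat where
  "decode_const = 100 + 100 * c + 4 * (c * \<delta>) + check_const"

lemma ops_gc_decode_op:
  assumes u: "length u = k" and D: "D \<subseteq> {..<k + c * (\<delta> + 1) * l}" "card D \<le> \<delta>"
  shows "ops (gc_decode_op T k \<delta> c (received u D)) \<le> decode_const * (k * k * ((m + \<delta>) choose \<delta>))"
proof -
  let ?P = "(m + \<delta>) choose \<delta>"
  let ?X = "k * k" and ?XP = "k * k * ((m + \<delta>) choose \<delta>)"
  let ?y = "received u D"
  have kX: "k \<le> ?X" "k * l \<le> ?X" "1 \<le> ?X"
    using l_le_k k_pos by simp_all
  have P: "1 \<le> ?P" by (metis One_nat_def Suc_leI le_add2 zero_less_binomial)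
  then have XP: "?X * 1 \<le> ?XP" by (intro mult_le_mono2)
  define ps where "ps = map bts (parities u)"
  define s where "s = received_systematic k \<delta> ?y"
  define ds where "ds = result (cases_op m \<delta>)"
  define Zs where "Zs = result (check_all_op T l \<delta> ps s ds)"
  note sample = sample_op_received [OF u D]
  have ps: "map (block l (parity_string u)) [0..<c] = ps"
    unfolding ps_def using set_parities [of u] by (intro nth_equalityI) (auto simp: block_concat_bits)
  have len_s: "length s = m * l - \<delta>"
    unfolding s_def by (rule length_received_systematic [OF u D])
  have ds: "set ds = deletion_cases m \<delta>" by (simp add: ds_def set_cases_op)
  have len_ds: "length ds \<le> ?P" unfolding ds_def by (rule length_cases_op)
  have len_y: "length ?y \<le> k + c * (\<delta> + 1) * l"
    using length_gc_encode [OF u] D by (simp add: received_def [OF u D] length_delete_at)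
  have total: "ops (gc_decode_op T k \<delta> c ?y) =
      (length ?y + 1) + ops (drop_op (length ?y - (c * (\<delta> + 1) * l - \<delta>)) ?y) +
      ops (sample_op \<delta> (c * l) (tail ?y)) + ops (chunks_op c l (parity_string u)) +
      ops (take_op (k - \<delta>) ?y) + (m * l - k + 1) + (length (take (k - \<delta>) ?y) + 1) +
      ops (cases_op m \<delta>) + ops (check_all_op T l \<delta> ps s ds) + ops (output_op k Zs) + 1"
    using sample ps
    by (simp add: gc_decode_op_def s_def received_systematic_def padding_def ds_def Zs_def)
  have XP': "l \<le> ?XP" "1 \<le> ?XP" "k \<le> ?XP" using l_le_k kX XP by linarith+
  have cl: "c * \<delta> * l \<le> c * \<delta> * ?XP" "c * l \<le> c * ?XP" "c * 1 \<le> c * ?XP"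
    by (rule mult_le_mono2 [OF XP'(1)] mult_le_mono2 [OF XP'(2)])+
  have "c * (\<delta> + 1) * l = c * \<delta> * l + c * l" by (simp add: algebra_simps)
  then have y: "length ?y + 1 \<le> 2 * ?XP + c * \<delta> * ?XP + c * ?XP"
    using len_y cl XP' by linarith
  have drop: "ops (drop_op (length ?y - (c * (\<delta> + 1) * l - \<delta>)) ?y) \<le>
      2 * ?XP + c * \<delta> * ?XP + c * ?XP"
    using ops_drop_op_length y by (rule order_trans)
  have "c * l * (\<delta> + 3) = c * \<delta> * l + 3 * (c * l)" by (simp add: algebra_simps)
  then have sampling: "ops (sample_op \<delta> (c * l) (tail ?y)) \<le> c * \<delta> * ?XP + 3 * (c * ?XP) + ?XP"
    using ops_sample_op [of \<delta> "c * l" "tail ?y"] cl XP' by linarith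
  have "c * (2 * l + 3) = 2 * (c * l) + 3 * c" by (simp add: algebra_simps)
  then have chunks: "ops (chunks_op c l (parity_string u)) \<le> 5 * (c * ?XP) + ?XP"
    using ops_chunks_op [of c l "parity_string u"] cl XP' by linarith
  have tk: "ops (take_op (k - \<delta>) ?y) \<le> 2 * ?XP"
    using ops_take_op [of "k - \<delta>" ?y] XP' by linarith
  have pad: "m * l - k + 1 \<le> 3 * ?XP"
    using ml_le XP' by linarith
  have app: "length (take (k - \<delta>) ?y) + 1 \<le> 2 * ?XP"
  proof -
    have "length (take (k - \<delta>) ?y) \<le> k" by simp
    then show ?thesis using XP' by linarith
  qed
  have cases: "ops (cases_op m \<delta>) \<le> 18 * ?XP"
  proof -
    have "ops (cases_op m \<delta>) \<le> 6 * (m + 1) * ?P" by (rule ops_cases_op)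
    also have "\<dots> \<le> (18 * ?X) * ?P"
    proof (rule mult_le_mono1)
      show "6 * (m + 1) \<le> 18 * ?X"
        using m_le kX(1,3) unfolding distrib_left by linarith
    qed
    finally show ?thesis by simp
  qed
  have check: "ops (check_all_op T l \<delta> ps s ds) \<le> check_const * ?XP + 2 * ?XP"
  proof -
    have "ops (check_all_op T l \<delta> ps s ds) \<le> length ds * (check_const * ?X + 1) + 1"
      using ops_check_op [OF length_parities set_parities len_s] ds
      by (intro ops_check_all_op) (simp add: ps_def)
    also have "length ds * (check_const * ?X + 1) \<le> ?P * (check_const * ?X + ?X)"
      using len_ds kX by (intro mult_le_mono) simp_all
    also have "\<dots> + 1 \<le> check_const * ?XP + 2 * ?XP"
      using XP kX by (simp add: algebra_simps)
    finally show ?thesis by simp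
  qed
  have out_ops: "ops (output_op k Zs) \<le> 20 * ?XP"
  proof -
    have Z: "length Z = m \<and> (\<forall>b\<in>set Z. length b = l)" if Zin: "Z \<in> set Zs" for Z
    proof -
      obtain d where "d \<in> deletion_cases m \<delta>" "result (check_op T l \<delta> ps s d) = Some Z"
        using Zin ds by (auto simp: Zs_def set_check_all_op)
      then obtain Y where "possible_case R B G k \<delta> c (parities u) s d Y" "Z = map bts Y"
        using check_op_correct [OF length_parities set_parities len_s] ps_def by auto
      then show ?thesis by (auto simp: possible_case_def erasure_decoded_def)
    qed
    have "ops (output_op k Zs) \<le> length Zs * (m * (l + 2) + 2) + m * l + 2 * m + k + 5"
      by (rule ops_output_op [OF Z])
    moreover have "length Zs * (m * (l + 2) + 2) \<le> ?P * (8 * ?X)"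
    proof (rule mult_le_mono)
      show "length Zs \<le> ?P"
        using length_check_all_op [of T l \<delta> ps s ds] len_ds by (simp add: Zs_def)
      have "m * (l + 2) = m * l + 2 * m" by (simp add: algebra_simps)
      then show "m * (l + 2) + 2 \<le> 8 * ?X" using ml_le m_le kX by linarith
    qed
    moreover have "?P * (8 * ?X) = 8 * ?XP" by simp
    ultimately show ?thesis using ml_le m_le kX XP by linarith
  qed
  have "ops (gc_decode_op T k \<delta> c ?y) \<le>
      (2 * ?XP + c * \<delta> * ?XP + c * ?XP) + (2 * ?XP + c * \<delta> * ?XP + c * ?XP) +
      (c * \<delta> * ?XP + 3 * (c * ?XP) + ?XP) + (5 * (c * ?XP) + ?XP) +
      2 * ?XP + 3 * ?XP + 2 * ?XP + 18 * ?XP + (check_const * ?XP + 2 * ?XP) + 20 * ?XP + ?XP"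
    unfolding total
    by (intro add_mono y drop sampling chunks tk pad app cases check out_ops XP'(2))
  also have "\<dots> \<le> 100 * ?XP + 100 * (c * ?XP) + 4 * (c * \<delta> * ?XP) + check_const * ?XP"
    by linarith
  also have "\<dots> = decode_const * ?XP"
    unfolding decode_const_def by (simp only: add_mult_distrib mult.assoc)
  finally show ?thesis .
qed

section \<open>Real-valued bounds and asymptotics\<close>

lemma log_k: "log 2 (real k) = real l"
  unfolding l_eq by (simp add: k_eq log_nat_power)

text \<open>The binomial is at most \<open>(m + \<delta>) ^ \<delta>\<close>; the constant comes
  from \<open>m + \<delta> \<le> (\<delta> + 1) * m\<close> and
  \<open>m \<le> 2 * k / l\<close>.\<close>

lemma choose_le: "real ((m + \<delta>) choose \<delta>) \<le> (2 * (real \<delta> + 1)) ^ \<delta> * (real k / log 2 (real k)) ^ \<delta>"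
proof -
  have l: "real l > 0" using l_pos by simp
  have "m \<ge> 1" using m_bounds(1) k_pos by (cases m) auto
  then have "real m + real \<delta> \<le> (real \<delta> + 1) * real m"
    using mult_left_mono [of 1 "real m" "real \<delta>"] by (simp add: algebra_simps)
  moreover have "real m \<le> 2 * (real k / real l)"
    using ml_le l by (simp add: field_simps) (metis of_nat_le_iff of_nat_mult of_nat_numeral)
  then have "(real \<delta> + 1) * real m \<le> (real \<delta> + 1) * (2 * (real k / real l))"
    by (intro mult_left_mono) auto
  ultimately have "real m + real \<delta> \<le> (real \<delta> + 1) * (2 * (real k / real l))"
    by linarith
  then have "real (m + \<delta>) \<le> 2 * (real \<delta> + 1) * (real k / log 2 (real k))"
    unfolding log_k by (simp add: mult.commute mult.left_commute)
  then have "real (m + \<delta>) ^ \<delta> \<le> (2 * (real \<delta> + 1) * (real k / log 2 (real k))) ^ \<delta>"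
    by (intro power_mono) auto
  moreover have "(m + \<delta>) choose \<delta> \<le> (m + \<delta>) ^ \<delta>"
    by (intro binomial_le_pow) simp
  then have "real ((m + \<delta>) choose \<delta>) \<le> real (m + \<delta>) ^ \<delta>"
    by (metis of_nat_le_iff of_nat_power)
  ultimately have "real ((m + \<delta>) choose \<delta>) \<le> (2 * (real \<delta> + 1) * (real k / log 2 (real k))) ^ \<delta>"
    by linarith
  then show ?thesis by (simp only: power_mult_distrib)
qed

lemma ops_encode_real:
  assumes "length u = k"
  shows "real (ops (gc_encode_op T k \<delta> u)) \<le>
    real (40 + 40 * c + 2 * c * \<delta>) * (real k * log 2 (real k))"
proof -
  have "real (ops (gc_encode_op T k \<delta> u)) \<le> real ((40 + 40 * c + 2 * c * \<delta>) * (k * l))"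
    using ops_gc_encode_op(1) [OF assms] by (simp only: of_nat_le_iff)
  then show ?thesis by (simp only: log_k of_nat_mult)
qed

lemma ops_decode_real:
  assumes "length u = k" "D \<subseteq> {..<k + c * (\<delta> + 1) * l}" "card D \<le> \<delta>"
  shows "real (ops (gc_decode_op T k \<delta> c (received u D))) \<le>
    real decode_const * (2 * (real \<delta> + 1)) ^ \<delta> * (real k ^ (\<delta> + 2) / log 2 (real k) ^ \<delta>)"
proof -
  have "real (ops (gc_decode_op T k \<delta> c (received u D))) \<le>
      real (decode_const * (k * k * ((m + \<delta>) choose \<delta>)))"
    using ops_gc_decode_op [OF assms] by (simp only: of_nat_le_iff)
  also have "\<dots> = real decode_const * (real k * real k) * real ((m + \<delta>) choose \<delta>)"
    by simp
  also have "\<dots> \<le> real decode_const * (real k * real k) *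
      ((2 * (real \<delta> + 1)) ^ \<delta> * (real k / log 2 (real k)) ^ \<delta>)"
    by (intro mult_left_mono choose_le) auto
  also have "\<dots> = real decode_const * (2 * (real \<delta> + 1)) ^ \<delta> * (real k ^ (\<delta> + 2) / log 2 (real k) ^ \<delta>)"
    by (simp add: power_divide power_add power2_eq_square)
  finally show ?thesis .
qed

text \<open>The factor \<open>k ^ \<delta>\<close> in the number of guesses raises the exponent
  \<open>\<delta> - c\<close> of a single guess to \<open>2 * \<delta> - c\<close>.\<close>

lemma prob_failure_real:
  assumes "s \<le> \<delta>"
  shows "measure_pmf.prob
      (pair_pmf (replicate_pmf k (bernoulli_pmf (1 / 2)))
        (pmf_of_set {D. D \<subseteq> {..<k + c * (\<delta> + 1) * l} \<and> card D = s}))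
      {(u, D). gc_decode R B G k \<delta> c (delete_at D (gc_encode R B G k \<delta> c u)) = None} \<le>
    (2 * (real \<delta> + 1)) ^ \<delta> * (real k powr (2 * real \<delta> - real c) / log 2 (real k) ^ \<delta>) +
    real ((\<delta> + 1) ^ (\<delta> * (2 * c + 1))) * real k powr (2 * real \<delta> - real c - 1)"
proof -
  have k: "real k > 0" using k_pos by simp
  have "real ((m + \<delta>) choose \<delta>) * real k powr (real \<delta> - real c) \<le>
      (2 * (real \<delta> + 1)) ^ \<delta> * (real k / log 2 (real k)) ^ \<delta> * real k powr (real \<delta> - real c)"
    by (intro mult_right_mono choose_le) auto
  also have "\<dots> = (2 * (real \<delta> + 1)) ^ \<delta> *
      ((real k powr real \<delta> * real k powr (real \<delta> - real c)) / log 2 (real k) ^ \<delta>)"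
    using k by (simp add: power_divide powr_realpow)
  also have "real k powr real \<delta> * real k powr (real \<delta> - real c) = real k powr (2 * real \<delta> - real c)"
    by (simp flip: powr_add)
  finally show ?thesis using prob_failure [OF assms] by linarith
qed

end

lemma cmult_bigo: "(\<lambda>k. C * f k) \<in> O[F](f)" for C :: real
  by (rule bigoI [of _ "norm C"]) (simp add: abs_mult)

lemma log_power_bigo: "(\<lambda>k. log 2 (real k) ^ n) \<in> O(\<lambda>k. real k)"
proof -
  have "(\<lambda>k. ln (real k) ^ n) \<in> O(\<lambda>k. real k)"
  proof (cases "n = 0")
    case True
    then show ?thesis by simp real_asymp
  next
    case False
    have "(\<lambda>x::real. ln x ^ n) \<in> O(\<lambda>x. x)"
      by real_asymp
    then show ?thesis
      by (rule landau_o.big.compose) (rule filterlim_real_sequentially)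
  qed
  then have "(\<lambda>k. inverse (ln 2 ^ n) * ln (real k) ^ n) \<in> O(\<lambda>k. real k)"
    by (rule landau_o.big_trans [OF cmult_bigo])
  moreover have "log 2 (real k) ^ n = inverse (ln 2 ^ n) * ln (real k) ^ n" for k
    by (simp add: log_def power_divide field_simps)
  ultimately show ?thesis by simp
qed

text \<open>Absorbs the contribution of the guesses with few free blocks: the missing factor
  \<open>k\<close> outweighs every fixed power of the logarithm.\<close>

lemma powr_minus_one_bigo:
  "(\<lambda>k. real k powr (a - 1)) \<in> O(\<lambda>k. real k powr a / log 2 (real k) ^ n)"
proof -
  obtain C where C: "eventually (\<lambda>k. norm (log 2 (real k) ^ n) \<le> C * norm (real k)) sequentially"
    using log_power_bigo [of n] by (auto elim: landau_o.bigE)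
  show ?thesis
  proof (rule bigoI)
    show "eventually (\<lambda>k. norm (real k powr (a - 1)) \<le> C * norm (real k powr a / log 2 (real k) ^ n))
        sequentially"
      using C eventually_ge_at_top [of "2::nat"]
    proof eventually_elim
      case (elim k)
      define L where "L = log 2 (real k) ^ n"
      have "log 2 (real k) > 0" using elim by simp
      then have L: "L > 0" by (simp add: L_def)
      have "L \<le> C * real k" using elim L by (simp add: L_def)
      then have "real k powr (a - 1) * L \<le> real k powr (a - 1) * (C * real k)"
        by (intro mult_left_mono) auto
      also have "\<dots> = C * real k powr a"
        using elim by (simp add: powr_diff)
      finally have "real k powr (a - 1) \<le> C * (real k powr a / L)"
        using L by (simp add: field_simps)
      then show ?case using L by (simp add: L_def)
    qed
  qed
qed

theorem theorem1:
  fixes \<delta> c :: nat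
  assumes "\<delta> \<ge> 1" and "c > \<delta>"
  shows "\<exists>T_enc T_dec P_fail :: nat \<Rightarrow> real.
    T_enc \<in> O(\<lambda>k. real k * log 2 (real k)) \<and>
    T_dec \<in> O(\<lambda>k. real k ^ (\<delta> + 2) / log 2 (real k) ^ \<delta>) \<and>
    P_fail \<in> O(\<lambda>k. real k powr (2 * real \<delta> - real c) / log 2 (real k) ^ \<delta>) \<and>
    (\<forall>k (R :: 'a ring) B G.
      (\<exists>e. k = 2 ^ e) \<and> k > nblocks k + c \<and> gc_code R B G k c \<longrightarrow>
      (\<exists>n.
        (\<forall>u. length u = k \<longrightarrow> length (gc_encode R B G k \<delta> c u) = n) \<and>
        real n - real k = real c * (real \<delta> + 1) * log 2 (real k) \<and>
        (\<forall>u D. length u = k \<and> D \<subseteq> {..<n} \<and> card D \<le> \<delta> \<longrightarrow>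
          (let y = delete_at D (gc_encode R B G k \<delta> c u) in
            gc_decode R B G k \<delta> c y \<noteq> None \<longrightarrow> gc_decode R B G k \<delta> c y = Some u)) \<and>
        (\<forall>u. length u = k \<longrightarrow>
          (let E = gc_encode_op (code_table R B G k c) k \<delta> u in
            result E = gc_encode R B G k \<delta> c u \<and> real (ops E) \<le> T_enc k)) \<and>
        (\<forall>u D. length u = k \<and> D \<subseteq> {..<n} \<and> card D \<le> \<delta> \<longrightarrow>
          (let y = delete_at D (gc_encode R B G k \<delta> c u);
               A = gc_decode_op (code_table R B G k c) k \<delta> c y in
            result A = gc_decode R B G k \<delta> c y \<and> real (ops A) \<le> T_dec k)) \<and>
        (\<forall>s\<le>\<delta>.
          measure_pmf.prob
            (pair_pmf (replicate_pmf k (bernoulli_pmf (1 / 2)))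
                      (pmf_of_set {D. D \<subseteq> {..<n} \<and> card D = s}))
            {(u, D). gc_decode R B G k \<delta> c (delete_at D (gc_encode R B G k \<delta> c u)) = None}
          \<le> P_fail k)))"
proof (intro exI conjI allI impI)
  let ?Te = "\<lambda>k. real (40 + 40 * c + 2 * c * \<delta>) * (real k * log 2 (real k))"
  \<comment> \<open>The witnesses have to serve all codes at once; \<open>decode_const\<close>,
    exported from the locale, depends on \<open>\<delta>\<close> and \<open>c\<close> alone.\<close>
  let ?Td = "\<lambda>k. real (gc.decode_const \<delta> c) * (2 * (real \<delta> + 1)) ^ \<delta> *
    (real k ^ (\<delta> + 2) / log 2 (real k) ^ \<delta>)"
  let ?Pf = "\<lambda>k. (2 * (real \<delta> + 1)) ^ \<delta> * (real k powr (2 * real \<delta> - real c) / log 2 (real k) ^ \<delta>) +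
    real ((\<delta> + 1) ^ (\<delta> * (2 * c + 1))) * real k powr (2 * real \<delta> - real c - 1)"
  show "?Te \<in> O(\<lambda>k. real k * log 2 (real k))"
    by (rule cmult_bigo)
  show "?Td \<in> O(\<lambda>k. real k ^ (\<delta> + 2) / log 2 (real k) ^ \<delta>)"
    by (rule cmult_bigo)
  show "?Pf \<in> O(\<lambda>k. real k powr (2 * real \<delta> - real c) / log 2 (real k) ^ \<delta>)"
    by (rule sum_in_bigo) (rule cmult_bigo, rule landau_o.big_trans [OF cmult_bigo powr_minus_one_bigo])
  fix k and R :: "'a ring" and B G
  assume *: "(\<exists>e. k = 2 ^ e) \<and> k > nblocks k + c \<and> gc_code R B G k c"
  then obtain e where e: "k = 2 ^ e" by blast
  interpret gc R B G k \<delta> c e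
    using * e assms by unfold_locales auto
  let ?n = "k + c * (\<delta> + 1) * lg k"
  show "length (gc_encode R B G k \<delta> c u) = ?n" if "length u = k" for u
    using length_gc_encode [OF that] .
  show "real ?n - real k = real c * (real \<delta> + 1) * log 2 (real k)"
    by (simp add: log_k algebra_simps)
  show "let y = delete_at D (gc_encode R B G k \<delta> c u) in
      gc_decode R B G k \<delta> c y \<noteq> None \<longrightarrow> gc_decode R B G k \<delta> c y = Some u"
    if "length u = k \<and> D \<subseteq> {..<?n} \<and> card D \<le> \<delta>" for u D
    using gc_decode_correct [of u D] received_def [of u D] that by (simp only: Let_def) blast
  show "let E = gc_encode_op (code_table R B G k c) k \<delta> u in
      result E = gc_encode R B G k \<delta> c u \<and> real (ops E) \<le> ?Te k" if "length u = k" for u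
    unfolding Let_def using ops_gc_encode_op(2) [OF that] ops_encode_real [OF that] by blast
  show "let y = delete_at D (gc_encode R B G k \<delta> c u);
        A = gc_decode_op (code_table R B G k c) k \<delta> c y in
      result A = gc_decode R B G k \<delta> c y \<and> real (ops A) \<le> ?Td k"
    if "length u = k \<and> D \<subseteq> {..<?n} \<and> card D \<le> \<delta>" for u D
  proof -
    have u: "length u = k" "D \<subseteq> {..<?n}" "card D \<le> \<delta>" using that by auto
    show ?thesis
      unfolding Let_def received_def [OF u, symmetric]
      using gc_decode_op_received [OF u] ops_decode_real [OF u] by blast
  qed
  show "measure_pmf.prob
      (pair_pmf (replicate_pmf k (bernoulli_pmf (1 / 2)))
        (pmf_of_set {D. D \<subseteq> {..<?n} \<and> card D = s}))
      {(u, D). gc_decode R B G k \<delta> c (delete_at D (gc_encode R B G k \<delta> c u)) = None} \<le> ?Pf k"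
    if "s \<le> \<delta>" for s
    using prob_failure_real [OF that] .
qed

end
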